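(* For any $1\leqslant p\leqslant2$, there exist two positive constants $\delta_0=\delta_0(p)$ and $\varepsilon_0=\varepsilon_0(p)$ such that for any $0<\varepsilon\leqslant\varepsilon_0$ there exists an external force $F^{\varepsilon}\in\dot{B}_{p,1}^{\frac{2}{p}-3}(\mathbb{R}^2)$ satisfying $\|F^{\varepsilon}\|_{\dot{B}_{p,1}^{\frac{2}{p}-3}}<\varepsilon$ such that the two-dimensional stationary Navier--Stokes equations $$-\Delta U+(U\cdot\nabla)U+\nabla P=F^{\varepsilon},\qquad\operatorname{div}U=0\qquad(x\in\mathbb{R}^2)$$ possess no solution in the class $$\left\{U\in\dot{B}_{p,1}^{\frac{2}{p}-1}(\mathbb{R}^2)\ ;\ \|U\|_{\dot{B}_{p,1}^{\frac{2}{p}-1}}<\delta_0\right\}.$$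
   Context: Besov spaces: let $\{\Phi_j\}_{j\in\mathbb{Z}}\subset\mathscr{S}(\mathbb{R}^2)$ satisfy $0\leqslant\widehat{\Phi_0}\leqslant1$, $\operatorname{supp}\widehat{\Phi_0}\subset\{2^{-1}\leqslant|\xi|\leqslant2\}$, $\widehat{\Phi_j}(\xi)=\widehat{\Phi_0}(2^{-j}\xi)$ and $\sum_{j\in\mathbb{Z}}\widehat{\Phi_j}(\xi)=1$ for $\xi\neq0$; put $\Delta_jF:=\mathscr{F}^{-1}[\widehat{\Phi_j}\widehat{F}]$. For $1\leqslant p,q\leqslant\infty$, $s\in\mathbb{R}$, $\dot{B}_{p,q}^s(\mathbb{R}^2)$ is the set of $F\in\mathscr{S}'(\mathbb{R}^2)/\mathscr{P}(\mathbb{R}^2)$ ($\mathscr{P}$ = polynomials) with $\|F\|_{\dot{B}_{p,q}^s}:=\|\{2^{sj}\|\Delta_jF\|_{L^p}\}_{j\in\mathbb{Z}}\|_{\ell^q}<\infty$. If $s<2/p$ or $(s,q)=(2/p,1)$, it is identified with the space of $F\in\mathscr{S}'(\mathbb{R}^2)$ such that $F=\sum_{j\in\mathbb{Z}}\Delta_jF$ in $\mathscr{S}'(\mathbb{R}^2)$ and $\|F\|_{\dot{B}_{p,q}^s}<\infty$. The same notation is used for vector fields. Solutions: let $\mathbb{P}:=I+\nabla\operatorname{div}(-\Delta)^{-1}$ be the Helmholtz projection onto divergence-free vector fields. For a Banach space $S\subset\mathscr{S}'(\mathbb{R}^2)$ (here $S=\dot{B}_{p,1}^{\frac{2}{p}-1}(\mathbb{R}^2)$),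 $U\in S$ is called a solution of the stationary Navier--Stokes equations with external force $F$ if $$U=(-\Delta)^{-1}\mathbb{P}F-(-\Delta)^{-1}\mathbb{P}\operatorname{div}(U\otimes U)\quad\text{in }S.$$ *)

theory Defs
  imports "HOL-Analysis.Analysis"
begin

section \<open>Schwartz functions and tempered distributions on the plane\<close>

text \<open>A distribution is a functional on complex-valued functions of which only the values at
  Schwartz functions matter; accordingly two distributions are equal iff they agree on Schwartz
  functions, and all equations between distributions below are tested on these only.\<close>

type_synonym distr = "(real^2 \<Rightarrow> complex) \<Rightarrow> complex"

definition partial :: "2 \<Rightarrow> (real^2 \<Rightarrow> complex) \<Rightarrow> real^2 \<Rightarrow> complex" where
  "partial i f x = frechet_derivative f (at x) (axis i 1)"

text \<open>A list of directions plays the role of a multi-index.\<close>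

definition partials :: "2 list \<Rightarrow> (real^2 \<Rightarrow> complex) \<Rightarrow> real^2 \<Rightarrow> complex" where
  "partials is f = foldr partial is f"

definition schwartz :: "(real^2 \<Rightarrow> complex) \<Rightarrow> bool" where
  "schwartz f \<longleftrightarrow>
     (\<forall>is. (\<forall>x. partials is f differentiable (at x)) \<and>
           (\<forall>k::nat. bdd_above (range (\<lambda>x. (1 + norm x) ^ k * norm (partials is f x)))))"

definition schwartz_seminorm :: "nat \<Rightarrow> (real^2 \<Rightarrow> complex) \<Rightarrow> real" where
  "schwartz_seminorm N f =
     (\<Sum>is | length is \<le> N. SUP x. (1 + norm x) ^ N * norm (partials is f x))"

definition tempered :: "distr \<Rightarrow> bool" where
  "tempered T \<longleftrightarrow>
     (\<forall>\<phi> \<psi> a b. schwartz \<phi> \<longrightarrow> schwartz \<psi> \<longrightarrow>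
        T (\<lambda>x. a * \<phi> x + b * \<psi> x) = a * T \<phi> + b * T \<psi>) \<and>
     (\<exists>C N. \<forall>\<phi>. schwartz \<phi> \<longrightarrow> norm (T \<phi>) \<le> C * schwartz_seminorm N \<phi>)"

definition real_distr :: "distr \<Rightarrow> bool" where
  "real_distr T \<longleftrightarrow> (\<forall>\<phi>. schwartz \<phi> \<longrightarrow> T (\<lambda>x. cnj (\<phi> x)) = cnj (T \<phi>))"

definition represents :: "(real^2 \<Rightarrow> complex) \<Rightarrow> distr \<Rightarrow> bool" where
  "represents f T \<longleftrightarrow> f \<in> borel_measurable lborel \<and>
     (\<forall>\<phi>. schwartz \<phi> \<longrightarrow>
        integrable lborel (\<lambda>x. f x * \<phi> x) \<and> T \<phi> = (LINT x|lborel. f x * \<phi> x))"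

definition dpartial :: "2 \<Rightarrow> distr \<Rightarrow> distr" where
  "dpartial i T = (\<lambda>\<phi>. - T (partial i \<phi>))"

definition ddiv :: "distr^2 \<Rightarrow> distr" where
  "ddiv F = (\<lambda>\<phi>. \<Sum>k\<in>UNIV. dpartial k (F $ k) \<phi>)"

definition dmult :: "(real^2 \<Rightarrow> complex) \<Rightarrow> distr \<Rightarrow> distr" where
  "dmult m T = (\<lambda>\<phi>. T (\<lambda>x. m x * \<phi> x))"


section \<open>Fourier transform\<close>

definition fourier :: "(real^2 \<Rightarrow> complex) \<Rightarrow> real^2 \<Rightarrow> complex" where
  "fourier f \<xi> = (LINT x|lborel. exp (- \<i> * complex_of_real (x \<bullet> \<xi>)) * f x)"

definition inv_fourier :: "(real^2 \<Rightarrow> complex) \<Rightarrow> real^2 \<Rightarrow> complex" where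
  "inv_fourier f x =
     (LINT \<xi>|lborel. exp (\<i> * complex_of_real (x \<bullet> \<xi>)) * f \<xi>) / complex_of_real ((2 * pi)\<^sup>2)"

definition dfourier :: "distr \<Rightarrow> distr" where
  "dfourier T = (\<lambda>\<phi>. T (fourier \<phi>))"

definition dinv_fourier :: "distr \<Rightarrow> distr" where
  "dinv_fourier T = (\<lambda>\<phi>. T (inv_fourier \<phi>))"

definition fmultiplier :: "(real^2 \<Rightarrow> complex) \<Rightarrow> distr \<Rightarrow> distr" where
  "fmultiplier m T = dinv_fourier (dmult m (dfourier T))"


section \<open>Homogeneous Besov spaces\<close>

definition littlewood_paley :: "(int \<Rightarrow> real^2 \<Rightarrow> complex) \<Rightarrow> bool" where
  "littlewood_paley \<Phi> \<longleftrightarrow>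
     (\<forall>j. schwartz (\<Phi> j)) \<and>
     (\<forall>\<xi>. fourier (\<Phi> 0) \<xi> \<in> \<real> \<and> 0 \<le> Re (fourier (\<Phi> 0) \<xi>) \<and> Re (fourier (\<Phi> 0) \<xi>) \<le> 1) \<and>
     closure {\<xi>. fourier (\<Phi> 0) \<xi> \<noteq> 0} \<subseteq> {\<xi>. 1/2 \<le> norm \<xi> \<and> norm \<xi> \<le> 2} \<and>
     (\<forall>j \<xi>. fourier (\<Phi> j) \<xi> = fourier (\<Phi> 0) ((2 powi (-j)) *\<^sub>R \<xi>)) \<and>
     (\<forall>\<xi>. \<xi> \<noteq> 0 \<longrightarrow> ((\<lambda>j. fourier (\<Phi> j) \<xi>) has_sum 1) UNIV)"

definition LP_block :: "(int \<Rightarrow> real^2 \<Rightarrow> complex) \<Rightarrow> int \<Rightarrow> distr \<Rightarrow> distr" where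
  "LP_block \<Phi> j T = fmultiplier (fourier (\<Phi> j)) T"

definition Lp_norm :: "real \<Rightarrow> (real^2 \<Rightarrow> complex^'m) \<Rightarrow> ennreal" where
  "Lp_norm p f =
     (let I = (\<integral>\<^sup>+ x. ennreal (norm (f x) powr p) \<partial>lborel)
      in if I = \<infinity> then \<infinity> else ennreal (enn2real I powr (1 / p)))"

text \<open>The representing function is unique almost everywhere if it exists, so the infimum only
  serves to assign the value \<open>\<infinity>\<close> to distributions that are not functions.\<close>

definition dLp_norm :: "real \<Rightarrow> distr^'m \<Rightarrow> ennreal" where
  "dLp_norm p T = Inf {Lp_norm p f | f. \<forall>i. represents (\<lambda>x. f x $ i) (T $ i)}"

text \<open>The norm and space \<open>B\<^sup>s\<^bsub>p,1\<^esub>\<close> of vector fields with \<open>m\<close> components, for finite \<open>p\<close> and summation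
  exponent 1. The space is the realization inside the tempered distributions, which is the
  meaning of the homogeneous Besov space (modulo polynomials) when \<open>s \<le> 2/p\<close>. For a finite norm
  and such \<open>s\<close>, the series of dyadic blocks tested on a Schwartz function converges absolutely,
  so that the use of unconditional summation is immaterial.\<close>

definition besov_norm ::
    "(int \<Rightarrow> real^2 \<Rightarrow> complex) \<Rightarrow> real \<Rightarrow> real \<Rightarrow> distr^'m \<Rightarrow> ennreal" where
  "besov_norm \<Phi> s p F =
     (\<Sum>\<^sub>\<infinity>j::int. ennreal (2 powr (s * of_int j)) * dLp_norm p (\<chi> i. LP_block \<Phi> j (F $ i)))"

definition besov_space ::
    "(int \<Rightarrow> real^2 \<Rightarrow> complex) \<Rightarrow> real \<Rightarrow> real \<Rightarrow> (distr^'m) set" where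
  "besov_space \<Phi> s p =
     {F. (\<forall>i. tempered (F $ i)) \<and>
         (\<forall>i \<phi>. schwartz \<phi> \<longrightarrow> ((\<lambda>j. LP_block \<Phi> j (F $ i) \<phi>) has_sum (F $ i) \<phi>) UNIV) \<and>
         besov_norm \<Phi> s p F < \<infinity>}"


section \<open>Stationary Navier--Stokes equations\<close>

text \<open>The symbol \<open>1 / |\<xi>|\<^sup>2\<close> is singular at the origin, so the inverse of the negative Laplacian is
  defined blockwise, as usual in homogeneous spaces. The series tested on a Schwartz function
  converges absolutely if \<open>T\<close> has a finite \<open>B\<^sup>s\<^bsub>p,q\<^esub>\<close> norm for some \<open>s < 2/p - 2\<close>. Below it is only
  applied in this case: \<open>s = 2/p - 3\<close> for the force, and \<open>s = -1\<close>, \<open>p = 1\<close>, \<open>q = \<infinity>\<close> for the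
  divergence of the integrable function \<open>U \<otimes> U\<close>.\<close>

definition inv_neg_laplacian :: "(int \<Rightarrow> real^2 \<Rightarrow> complex) \<Rightarrow> distr \<Rightarrow> distr" where
  "inv_neg_laplacian \<Phi> T =
     (\<lambda>\<phi>. \<Sum>\<^sub>\<infinity>j::int.
        fmultiplier (\<lambda>\<xi>. fourier (\<Phi> j) \<xi> / complex_of_real ((norm \<xi>)\<^sup>2)) T \<phi>)"

definition helmholtz :: "(int \<Rightarrow> real^2 \<Rightarrow> complex) \<Rightarrow> distr^2 \<Rightarrow> distr^2" where
  "helmholtz \<Phi> F =
     (\<chi> i. (\<lambda>\<phi>. (F $ i) \<phi> + dpartial i (ddiv (\<chi> k. inv_neg_laplacian \<Phi> (F $ k))) \<phi>))"

text \<open>\<open>W = U \<otimes> U\<close>, the pointwise product of the functions that represent the components of \<open>U\<close>.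
  Elements of \<open>B\<^sup>s\<^bsub>p,1\<^esub>\<close> with \<open>s = 2/p - 1\<close> and \<open>p \<le> 2\<close> are square integrable, so for these
  \<open>W\<close> always exists and is unique.\<close>

definition is_tensor_square :: "distr^2 \<Rightarrow> distr^2^2 \<Rightarrow> bool" where
  "is_tensor_square U W \<longleftrightarrow>
     (\<exists>u :: real^2 \<Rightarrow> complex^2.
        (\<forall>i. represents (\<lambda>x. u x $ i) (U $ i)) \<and>
        (\<forall>i k. represents (\<lambda>x. u x $ i * u x $ k) (W $ i $ k)))"

definition stationary_NS_solution ::
    "(int \<Rightarrow> real^2 \<Rightarrow> complex) \<Rightarrow> (distr^2) set \<Rightarrow> distr^2 \<Rightarrow> distr^2 \<Rightarrow> bool" where
  "stationary_NS_solution \<Phi> S F U \<longleftrightarrow> U \<in> S \<and>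
     (\<exists>W. is_tensor_square U W \<and>
        (\<forall>i \<phi>. schwartz \<phi> \<longrightarrow>
           (U $ i) \<phi> =
             inv_neg_laplacian \<Phi> (helmholtz \<Phi> F $ i) \<phi>
             - inv_neg_laplacian \<Phi> (helmholtz \<Phi> (\<chi> l. ddiv (W $ l)) $ i) \<phi>))"

end

theory Submission
  imports Defs "HOL-Probability.Probability"
begin

text \<open>
  Let \<open>F = -\<eta> \<Delta> g\<close>, where \<open>g\<close> is a divergence free Schwartz field with Fourier transform supported
  in an annulus and with \<open>\<integral> g\<^sub>1\<^sup>2 \<noteq> \<integral> g\<^sub>2\<^sup>2\<close>. For \<open>p \<le> 2\<close> a solution \<open>U\<close> in the given class is square
  integrable, and more precisely the \<open>L\<^sup>2\<close> norms of its dyadic blocks are summable with sum \<open>O(\<delta>)\<close>.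
  Off the origin its Fourier transform is \<open>\<eta> g^ - k\<close>, where \<open>k\<close> is the Leray projection of the
  divergence of \<open>W = U \<otimes> U\<close>, divided by \<open>|\<xi>|\<^sup>2\<close>.

  First, since \<open>U\<close> is square integrable and \<open>1/|\<xi>|\<close> is not square integrable near the origin of the
  plane, the leading term of \<open>k\<close> at the origin has to vanish. This term only involves \<open>W^(0) = \<integral> U \<otimes> U\<close>,
  and its vanishing implies \<open>\<integral> U\<^sub>1\<^sup>2 = \<integral> U\<^sub>2\<^sup>2\<close>.

  Second, \<open>|k| \<le> C \<parallel>U\<parallel>\<^sup>2 / |\<xi>|\<close>, so that \<open>\<integral> |k|\<^sup>2 \<le> C \<parallel>U\<parallel>\<^sup>2 \<integral> |k| / |\<xi>|\<close>, and the last integral is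
  controlled by the sum of the \<open>L\<^sup>2\<close> norms of the dyadic blocks, that is by \<open>O(\<delta> + \<eta>)\<close>. Hence
  \<open>\<parallel>U - \<eta> g\<parallel>\<^sup>2 \<le> C (\<delta> + \<eta>) \<parallel>U\<parallel>\<^sup>2\<close>, so \<open>U\<close> is a small relative perturbation of \<open>\<eta> g\<close> and inherits its
  anisotropy, which contradicts the first part.
\<close>

section \<open>Schwartz functions and slowly growing multipliers\<close>

text \<open>The space is scale critical in two matching ways. Bernstein's inequality with p \<le> 2
  turns the weight 2^((2/p - 1) j) exactly into L^2 norms of blocks, and in the plane the L^2 norm
  of 1/|\<xi>| is the same on every dyadic annulus. Cauchy-Schwarz on each annulus therefore costs
  one constant, and summation exponent 1 makes the total finite. The same scaling makes 1/|\<xi>|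
  just fail to be square integrable at the origin.

  Smallness is relative: the error is a small multiple of \<eta>^2 and the anisotropy of the linear
  solution is a fixed multiple of \<eta>^2, so \<eta> cancels and \<delta> stays fixed while the
  force shrinks.

  The obstacle is the origin of frequency space. The inverse Laplacian is a sum of blocks, so the
  equation is first tested only with functions vanishing near 0. The identity is extended across 0
  once k is known to be square integrable; the condition that U is the sum of its blocks then
  excludes a part concentrated at 0. Products are taken without conjugation, so moments are compared
  as complex numbers.\<close>

lemma partials_Nil [simp]: "partials [] f = f"
  by (simp add: partials_def)

lemma partials_Cons: "partials (i # is) f = partial i (partials is f)"
  by (simp add: partials_def)

lemma partials_snoc: "partials (is @ [i]) f = partials is (partial i f)"
  by (simp add: partials_def)

definition rapid :: "(real^2 \<Rightarrow> complex) \<Rightarrow> bool" where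
  "rapid f \<longleftrightarrow> (\<forall>k. \<exists>C. \<forall>x. (1 + norm x) ^ k * norm (f x) \<le> C)"

definition poly_bounded :: "(real^2 \<Rightarrow> complex) \<Rightarrow> bool" where
  "poly_bounded f \<longleftrightarrow> (\<exists>k C. \<forall>x. norm (f x) \<le> C * (1 + norm x) ^ k)"

text \<open>The multiplier space of the Schwartz class, usually written O_M: the degree of growth
  may depend on the derivative. Coordinates, waves and cutoffs all live here.\<close>

definition slow :: "(real^2 \<Rightarrow> complex) \<Rightarrow> bool" where
  "slow f \<longleftrightarrow> (\<forall>is. (\<forall>x. partials is f differentiable (at x)) \<and> poly_bounded (partials is f))"

lemma schwartz_alt:
  "schwartz f \<longleftrightarrow> (\<forall>is. (\<forall>x. partials is f differentiable (at x)) \<and> rapid (partials is f))"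
  by (simp add: schwartz_def rapid_def bdd_above_def)

text \<open>Derivatives of all orders arise from single steps, so it suffices to exhibit a class
  that is stable under one \<open>partial\<close> and whose members are differentiable and decay.
  Later membership proofs choose such a class instead of expanding a multi-index Leibniz
  formula.\<close>

lemma schwartz_coinduct:
  assumes "f \<in> P"
    and "\<And>g. g \<in> P \<Longrightarrow> (\<forall>x. g differentiable (at x)) \<and> rapid g \<and> (\<forall>i. partial i g \<in> P)"
  shows "schwartz f"
proof -
  have "partials is f \<in> P" for "is"
    by (induction "is") (use assms in \<open>auto simp: partials_Cons\<close>)
  then show ?thesis
    using assms(2) by (auto simp: schwartz_alt)
qed

lemma slow_coinduct:
  assumes "f \<in> P"
    and "\<And>g. g \<in> P \<Longrightarrow> (\<forall>x. g differentiable (at x)) \<and> poly_bounded g \<and> (\<forall>i. partial i g \<in> P)"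
  shows "slow f"
proof -
  have "partials is f \<in> P" for "is"
    by (induction "is") (use assms in \<open>auto simp: partials_Cons\<close>)
  then show ?thesis
    using assms(2) by (auto simp: slow_def)
qed

lemma schwartz_differentiable: "schwartz f \<Longrightarrow> f differentiable (at x)"
  and schwartz_rapid: "schwartz f \<Longrightarrow> rapid f"
  and schwartz_partial: "schwartz f \<Longrightarrow> schwartz (partial i f)"
  unfolding schwartz_alt by (metis partials_Nil, metis partials_Nil, metis partials_snoc)

lemma slow_differentiable: "slow f \<Longrightarrow> f differentiable (at x)"
  and slow_poly_bounded: "slow f \<Longrightarrow> poly_bounded f"
  and slow_partial: "slow f \<Longrightarrow> slow (partial i f)"
  unfolding slow_def by (metis partials_Nil, metis partials_Nil, metis partials_snoc)

lemma slowI: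
  assumes "\<And>x. f differentiable (at x)" "poly_bounded f" "\<And>i. slow (partial i f)"
  shows "slow f"
  by (rule slow_coinduct[where P = "insert f (Collect slow)"])
     (use assms slow_differentiable slow_poly_bounded slow_partial in auto)

section \<open>Rules for coordinate derivatives\<close>

lemma partial_eqI: "(f has_derivative D) (at x) \<Longrightarrow> partial i f x = D (axis i 1)"
  by (simp add: partial_def frechet_derivative_at[symmetric])

lemma differentiable_has_derivative:
  "f differentiable (at x) \<Longrightarrow> (f has_derivative frechet_derivative f (at x)) (at x)"
  by (simp add: frechet_derivative_works)

lemma partial_add:
  assumes "\<And>x. f differentiable (at x)" "\<And>x. g differentiable (at x)"
  shows "partial i (\<lambda>x. f x + g x) = (\<lambda>x. partial i f x + partial i g x)"
proof
  fix x
  show "partial i (\<lambda>x. f x + g x) x = partial i f x + partial i g x"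
    by (rule partial_eqI[OF has_derivative_add, THEN trans])
       (use assms differentiable_has_derivative in \<open>auto simp: partial_def\<close>)
qed

lemma partial_mult:
  assumes "\<And>x. f differentiable (at x)" "\<And>x. g differentiable (at x)"
  shows "partial i (\<lambda>x. f x * g x) = (\<lambda>x. f x * partial i g x + partial i f x * g x)"
proof
  fix x
  show "partial i (\<lambda>x. f x * g x) x = f x * partial i g x + partial i f x * g x"
    by (rule partial_eqI[OF has_derivative_mult, THEN trans])
       (use assms differentiable_has_derivative in \<open>auto simp: partial_def\<close>)
qed

lemma partial_const [simp]: "partial i (\<lambda>x. c) = (\<lambda>x. 0)"
  by (rule ext) (rule partial_eqI[OF has_derivative_const])

lemma partial_cnj:
  assumes "\<And>x. f differentiable (at x)"
  shows "partial i (\<lambda>x. cnj (f x)) = (\<lambda>x. cnj (partial i f x))"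
proof
  fix x
  show "partial i (\<lambda>x. cnj (f x)) x = cnj (partial i f x)"
    by (rule partial_eqI[OF has_derivative_cnj, THEN trans])
       (use assms differentiable_has_derivative in \<open>auto simp: partial_def\<close>)
qed

lemma has_derivative_exp_comp:
  fixes f :: "real^2 \<Rightarrow> complex"
  assumes "f differentiable (at x)"
  shows "((\<lambda>x. exp (f x)) has_derivative (\<lambda>h. exp (f x) * frechet_derivative f (at x) h)) (at x)"
  using has_derivative_compose[OF differentiable_has_derivative[OF assms],
       of exp "\<lambda>h. exp (f x) * h"] DERIV_exp[of "f x"]
  by (simp add: has_field_derivative_def)

lemma partial_exp:
  assumes "\<And>x. f differentiable (at x)"
  shows "partial i (\<lambda>x. exp (f x)) = (\<lambda>x. partial i f x * exp (f x))"
proof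
  fix x
  from partial_eqI[OF has_derivative_exp_comp[OF assms], of i] show "partial i (\<lambda>x. exp (f x)) x = partial i f x * exp (f x)"
    by (simp add: partial_def mult.commute)
qed

lemma partial_scale:
  assumes "\<And>x. f differentiable (at x)"
  shows "partial i (\<lambda>x. f (c *\<^sub>R x)) = (\<lambda>x. of_real c * partial i f (c *\<^sub>R x))"
proof
  fix x
  have lin: "linear (frechet_derivative f (at (c *\<^sub>R x)))"
    using assms linear_frechet_derivative by blast
  have "((\<lambda>x. f (c *\<^sub>R x)) has_derivative (\<lambda>h. frechet_derivative f (at (c *\<^sub>R x)) (c *\<^sub>R h))) (at x)"
    by (rule has_derivative_compose[OF _ differentiable_has_derivative[OF assms]])
       (auto intro!: derivative_eq_intros)
  from partial_eqI[OF this, of i] show "partial i (\<lambda>x. f (c *\<^sub>R x)) x = of_real c * partial i f (c *\<^sub>R x)"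
    using linear_scale[OF lin] by (simp add: partial_def scaleR_conv_of_real del: scaleR_vec_def)
qed

section \<open>Arithmetic of growth and decay\<close>

lemma poly_boundedI: "(\<And>x. norm (f x) \<le> C * (1 + norm x) ^ k) \<Longrightarrow> poly_bounded f"
  unfolding poly_bounded_def by blast

lemma poly_boundedE:
  assumes "poly_bounded f"
  obtains k C where "C \<ge> 0" "\<And>x. norm (f x) \<le> C * (1 + norm x) ^ k"
proof -
  from assms obtain k C where *: "\<And>x. norm (f x) \<le> C * (1 + norm x) ^ k"
    unfolding poly_bounded_def by blast
  have "norm (f 0) \<le> C" using *[of 0] by simp
  then have "C \<ge> 0" using norm_ge_zero[of "f 0"] by linarith
  with * that show ?thesis by blast
qed

lemma rapidE:
  assumes "rapid f"
  obtains C where "C \<ge> 0" "\<And>x. (1 + norm x) ^ k * norm (f x) \<le> C"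
proof -
  from assms obtain C where *: "\<And>x. (1 + norm x) ^ k * norm (f x) \<le> C"
    unfolding rapid_def by blast
  have "norm (f 0) \<le> C" using *[of 0] by simp
  then have "C \<ge> 0" using norm_ge_zero[of "f 0"] by linarith
  with * that show ?thesis by blast
qed

lemma poly_bounded_add:
  assumes "poly_bounded f" "poly_bounded g"
  shows "poly_bounded (\<lambda>x. f x + g x)"
proof -
  from assms(1) obtain k C where f: "C \<ge> 0" "\<And>x. norm (f x) \<le> C * (1 + norm x) ^ k"
    by (rule poly_boundedE) blast
  from assms(2) obtain l D where g: "D \<ge> 0" "\<And>x. norm (g x) \<le> D * (1 + norm x) ^ l"
    by (rule poly_boundedE) blast
  show ?thesis
  proof (rule poly_boundedI)
    fix x :: "real^2"
    have "norm (f x + g x) \<le> norm (f x) + norm (g x)" by (rule norm_triangle_ineq)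
    also have "\<dots> \<le> C * (1 + norm x) ^ k + D * (1 + norm x) ^ l" using f g by (simp add: add_mono)
    also have "\<dots> \<le> C * (1 + norm x) ^ (k+l) + D * (1 + norm x) ^ (k+l)"
      using f g by (intro add_mono mult_left_mono power_increasing) auto
    also have "\<dots> = (C + D) * (1 + norm x) ^ (k+l)" by (simp add: distrib_right)
    finally show "norm (f x + g x) \<le> (C + D) * (1 + norm x) ^ (k+l)" .
  qed
qed

lemma poly_bounded_mult:
  assumes "poly_bounded f" "poly_bounded g"
  shows "poly_bounded (\<lambda>x. f x * g x)"
proof -
  from assms(1) obtain k C where f: "C \<ge> 0" "\<And>x. norm (f x) \<le> C * (1 + norm x) ^ k"
    by (rule poly_boundedE) blast
  from assms(2) obtain l D where g: "D \<ge> 0" "\<And>x. norm (g x) \<le> D * (1 + norm x) ^ l"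
    by (rule poly_boundedE) blast
  show ?thesis
  proof (rule poly_boundedI)
    fix x :: "real^2"
    have "norm (f x * g x) = norm (f x) * norm (g x)" by (rule norm_mult)
    also have "\<dots> \<le> (C * (1 + norm x) ^ k) * (D * (1 + norm x) ^ l)"
      using f g by (intro mult_mono) auto
    also have "\<dots> = (C * D) * (1 + norm x) ^ (k+l)" by (simp add: power_add)
    finally show "norm (f x * g x) \<le> (C * D) * (1 + norm x) ^ (k+l)" .
  qed
qed

lemma rapid_add:
  assumes "rapid f" "rapid g" shows "rapid (\<lambda>x. f x + g x)"
  unfolding rapid_def
proof
  fix k
  from assms(1) obtain C where C: "\<And>x. (1 + norm x) ^ k * norm (f x) \<le> C" by (rule rapidE) blast
  from assms(2) obtain D where D: "\<And>x. (1 + norm x) ^ k * norm (g x) \<le> D" by (rule rapidE) blast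
  have "(1 + norm x) ^ k * norm (f x + g x) \<le> C + D" for x
  proof -
    have "(1 + norm x) ^ k * norm (f x + g x) \<le> (1 + norm x) ^ k * (norm (f x) + norm (g x))"
      by (intro mult_left_mono norm_triangle_ineq) auto
    then show ?thesis using C[of x] D[of x] by (simp add: distrib_left)
  qed
  then show "\<exists>C. \<forall>x. (1 + norm x) ^ k * norm (f x + g x) \<le> C" by blast
qed

lemma rapid_mult:
  assumes "poly_bounded f" "rapid g" shows "rapid (\<lambda>x. f x * g x)"
  unfolding rapid_def
proof
  fix k
  from assms(1) obtain l C where f: "C \<ge> 0" "\<And>x. norm (f x) \<le> C * (1 + norm x) ^ l"
    by (rule poly_boundedE) blast
  \<comment> \<open>The factor \<open>f\<close> spends \<open>l\<close> powers of the decay of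
    \<open>g\<close>, so the bound of order \<open>k + l\<close> is taken.\<close>
  from assms(2) obtain D where D: "\<And>x. (1 + norm x) ^ (k+l) * norm (g x) \<le> D" by (rule rapidE) blast
  have "(1 + norm x) ^ k * norm (f x * g x) \<le> C * D" for x
  proof -
    have "(1 + norm x) ^ k * norm (f x * g x) \<le> (1 + norm x) ^ k * ((C * (1 + norm x) ^ l) * norm (g x))"
      unfolding norm_mult using f(2) by (intro mult_left_mono mult_right_mono) auto
    also have "\<dots> = C * ((1 + norm x) ^ (k+l) * norm (g x))" by (simp add: power_add)
    also have "\<dots> \<le> C * D" using D f(1) by (intro mult_left_mono)
    finally show ?thesis .
  qed
  then show "\<exists>C. \<forall>x. (1 + norm x) ^ k * norm (f x * g x) \<le> C" by blast
qed

lemma rapid_poly_bounded: "rapid f \<Longrightarrow> poly_bounded f"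
  unfolding rapid_def poly_bounded_def
  by (rule exI[of _ 0], drule spec[of _ 0]) simp

lemma rapid_mono: "rapid g \<Longrightarrow> (\<And>x. norm (f x) \<le> C * norm (g x)) \<Longrightarrow> rapid f"
  unfolding rapid_def
proof
  fix k assume g: "\<forall>k. \<exists>C. \<forall>x. (1 + norm x) ^ k * norm (g x) \<le> C"
    and f: "\<And>x. norm (f x) \<le> C * norm (g x)"
  from g obtain D where D: "\<And>x. (1 + norm x) ^ k * norm (g x) \<le> D" by blast
  have "(1 + norm x) ^ k * norm (f x) \<le> \<bar>C\<bar> * D" for x
  proof -
    have "norm (f x) \<le> \<bar>C\<bar> * norm (g x)"
      using f[of x] by (meson abs_ge_self mult_right_mono norm_ge_zero order_trans)
    then have "(1 + norm x) ^ k * norm (f x) \<le> (1 + norm x) ^ k * (\<bar>C\<bar> * norm (g x))"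
      by (intro mult_left_mono) auto
    also have "\<dots> = \<bar>C\<bar> * ((1 + norm x) ^ k * norm (g x))" by simp
    also have "\<dots> \<le> \<bar>C\<bar> * D" using D by (intro mult_left_mono) auto
    finally show ?thesis .
  qed
  then show "\<exists>C. \<forall>x. (1 + norm x) ^ k * norm (f x) \<le> C" by blast
qed

lemma schwartz_slow: "schwartz f \<Longrightarrow> slow f"
  by (simp add: schwartz_alt slow_def rapid_poly_bounded)

section \<open>Closure of the two classes under sums and products\<close>

lemma slow_add:
  assumes "slow f" "slow g" shows "slow (\<lambda>x. f x + g x)"
  by (rule slow_coinduct[where P = "{\<lambda>x. f x + g x |f g. slow f \<and> slow g}"])
     (use assms in \<open>auto simp: partial_add slow_differentiable poly_bounded_add slow_poly_bounded
        intro!: slow_partial\<close>, metis slow_partial)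

lemma schwartz_add:
  assumes "schwartz f" "schwartz g" shows "schwartz (\<lambda>x. f x + g x)"
  by (rule schwartz_coinduct[where P = "{\<lambda>x. f x + g x |f g. schwartz f \<and> schwartz g}"])
     (use assms in \<open>auto simp: partial_add schwartz_differentiable rapid_add schwartz_rapid\<close>, metis schwartz_partial)

text \<open>Leibniz' rule produces sums of products; their closure is what the coinduction needs.\<close>

inductive_set product_span :: "(real^2 \<Rightarrow> complex) set \<Rightarrow> (real^2 \<Rightarrow> complex) set \<Rightarrow> (real^2 \<Rightarrow> complex) set"
  for A B where
  product_span_mult: "f \<in> A \<Longrightarrow> g \<in> B \<Longrightarrow> (\<lambda>x. f x * g x) \<in> product_span A B"
| product_span_add: "p \<in> product_span A B \<Longrightarrow> q \<in> product_span A B \<Longrightarrow> (\<lambda>x. p x + q x) \<in> product_span A B"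

lemma product_span_differentiable:
  assumes "p \<in> product_span A B"
    and "\<And>f x. f \<in> A \<Longrightarrow> f differentiable (at x)" "\<And>f x. f \<in> B \<Longrightarrow> f differentiable (at x)"
  shows "p differentiable (at x)"
  using assms by (induction arbitrary: x) auto

lemma product_span_partial:
  assumes "p \<in> product_span A B"
    and "\<And>f x. f \<in> A \<Longrightarrow> f differentiable (at x)" "\<And>f x. f \<in> B \<Longrightarrow> f differentiable (at x)"
    and "\<And>f. f \<in> A \<Longrightarrow> partial i f \<in> A" "\<And>f. f \<in> B \<Longrightarrow> partial i f \<in> B"
  shows "partial i p \<in> product_span A B"
  using assms(1)
proof induction
  case (product_span_mult f g)
  then show ?case
    using assms by (subst partial_mult) (auto intro!: product_span.intros)
next
  case (product_span_add p q)
  then show ?case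
    using assms product_span_differentiable[of _ A B]
    by (subst partial_add) (auto intro!: product_span.intros)
qed

lemma slow_mult:
  assumes "slow f" "slow g" shows "slow (\<lambda>x. f x * g x)"
proof (rule slow_coinduct[where P = "product_span (Collect slow) (Collect slow)"])
  show "(\<lambda>x. f x * g x) \<in> product_span (Collect slow) (Collect slow)"
    using assms by (auto intro: product_span.intros)
  fix h assume h: "h \<in> product_span (Collect slow) (Collect slow)"
  then have "poly_bounded h"
    by induction (auto simp: poly_bounded_add poly_bounded_mult slow_poly_bounded)
  then show "(\<forall>x. h differentiable at x) \<and> poly_bounded h \<and> (\<forall>i. partial i h \<in> product_span (Collect slow) (Collect slow))"
    using product_span_differentiable[OF h, of] product_span_partial[OF h]
    by (simp add: slow_differentiable slow_partial)
qed

lemma schwartz_mult: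
  assumes "slow f" "schwartz g" shows "schwartz (\<lambda>x. f x * g x)"
proof (rule schwartz_coinduct[where P = "product_span (Collect slow) (Collect schwartz)"])
  show "(\<lambda>x. f x * g x) \<in> product_span (Collect slow) (Collect schwartz)"
    using assms by (auto intro: product_span.intros)
  fix h assume h: "h \<in> product_span (Collect slow) (Collect schwartz)"
  then have "rapid h"
    by induction (auto simp: rapid_add rapid_mult slow_poly_bounded schwartz_rapid)
  then show "(\<forall>x. h differentiable at x) \<and> rapid h \<and> (\<forall>i. partial i h \<in> product_span (Collect slow) (Collect schwartz))"
    using product_span_differentiable[OF h] product_span_partial[OF h]
    by (simp add: slow_differentiable slow_partial schwartz_differentiable schwartz_partial)
qed

lemma schwartz_mult': "schwartz f \<Longrightarrow> slow g \<Longrightarrow> schwartz (\<lambda>x. f x * g x)"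
  using schwartz_mult[of g f] by (simp add: mult.commute)

lemma slow_const [simp]: "slow (\<lambda>x. c)"
  by (rule slow_coinduct[where P = "range (\<lambda>c x. c)"])
     (auto intro!: poly_boundedI[of _ "norm _" 0])

lemma schwartz_cmult: "schwartz f \<Longrightarrow> schwartz (\<lambda>x. c * f x)"
  by (rule schwartz_mult) auto

lemma schwartz_lincomb: "schwartz f \<Longrightarrow> schwartz g \<Longrightarrow> schwartz (\<lambda>x. a * f x + b * g x)"
  by (intro schwartz_add schwartz_cmult)

lemma schwartz_diff: "schwartz f \<Longrightarrow> schwartz g \<Longrightarrow> schwartz (\<lambda>x. f x - g x)"
  using schwartz_lincomb[of f g 1 "-1"] by simp

lemma schwartz_zero [simp]: "schwartz (\<lambda>x. 0)"
  by (rule schwartz_coinduct[where P = "{\<lambda>x. 0}"]) (auto simp: rapid_def)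

lemma schwartz_sum:
  "(\<And>i. i \<in> I \<Longrightarrow> schwartz (f i)) \<Longrightarrow> schwartz (\<lambda>x. \<Sum>i\<in>I. f i x)"
  by (induction I rule: infinite_finite_induct) (auto intro!: schwartz_add)

lemma slow_diff: "slow f \<Longrightarrow> slow g \<Longrightarrow> slow (\<lambda>x. f x - g x)"
  using slow_add[of f "\<lambda>x. (-1) * g x"] slow_mult[of "\<lambda>x. -1" g] by simp

lemma slow_sum:
  "(\<And>i. i \<in> I \<Longrightarrow> slow (f i)) \<Longrightarrow> slow (\<lambda>x. \<Sum>i\<in>I. f i x)"
  by (induction I rule: infinite_finite_induct) (auto intro!: slow_add)

lemma slow_prod:
  "(\<And>i. i \<in> I \<Longrightarrow> slow (f i)) \<Longrightarrow> slow (\<lambda>x. \<Prod>i\<in>I. f i x)"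
  by (induction I rule: infinite_finite_induct) (auto intro!: slow_mult)

lemma slow_power: "slow f \<Longrightarrow> slow (\<lambda>x. f x ^ n)"
  by (induction n) (auto intro!: slow_mult)

section \<open>Coordinates, exponentials and Gaussians\<close>

lemma partial_coord: "partial i (\<lambda>x. of_real (x $ k)) = (\<lambda>x. of_real (axis i 1 $ k))"
  by (rule ext, rule partial_eqI[OF has_derivative_of_real[OF bounded_linear_imp_has_derivative]])
     (rule bounded_linear_vec_nth)

lemma slow_coord [simp]: "slow (\<lambda>x. of_real (x $ k))"
proof (rule slowI)
  show "poly_bounded (\<lambda>x. of_real (x $ k))"
    by (rule poly_boundedI[of _ 1 1]) (use component_le_norm_cart[of _ k] in \<open>simp add: add_increasing\<close>)
  show "(\<lambda>x. complex_of_real (x $ k)) differentiable at x" for x :: "real^2"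
    unfolding differentiable_def
    by (rule exI, rule has_derivative_of_real[OF bounded_linear_imp_has_derivative]) (rule bounded_linear_vec_nth)
qed (simp add: partial_coord)

lemma norm_sq_2: "(norm (x :: real^2))\<^sup>2 = (x $ 1)\<^sup>2 + (x $ 2)\<^sup>2"
  unfolding power2_norm_eq_inner by (simp add: inner_vec_def sum_2 power2_eq_square)

lemma slow_norm_sq: "slow (\<lambda>x. of_real ((norm (x - c))\<^sup>2))"
proof -
  have "(\<lambda>x. of_real ((norm (x - c))\<^sup>2)) =
      (\<lambda>x. (of_real (x $ 1) - of_real (c $ 1))\<^sup>2 + (of_real (x $ 2) - of_real (c $ 2) :: complex)\<^sup>2)"
    by (simp add: norm_sq_2 fun_eq_iff)
  then show ?thesis
    by (auto intro!: slow_add slow_power slow_diff)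
qed

lemma slow_inner: "slow (\<lambda>x. of_real (x \<bullet> c))"
proof -
  have "(\<lambda>x. of_real (x \<bullet> c)) = (\<lambda>x. of_real (x $ 1) * of_real (c $ 1) + of_real (x $ 2) * of_real (c $ 2) :: complex)"
    by (simp add: inner_vec_def sum_2 fun_eq_iff)
  then show ?thesis by (auto intro!: slow_add slow_mult)
qed

text \<open>The stable class consists of a slow factor times the exponential: differentiation only
  replaces the factor \<open>g\<close> by \<open>g * q' + g'\<close>, so the growth of
  \<open>exp q\<close> itself is the only analytic input.\<close>

lemma slow_exp:
  assumes q: "slow q" and b: "poly_bounded (\<lambda>x. exp (q x))"
  shows "slow (\<lambda>x. exp (q x))"
proof (rule slow_coinduct[where P = "{\<lambda>x. g x * exp (q x) |g. slow g}"])
  show "(\<lambda>x. exp (q x)) \<in> {\<lambda>x. g x * exp (q x) |g. slow g}"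
    by (auto intro!: exI[of _ "\<lambda>x. 1"])
  have d: "(\<lambda>x. exp (q x)) differentiable at x" for x
    using has_derivative_exp_comp[OF slow_differentiable[OF q]] by (auto simp: differentiable_def)
  fix h assume "h \<in> {\<lambda>x. g x * exp (q x) |g. slow g}"
  then obtain g where g: "slow g" "h = (\<lambda>x. g x * exp (q x))" by blast
  have "partial i h = (\<lambda>x. (g x * partial i q x + partial i g x) * exp (q x))" for i
    unfolding g(2) using g(1) q d
    by (subst partial_mult) (auto simp: slow_differentiable partial_exp algebra_simps)
  moreover have "slow (\<lambda>x. g x * partial i q x + partial i g x)" for i
    by (intro slow_add slow_mult slow_partial g q)
  ultimately show "(\<forall>x. h differentiable at x) \<and> poly_bounded h \<and> (\<forall>i. partial i h \<in> {\<lambda>x. g x * exp (q x) |g. slow g})"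
    using g d b by (auto intro!: poly_bounded_mult simp: slow_poly_bounded slow_differentiable)
qed

lemma schwartz_exp:
  assumes q: "slow q" and b: "rapid (\<lambda>x. exp (q x))"
  shows "schwartz (\<lambda>x. exp (q x))"
proof (rule schwartz_coinduct[where P = "{\<lambda>x. g x * exp (q x) |g. slow g}"])
  show "(\<lambda>x. exp (q x)) \<in> {\<lambda>x. g x * exp (q x) |g. slow g}"
    by (auto intro!: exI[of _ "\<lambda>x. 1"])
  have d: "(\<lambda>x. exp (q x)) differentiable at x" for x
    using has_derivative_exp_comp[OF slow_differentiable[OF q]] by (auto simp: differentiable_def)
  fix h assume "h \<in> {\<lambda>x. g x * exp (q x) |g. slow g}"
  then obtain g where g: "slow g" "h = (\<lambda>x. g x * exp (q x))" by blast
  have "partial i h = (\<lambda>x. (g x * partial i q x + partial i g x) * exp (q x))" for i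
    unfolding g(2) using g(1) q d
    by (subst partial_mult) (auto simp: slow_differentiable partial_exp algebra_simps)
  moreover have "slow (\<lambda>x. g x * partial i q x + partial i g x)" for i
    by (intro slow_add slow_mult slow_partial g q)
  ultimately show "(\<forall>x. h differentiable at x) \<and> rapid h \<and> (\<forall>i. partial i h \<in> {\<lambda>x. g x * exp (q x) |g. slow g})"
    using g d b by (auto intro!: rapid_mult simp: slow_poly_bounded slow_differentiable)
qed

lemma slow_exp_bounded:
  assumes "slow q" "\<And>x. Re (q x) \<le> 0"
  shows "slow (\<lambda>x. exp (q x))"
  by (rule slow_exp) (use assms in \<open>auto intro!: poly_boundedI[of _ 1 0]\<close>)

lemma rapid_gaussian:
  assumes "a > 0" shows "rapid (\<lambda>x. exp (- of_real (a * (norm x)\<^sup>2)))"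
  unfolding rapid_def
proof
  fix k
  have "((\<lambda>r::real. (1 + r) ^ k * exp (- (a * r\<^sup>2))) \<longlongrightarrow> 0) at_top"
    using assms by real_asymp
  then have "\<forall>\<^sub>F r in at_top. (1 + r) ^ k * exp (- (a * r\<^sup>2)) < 1"
    by (rule order_tendstoD) simp
  then obtain R where R: "\<And>r. r \<ge> R \<Longrightarrow> (1 + r) ^ k * exp (- (a * r\<^sup>2)) < 1"
    by (auto simp: eventually_at_top_linorder)
  have "(1 + norm x) ^ k * norm (exp (- complex_of_real (a * (norm x)\<^sup>2))) \<le> max 1 ((1 + \<bar>R\<bar>) ^ k)" for x :: "real^2"
  proof -
    have eq: "norm (exp (- complex_of_real (a * (norm x)\<^sup>2))) = exp (- (a * (norm x)\<^sup>2))"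
      by (simp add: norm_exp_eq_Re)
    show ?thesis
    proof (cases "norm x \<ge> R")
      case True
      then show ?thesis using R[OF True] by (intro max.coboundedI1) (simp add: eq)
    next
      case False
      have "(1 + norm x) ^ k * exp (- (a * (norm x)\<^sup>2)) \<le> (1 + \<bar>R\<bar>) ^ k * 1"
        using False assms by (intro mult_mono power_mono) auto
      then show ?thesis by (simp add: eq)
    qed
  qed
  then show "\<exists>C. \<forall>x::real^2. (1 + norm x) ^ k * norm (exp (- complex_of_real (a * (norm x)\<^sup>2))) \<le> C" by blast
qed

lemma schwartz_gaussian:
  assumes "a > 0" shows "schwartz (\<lambda>x. exp (- of_real (a * (norm x)\<^sup>2)))"
proof -
  have "slow (\<lambda>x. of_real (-a) * of_real ((norm (x - 0))\<^sup>2))"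
    by (intro slow_mult slow_norm_sq slow_const)
  then show ?thesis
    using assms by (intro schwartz_exp rapid_gaussian) auto
qed

section \<open>Dilation, conjugation and division by the squared norm\<close>

lemma rapid_scale:
  assumes "rapid f" "c \<noteq> 0" shows "rapid (\<lambda>x. f (c *\<^sub>R x))"
  unfolding rapid_def
proof
  fix k
  from assms(1) obtain C where C: "\<And>x. (1 + norm x) ^ k * norm (f x) \<le> C" by (rule rapidE) blast
  have "(1 + norm x) ^ k * norm (f (c *\<^sub>R x)) \<le> (1 + 1 / \<bar>c\<bar>) ^ k * C" for x :: "real^2"
  proof -
    have "1 + norm x \<le> (1 + 1 / \<bar>c\<bar>) * (1 + norm (c *\<^sub>R x))"
      using assms by (simp add: field_simps)
    then have "(1 + norm x) ^ k \<le> (1 + 1 / \<bar>c\<bar>) ^ k * (1 + norm (c *\<^sub>R x)) ^ k"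
      by (metis add_nonneg_nonneg norm_ge_zero power_mono power_mult_distrib zero_le_one)
    then have "(1 + norm x) ^ k * norm (f (c *\<^sub>R x)) \<le> (1 + 1 / \<bar>c\<bar>) ^ k * ((1 + norm (c *\<^sub>R x)) ^ k * norm (f (c *\<^sub>R x)))"
      by (metis mult.assoc mult_right_mono norm_ge_zero)
    also have "\<dots> \<le> (1 + 1 / \<bar>c\<bar>) ^ k * C" by (intro mult_left_mono C) auto
    finally show ?thesis .
  qed
  then show "\<exists>C. \<forall>x. (1 + norm x) ^ k * norm (f (c *\<^sub>R x)) \<le> C" by blast
qed

lemma schwartz_scale:
  assumes f: "schwartz f" and c: "c \<noteq> 0" shows "schwartz (\<lambda>x. f (c *\<^sub>R x))"
proof (rule schwartz_coinduct[where P = "{\<lambda>x. g (c *\<^sub>R x) |g. schwartz g}"])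
  show "(\<lambda>x. f (c *\<^sub>R x)) \<in> {\<lambda>x. g (c *\<^sub>R x) |g. schwartz g}"
    using f by blast
  fix h assume "h \<in> {\<lambda>x. g (c *\<^sub>R x) |g. schwartz g}"
  then obtain g where g: "schwartz g" "h = (\<lambda>x. g (c *\<^sub>R x))" by blast
  have "(\<lambda>x. g (c *\<^sub>R x)) differentiable at x" for x
  proof -
    have "((\<lambda>x. g (c *\<^sub>R x)) has_derivative (\<lambda>h. frechet_derivative g (at (c *\<^sub>R x)) (c *\<^sub>R h))) (at x)"
      by (rule has_derivative_compose[OF _ differentiable_has_derivative[OF schwartz_differentiable[OF g(1)]]])
         (auto intro!: derivative_eq_intros)
    then show ?thesis by (auto simp: differentiable_def)
  qed
  moreover have "partial i h \<in> {\<lambda>x. g (c *\<^sub>R x) |g. schwartz g}" for i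
    using schwartz_cmult[OF schwartz_partial[OF g(1)]] g
    by (auto simp: partial_scale schwartz_differentiable intro!: exI[of _ "\<lambda>x. of_real c * partial i g x"])
  ultimately show "(\<forall>x. h differentiable at x) \<and> rapid h \<and> (\<forall>i. partial i h \<in> {\<lambda>x. g (c *\<^sub>R x) |g. schwartz g})"
    using g c by (auto simp: rapid_scale schwartz_rapid)
qed

lemma schwartz_uminus_arg: "schwartz f \<Longrightarrow> schwartz (\<lambda>x. f (- x))"
  using schwartz_scale[of f "-1"] by simp

lemma schwartz_cnj:
  assumes "schwartz f" shows "schwartz (\<lambda>x. cnj (f x))"
proof (rule schwartz_coinduct[where P = "{\<lambda>x. cnj (g x) |g. schwartz g}"])
  fix h assume "h \<in> {\<lambda>x. cnj (g x) |g. schwartz g}"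
  then obtain g where g: "schwartz g" "h = (\<lambda>x. cnj (g x))" by blast
  have "(\<lambda>x. cnj (g x)) differentiable at x" for x
    using schwartz_differentiable[OF g(1), of x]
    unfolding differentiable_def using has_derivative_cnj by blast
  moreover have "rapid h"
    using schwartz_rapid[OF g(1)] by (simp add: g rapid_def)
  ultimately show "(\<forall>x. h differentiable at x) \<and> rapid h \<and> (\<forall>i. partial i h \<in> {\<lambda>x. cnj (g x) |g. schwartz g})"
    using g schwartz_partial[OF g(1)] by (auto simp: partial_cnj schwartz_differentiable)
qed (use assms in blast)

text \<open>Allows a quotient that is identically zero near the origin to be differentiated there
  without touching its singular formula.\<close>

lemma partial_local:
  assumes "open S" "x \<in> S" "\<And>y. y \<in> S \<Longrightarrow> f y = g y"
  shows "f differentiable (at x) \<longleftrightarrow> g differentiable (at x)" "partial i f x = partial i g x"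
proof -
  have *: "(f has_derivative D) (at x) \<longleftrightarrow> (g has_derivative D) (at x)" for D
    using assms has_derivative_transform_within_open[of f D x UNIV S g]
      has_derivative_transform_within_open[of g D x UNIV S f] by auto
  show "f differentiable (at x) \<longleftrightarrow> g differentiable (at x)" "partial i f x = partial i g x"
    using * by (simp_all add: differentiable_def partial_def frechet_derivative_def)
qed

text \<open>The symbol 1/|x|^2 is harmless on functions vanishing near 0. The stable class must
  contain all powers of the denominator, because every derivative raises the power by one.\<close>

lemma schwartz_divide_norm_sq:
  assumes f: "schwartz f" and r: "r > 0" and v: "\<And>x. norm x < r \<Longrightarrow> f x = 0"
  shows "schwartz (\<lambda>x. f x / of_real ((norm x)\<^sup>2))"
proof (rule schwartz_coinduct[where P = "{\<lambda>x. g x / of_real ((norm x)\<^sup>2) ^ n |g n. schwartz g \<and> (\<forall>x. norm x < r \<longrightarrow> g x = 0)}"])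
  show "(\<lambda>x. f x / of_real ((norm x)\<^sup>2)) \<in> {\<lambda>x. g x / of_real ((norm x)\<^sup>2) ^ n |g n. schwartz g \<and> (\<forall>x. norm x < r \<longrightarrow> g x = 0)}"
    using f v by (auto intro!: exI[of _ f] exI[of _ 1])
  fix h assume "h \<in> {\<lambda>x. g x / of_real ((norm x)\<^sup>2) ^ n |g n. schwartz g \<and> (\<forall>x. norm x < r \<longrightarrow> g x = 0)}"
  then obtain g n where g: "schwartz g" "\<And>x. norm x < r \<Longrightarrow> g x = 0" and h: "h = (\<lambda>x. g x / of_real ((norm x)\<^sup>2) ^ n)"
    by blast
  let ?N = "\<lambda>x::real^2. complex_of_real ((norm x)\<^sup>2)"
  have N: "(?N has_derivative (\<lambda>h. of_real (2 * (x \<bullet> h)))) (at x)" for x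
    unfolding power2_norm_eq_inner by (auto intro!: derivative_eq_intros simp: inner_commute)
  have op: "open {x::real^2. norm x < r}"
    by (auto intro!: open_Collect_less continuous_intros)
  have zero: "h x = 0" if "norm x < r" for x
    using g(2)[OF that] by (simp add: h)
  have pz: "partial i g x = 0" if "norm x < r" for i x
    using partial_local(2)[OF op, of x g "\<lambda>_. 0" i] that g(2) by simp
  have D: "(h has_derivative (\<lambda>k. - g x * (inverse (?N x ^ n) * (of_nat n * of_real (2 * (x \<bullet> k)) * ?N x ^ (n - 1)) * inverse (?N x ^ n))
      + frechet_derivative g (at x) k / ?N x ^ n)) (at x)" if "x \<noteq> 0" for x
    unfolding h using that
    by (intro has_derivative_divide[OF differentiable_has_derivative[OF schwartz_differentiable[OF g(1)]]]
        has_derivative_power N) auto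
  have "h differentiable at x" for x
  proof (cases "x = 0")
    case True
    then show ?thesis
      using partial_local(1)[OF op, of x h "\<lambda>_. 0"] zero r by simp
  next
    case False
    then show ?thesis using D by (auto simp: differentiable_def)
  qed
  moreover have "rapid h"
  proof (rule rapid_mono[OF schwartz_rapid[OF g(1)]])
    fix x
    show "norm (h x) \<le> (1 / (r\<^sup>2) ^ n) * norm (g x)"
    proof (cases "norm x < r")
      case True
      then show ?thesis using zero g by simp
    next
      case False
      then have "norm x > 0" using r by linarith
      then have "norm (g x) / ((norm x)\<^sup>2) ^ n \<le> norm (g x) / (r\<^sup>2) ^ n"
        using r False by (intro divide_left_mono power_mono mult_pos_pos) auto
      then show ?thesis by (simp add: h norm_divide norm_power)
    qed
  qed
  moreover have "partial i h \<in> {\<lambda>x. g x / of_real ((norm x)\<^sup>2) ^ n |g n. schwartz g \<and> (\<forall>x. norm x < r \<longrightarrow> g x = 0)}" for i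
  proof -
    \<comment> \<open>The numerator given by the quotient rule for the exponent
      \<open>Suc n\<close>. It still vanishes near the origin because both \<open>g\<close> and
      \<open>partial i g\<close> do.\<close>
    let ?g = "\<lambda>x. (partial i g x * ?N x - of_nat n * of_real (2 * x $ i) * g x)"
    have "partial i h x = ?g x / ?N x ^ (Suc n)" for x
    proof (cases "norm x < r")
      case True
      then show ?thesis
        using partial_local(2)[OF op, of x h "\<lambda>_. 0" i] zero pz g(2) by simp
    next
      case False
      then have x: "x \<noteq> 0" using r by auto
      \<comment> \<open>The case n = 0 is separate because of the truncated exponent
        \<open>n - 1\<close>; there the factor \<open>of_nat n\<close> removes that term.\<close>
      show ?thesis
        unfolding partial_eqI[OF D[OF x]] using x
        by (cases n) (auto simp: inner_axis partial_def field_simps power2_eq_square)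
    qed
    moreover have "slow (\<lambda>x. of_nat n * of_real (2 * x $ i))"
      using slow_mult[OF slow_const[of "of_nat n * 2"] slow_coord[of i]] by (simp add: mult.assoc)
    then have "schwartz ?g"
      using schwartz_mult'[OF schwartz_partial[OF g(1), of i] slow_norm_sq[of 0]]
      by (intro schwartz_diff schwartz_mult[OF _ g(1)]) simp_all
    ultimately show ?thesis
      using pz g by (intro CollectI exI[of _ ?g] exI[of _ "Suc n"]) auto
  qed
  ultimately show "(\<forall>x. h differentiable at x) \<and> rapid h \<and> (\<forall>i. partial i h \<in>
      {\<lambda>x. g x / of_real ((norm x)\<^sup>2) ^ n |g n. schwartz g \<and> (\<forall>x. norm x < r \<longrightarrow> g x = 0)})"
    by blast
qed

section \<open>Integration on the plane\<close>

lemma schwartz_continuous: "schwartz f \<Longrightarrow> continuous_on S f"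
  by (meson continuous_at_imp_continuous_on differentiable_imp_continuous_within schwartz_differentiable)

lemma schwartz_measurable: "schwartz f \<Longrightarrow> f \<in> borel_measurable borel"
  by (simp add: borel_measurable_continuous_onI schwartz_continuous)

lemma Basis_real2: "(Basis :: (real^2) set) = {axis 1 1, axis 2 1}"
proof -
  have A: "(UNIV :: 2 set) = {1, 2}" using exhaust_2 by auto
  have B: "Basis = (\<lambda>i. axis i 1 :: real^2) ` UNIV" by (auto simp: Basis_vec_def)
  show ?thesis unfolding B A by simp
qed

section \<open>Integrability of rapidly decaying functions\<close>

lemma integrable_weight_measurable: "(\<lambda>x::real^2. 1 / (1 + norm x) ^ 4) \<in> borel_measurable lborel"
  by measurable

lemma one_plus_norm_pos [simp]: "0 < 1 + norm x" "1 + norm x \<noteq> 0" for x :: "'a::real_normed_vector"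
  using norm_ge_zero[of x] by linarith+

lemma prod_Basis_real2: "(\<Prod>b\<in>(Basis :: (real^2) set). g b) = g (axis 1 1) * g (axis 2 1)"
  unfolding Basis_real2 by (subst prod.insert) (auto simp: axis_eq_axis)

lemma integrable_inverse_one_plus_sq: "integrable lborel (\<lambda>x::real. inverse (1 + x\<^sup>2))"
  using integrable_inverse_1_plus_square by (simp add: set_integrable_def)

text \<open>Each of the two factors \<open>1 + (x $ i)\<^sup>2\<close> is at most
  \<open>(1 + norm x)\<^sup>2\<close>, so the weight is dominated by a product of one-dimensional
  Cauchy densities; this is the origin of the exponent 4.\<close>

lemma integrable_weight: "integrable lborel (\<lambda>x::real^2. 1 / (1 + norm x) ^ 4)"
proof -
  let ?g = "\<lambda>x::real^2. \<Prod>b\<in>Basis. inverse (1 + (x \<bullet> b)\<^sup>2)"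
  have "(\<integral>\<^sup>+x. ennreal (inverse (1 + x\<^sup>2)) \<partial>lborel) < \<infinity>"
    using integrable_inverse_one_plus_sq unfolding integrable_iff_bounded by (simp add: add_pos_nonneg)
  moreover have "(\<integral>\<^sup>+x. (\<Prod>b\<in>(Basis::(real^2) set). ennreal (inverse (1 + (x \<bullet> b)\<^sup>2))) \<partial>lborel)
      = (\<Prod>b\<in>(Basis::(real^2) set). \<integral>\<^sup>+x. ennreal (inverse (1 + x\<^sup>2)) \<partial>lborel)"
    by (rule nn_integral_lborel_prod) auto
  ultimately have "(\<integral>\<^sup>+x. ennreal (?g x) \<partial>lborel) < \<infinity>"
    by (simp add: prod_Basis_real2 ennreal_mult ennreal_mult_less_top power2_eq_square)
  then have I: "integrable lborel ?g"
    by (subst integrable_iff_bounded) (auto intro!: prod_nonneg simp: add_pos_nonneg prod_nonneg)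
  have A: "AE x in lborel. norm (1 / (1 + norm x) ^ 4) \<le> norm (?g x)"
  proof (rule AE_I2)
    fix x :: "real^2"
    have *: "1 + (x $ i)\<^sup>2 \<le> (1 + norm x)\<^sup>2" for i
    proof -
      have "(x $ i)\<^sup>2 \<le> (norm x)\<^sup>2"
        using component_le_norm_cart[of x i] by (simp add: abs_le_square_iff[symmetric])
      moreover have "(1 + norm x)\<^sup>2 = 1 + 2 * norm x + (norm x)\<^sup>2"
        by (simp add: power2_eq_square algebra_simps)
      ultimately show ?thesis using norm_ge_zero[of x] by linarith
    qed
    have "(1 + (x $ 1)\<^sup>2) * (1 + (x $ 2)\<^sup>2) \<le> (1 + norm x)\<^sup>2 * (1 + norm x)\<^sup>2"
      by (intro mult_mono *) auto
    also have "\<dots> = (1 + norm x) ^ 4" by (simp flip: power_add)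
    finally have "1 / (1 + norm x) ^ 4 \<le> 1 / ((1 + (x $ 1)\<^sup>2) * (1 + (x $ 2)\<^sup>2))"
      by (intro divide_left_mono mult_pos_pos) (auto simp: add_pos_nonneg)
    moreover have "?g x = 1 / ((1 + (x $ 1)\<^sup>2) * (1 + (x $ 2)\<^sup>2))"
      unfolding prod_Basis_real2 inner_axis by (simp add: divide_inverse)
    moreover have "norm a \<le> norm b" if "0 \<le> a" "a \<le> b" for a b :: real
      using that by simp
    moreover have "0 \<le> 1 / (1 + norm x) ^ 4" by simp
    ultimately show "norm (1 / (1 + norm x) ^ 4) \<le> norm (?g x)"
      by (simp only:)
  qed
  show ?thesis
    by (rule Bochner_Integration.integrable_bound[OF I integrable_weight_measurable A])
qed

lemma integrable_rapid:
  assumes "rapid f" "f \<in> borel_measurable borel" shows "integrable lborel f"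
proof -
  from assms(1) obtain C where C: "\<And>x. (1 + norm x) ^ 4 * norm (f x) \<le> C" by (rule rapidE) blast
  show ?thesis
  proof (rule Bochner_Integration.integrable_bound)
    show "integrable lborel (\<lambda>x::real^2. C * (1 / (1 + norm x) ^ 4))"
      by (intro integrable_mult_right integrable_weight)
    have "norm (f x) \<le> C * (1 / (1 + norm x) ^ 4)" for x
      using C[of x] by (simp add: pos_le_divide_eq mult.commute)
    then show "AE x in lborel. norm (f x) \<le> norm (C * (1 / (1 + norm x) ^ 4))"
      by (intro AE_I2) (metis abs_ge_self order_trans real_norm_def)
  qed (use assms in simp)
qed

lemma schwartz_integrable: "schwartz f \<Longrightarrow> integrable lborel f"
  by (simp add: integrable_rapid schwartz_measurable schwartz_rapid)

lemma lborel_integral_translate: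
  fixes f :: "'a::euclidean_space \<Rightarrow> 'b::{banach, second_countable_topology}"
  assumes [measurable]: "f \<in> borel_measurable borel"
  shows "(LINT x|lborel. f (a + x)) = (LINT x|lborel. f x)"
proof -
  have "(LINT x|lborel. f x) = (LINT x|distr lborel borel ((+) a). f x)"
    by (simp add: lborel_distr_plus)
  also have "\<dots> = (LINT x|lborel. f (a + x))"
    by (subst integral_distr) auto
  finally show ?thesis by simp
qed

lemma lborel_integrable_translate:
  fixes f :: "'a::euclidean_space \<Rightarrow> 'b::{banach, second_countable_topology}"
  assumes "integrable lborel f"
  shows "integrable lborel (\<lambda>x. f (a + x))"
proof -
  have "integrable (distr lborel borel ((+) a)) f" using assms by (simp add: lborel_distr_plus)
  then show ?thesis by (subst (asm) integrable_distr_eq) (use assms in auto)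
qed

lemma lborel_integral_scale:
  fixes f :: "real^2 \<Rightarrow> 'b::{banach, second_countable_topology}"
  assumes [measurable]: "f \<in> borel_measurable borel" and c: "c \<noteq> 0"
  shows "(LINT x|lborel. f x) = c\<^sup>2 *\<^sub>R (LINT x|lborel. f (c *\<^sub>R x))"
proof -
  have "(LINT x|lborel. f x) = (LINT x|density (distr lborel borel (\<lambda>x. 0 + c *\<^sub>R x)) (\<lambda>_. \<bar>c\<bar>^DIM(real^2)). f x)"
    using lborel_affine[OF c, of "0 :: real^2"] by simp
  also have "\<dots> = (LINT x|distr lborel borel (\<lambda>x. 0 + c *\<^sub>R x). \<bar>c\<bar>^DIM(real^2) *\<^sub>R f x)"
    by (subst integral_density) (auto simp: c)
  also have "\<dots> = (LINT x|lborel. \<bar>c\<bar>^DIM(real^2) *\<^sub>R f (c *\<^sub>R x))"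
    by (subst integral_distr) auto
  finally show ?thesis by simp
qed

lemma lborel_integral_uminus:
  fixes f :: "real^2 \<Rightarrow> 'b::{banach, second_countable_topology}"
  assumes "f \<in> borel_measurable borel"
  shows "(LINT x|lborel. f (- x)) = (LINT x|lborel. f x)"
  using lborel_integral_scale[OF assms, of "-1"] by simp

section \<open>Integrals of derivatives vanish\<close>

lemma schwartz_line_derivative:
  assumes "schwartz f"
  shows "((\<lambda>t. f (t *\<^sub>R axis k 1 + x)) has_vector_derivative partial k f (t *\<^sub>R axis k 1 + x)) (at t within S)"
proof -
  let ?D = "frechet_derivative f (at (t *\<^sub>R axis k 1 + x))"
  have "((\<lambda>t. f (t *\<^sub>R axis k 1 + x)) has_derivative (\<lambda>h. ?D (h *\<^sub>R axis k 1))) (at t within S)"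
    by (rule has_derivative_compose[OF _ differentiable_has_derivative[OF schwartz_differentiable[OF assms]]])
       (auto intro!: derivative_eq_intros)
  moreover have "linear ?D" using linear_frechet_derivative[OF schwartz_differentiable[OF assms]] .
  ultimately show ?thesis
    by (simp add: has_vector_derivative_def partial_def linear_scale)
qed

text \<open>Difference quotients have integral zero by translation invariance, and they converge to
  the derivative under the integrable weight. This avoids iterated integration and boundary
  terms.\<close>

lemma integral_partial_zero:
  assumes f: "schwartz f"
  shows "(LINT x|lborel. partial k f x) = 0"
proof -
  let ?e = "axis k 1 :: real^2"
  have pf: "schwartz (partial k f)" by (rule schwartz_partial[OF f])
  from schwartz_rapid[OF pf] obtain C where C: "\<And>x. (1 + norm x) ^ 4 * norm (partial k f x) \<le> C"
    by (rule rapidE) blast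
  have C0: "C \<ge> 0" using C[of 0] by (meson norm_ge_zero order_trans mult_nonneg_nonneg zero_le_power add_nonneg_nonneg zero_le_one)
  define q where "q n x = of_nat (Suc n) * (f ((1 / real (Suc n)) *\<^sub>R ?e + x) - f x)" for n x
  have qm: "q n \<in> borel_measurable lborel" for n
  proof -
    have [measurable]: "f \<in> borel_measurable borel" by (rule schwartz_measurable[OF f])
    show ?thesis unfolding q_def by measurable
  qed
  have bound: "norm (q n x) \<le> C * 16 * (1 / (1 + norm x) ^ 4)" for n x
  proof -
    have "norm (f ((1 / real (Suc n)) *\<^sub>R ?e + x) - f (0 *\<^sub>R ?e + x)) \<le> (C * 16 * (1 / (1 + norm x) ^ 4)) * norm (1 / real (Suc n) - 0)"
    proof (rule differentiable_bound[where S = "{0..1}"])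
      fix t :: real assume t: "t \<in> {0..1}"
      show "((\<lambda>t. f (t *\<^sub>R ?e + x)) has_derivative (\<lambda>h. h *\<^sub>R partial k f (t *\<^sub>R ?e + x))) (at t within {0..1})"
        using schwartz_line_derivative[OF f] by (simp add: has_vector_derivative_def)
      \<comment> \<open>A shift by at most 1 changes \<open>1 + norm x\<close> by at most a factor
        2; the fourth power of this factor is the constant 16.\<close>
      have "norm x \<le> norm (t *\<^sub>R ?e + x) + norm (t *\<^sub>R ?e)"
        by (metis add_diff_cancel_left' norm_triangle_ineq4 add.commute)
      moreover have "norm (t *\<^sub>R ?e) \<le> 1" using t by simp
      moreover have "a \<le> b + c \<Longrightarrow> c \<le> 1 \<Longrightarrow> 0 \<le> b \<Longrightarrow> 1 + a \<le> 2 * (1 + b)" for a b c :: real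
        by argo
      ultimately have "1 + norm x \<le> 2 * (1 + norm (t *\<^sub>R ?e + x))" by (meson norm_ge_zero)
      then have "(1 + norm x) ^ 4 \<le> (2 * (1 + norm (t *\<^sub>R ?e + x))) ^ 4"
        by (intro power_mono) auto
      then have "(1 + norm x) ^ 4 * norm (partial k f (t *\<^sub>R ?e + x)) \<le> 16 * ((1 + norm (t *\<^sub>R ?e + x)) ^ 4 * norm (partial k f (t *\<^sub>R ?e + x)))"
        unfolding mult.assoc[symmetric] power_mult_distrib by (intro mult_right_mono) simp_all
      also have "\<dots> \<le> 16 * C" using C by simp
      finally have B: "norm (partial k f (t *\<^sub>R ?e + x)) \<le> C * 16 * (1 / (1 + norm x) ^ 4)"
        by (simp add: pos_le_divide_eq mult.commute)
      show "onorm (\<lambda>h. h *\<^sub>R partial k f (t *\<^sub>R ?e + x)) \<le> C * 16 * (1 / (1 + norm x) ^ 4)"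
      proof (rule onorm_le)
        fix h :: real
        have "norm (h *\<^sub>R partial k f (t *\<^sub>R ?e + x)) = norm (partial k f (t *\<^sub>R ?e + x)) * norm h"
          by (simp only: norm_scaleR real_norm_def mult.commute)
        also have "\<dots> \<le> C * 16 * (1 / (1 + norm x) ^ 4) * norm h"
          by (rule mult_right_mono[OF B norm_ge_zero])
        finally show "norm (h *\<^sub>R partial k f (t *\<^sub>R ?e + x)) \<le> C * 16 * (1 / (1 + norm x) ^ 4) * norm h" .
      qed
    qed auto
    then have *: "norm (f ((1 / real (Suc n)) *\<^sub>R ?e + x) - f x) \<le> (C * 16 * (1 / (1 + norm x) ^ 4)) * (1 / real (Suc n))"
      by simp
    have "norm (q n x) = real (Suc n) * norm (f ((1 / real (Suc n)) *\<^sub>R ?e + x) - f x)"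
      unfolding q_def norm_mult norm_of_nat ..
    also have "\<dots> \<le> real (Suc n) * ((C * 16 * (1 / (1 + norm x) ^ 4)) * (1 / real (Suc n)))"
      by (intro mult_left_mono *) simp
    also have "\<dots> = C * 16 * (1 / (1 + norm x) ^ 4)"
      by (simp del: of_nat_Suc)
    finally show ?thesis .
  qed
  have lim: "(\<lambda>n. q n x) \<longlonglongrightarrow> partial k f x" for x
  proof -
    have "((\<lambda>t. f (t *\<^sub>R ?e + x)) has_vector_derivative partial k f x) (at 0)"
      using schwartz_line_derivative[OF f, of k x 0] by simp
    then have "((\<lambda>h. norm (f (h *\<^sub>R ?e + x) - f x - h *\<^sub>R partial k f x) / norm h) \<longlongrightarrow> 0) (at 0)"
      by (simp add: has_vector_derivative_def has_derivative_at)
    moreover have "filterlim (\<lambda>n. 1 / real (Suc n)) (at 0) sequentially"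
      unfolding filterlim_at using LIMSEQ_inverse_real_of_nat by (auto simp: divide_inverse)
    ultimately have "(\<lambda>n. norm (f ((1 / real (Suc n)) *\<^sub>R ?e + x) - f x - (1 / real (Suc n)) *\<^sub>R partial k f x) / norm (1 / real (Suc n))) \<longlonglongrightarrow> 0"
      by (rule filterlim_compose)
    also have "(\<lambda>n. norm (f ((1 / real (Suc n)) *\<^sub>R ?e + x) - f x - (1 / real (Suc n)) *\<^sub>R partial k f x) / norm (1 / real (Suc n)))
      = (\<lambda>n. norm (q n x - partial k f x))"
    proof
      fix n
      have "q n x - partial k f x = of_nat (Suc n) * (f ((1 / real (Suc n)) *\<^sub>R ?e + x) - f x - (1 / real (Suc n)) *\<^sub>R partial k f x)"
        by (simp add: q_def scaleR_conv_of_real field_simps del: of_nat_Suc)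
      then show "norm (f ((1 / real (Suc n)) *\<^sub>R ?e + x) - f x - (1 / real (Suc n)) *\<^sub>R partial k f x) / norm (1 / real (Suc n))
        = norm (q n x - partial k f x)"
        by (simp add: norm_mult del: of_nat_Suc)
    qed
    finally show ?thesis
      by (rule LIM_zero_cancel[OF tendsto_norm_zero_cancel])
  qed
  have "(\<lambda>n. LINT x|lborel. q n x) \<longlonglongrightarrow> (LINT x|lborel. partial k f x)"
  proof (rule integral_dominated_convergence[where w = "\<lambda>x. C * 16 * (1 / (1 + norm x) ^ 4)"])
    show "integrable lborel (\<lambda>x::real^2. C * 16 * (1 / (1 + norm x) ^ 4))"
      by (intro integrable_mult_right integrable_weight)
  qed (use qm bound lim schwartz_measurable[OF pf] in auto)
  moreover have "(LINT x|lborel. q n x) = 0" for n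
  proof -
    have "integrable lborel (\<lambda>x. f ((1 / real (Suc n)) *\<^sub>R ?e + x))"
      by (rule lborel_integrable_translate) (rule schwartz_integrable[OF f])
    then show ?thesis
      unfolding q_def using schwartz_integrable[OF f] lborel_integral_translate[of f] schwartz_measurable[OF f]
      by simp
  qed
  ultimately show ?thesis by (simp add: LIMSEQ_const_iff)
qed

section \<open>The Fourier transform on Schwartz functions\<close>

abbreviation wave :: "real^2 \<Rightarrow> real^2 \<Rightarrow> complex" where
  "wave \<xi> x \<equiv> exp (- \<i> * complex_of_real (x \<bullet> \<xi>))"

lemma norm_wave [simp]: "norm (wave \<xi> x) = 1"
  by (simp add: norm_exp_eq_Re)

lemma wave_measurable [measurable]: "wave \<xi> \<in> borel_measurable borel"
  by (intro borel_measurable_continuous_onI continuous_intros)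

lemma integrable_wave_mult:
  assumes "integrable lborel f" shows "integrable lborel (\<lambda>x. wave \<xi> x * f x)"
proof (rule Bochner_Integration.integrable_bound[OF assms])
  show "(\<lambda>x. wave \<xi> x * f x) \<in> borel_measurable lborel"
    using borel_measurable_integrable[OF assms] by (intro borel_measurable_times) auto
  show "AE x in lborel. norm (wave \<xi> x * f x) \<le> norm (f x)"
    unfolding norm_mult norm_wave by simp
qed

lemma norm_fourier_le:
  assumes "integrable lborel f" shows "norm (fourier f \<xi>) \<le> (LINT x|lborel. norm (f x))"
proof -
  have "norm (fourier f \<xi>) \<le> (LINT x|lborel. norm (wave \<xi> x * f x))"
    unfolding fourier_def by (rule integral_norm_bound)
  also have "\<dots> = (LINT x|lborel. norm (f x))"
    unfolding norm_mult norm_wave by simp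
  finally show ?thesis .
qed

lemma continuous_fourier:
  assumes f: "integrable lborel f" shows "continuous_on UNIV (fourier f)"
proof (rule continuous_at_imp_continuous_on, intro ballI)
  fix \<xi>
  show "isCont (fourier f) \<xi>"
    unfolding continuous_at_sequentially
  proof (intro allI impI)
    fix z assume z: "z \<longlonglongrightarrow> \<xi>"
    show "(fourier f \<circ> z) \<longlonglongrightarrow> fourier f \<xi>"
      unfolding fourier_def comp_def
    proof (rule integral_dominated_convergence[where w = "\<lambda>x. norm (f x)"])
      show "AE x in lborel. (\<lambda>n. wave (z n) x * f x) \<longlonglongrightarrow> wave \<xi> x * f x"
        by (intro AE_I2 tendsto_intros z)
      show "AE x in lborel. norm (wave (z n) x * f x) \<le> norm (f x)" for n
        unfolding norm_mult norm_wave by simp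
    qed (use f integrable_wave_mult[OF f, THEN borel_measurable_integrable] in auto)
  qed
qed

lemma fourier_measurable: "integrable lborel f \<Longrightarrow> fourier f \<in> borel_measurable borel"
  by (intro borel_measurable_continuous_onI continuous_fourier)

lemma fourier_cmult: "fourier (\<lambda>x. a * f x) \<xi> = a * fourier f \<xi>"
proof -
  have "(\<lambda>x. wave \<xi> x * (a * f x)) = (\<lambda>x. a * (wave \<xi> x * f x))"
    by (simp add: algebra_simps)
  then show ?thesis unfolding fourier_def by simp
qed

lemma fourier_zero [simp]: "fourier (\<lambda>x. 0) = (\<lambda>\<xi>. 0)"
  by (simp add: fourier_def fun_eq_iff)

lemma slow_wave: "slow (wave \<xi>)"
proof -
  have "slow (\<lambda>x. - \<i> * complex_of_real (x \<bullet> \<xi>))"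
    by (intro slow_mult slow_inner slow_const)
  then show ?thesis by (rule slow_exp_bounded) simp
qed

lemma partial_wave: "partial k (wave \<xi>) x = - \<i> * of_real (\<xi> $ k) * wave \<xi> x"
proof -
  have "((\<lambda>x. - \<i> * complex_of_real (x \<bullet> \<xi>)) has_derivative (\<lambda>h. - \<i> * complex_of_real (h \<bullet> \<xi>))) (at x)" for x
    by (auto intro!: derivative_eq_intros)
  note D = this
  have "partial k (\<lambda>x. - \<i> * complex_of_real (x \<bullet> \<xi>)) x = - \<i> * of_real (\<xi> $ k)" for x
    by (rule trans[OF partial_eqI[OF D]]) (simp add: inner_axis')
  moreover have "(\<lambda>x. - \<i> * complex_of_real (x \<bullet> \<xi>)) differentiable (at x)" for x
    using D differentiable_def by blast
  ultimately show ?thesis by (subst partial_exp) simp_all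
qed

lemma fourier_partial:
  assumes f: "schwartz f"
  shows "fourier (partial k f) \<xi> = \<i> * of_real (\<xi> $ k) * fourier f \<xi>"
proof -
  have s: "schwartz (\<lambda>x. wave \<xi> x * f x)" by (rule schwartz_mult[OF slow_wave f])
  have pf: "schwartz (partial k f)" by (rule schwartz_partial[OF f])
  have "0 = (LINT x|lborel. partial k (\<lambda>x. wave \<xi> x * f x) x)"
    using integral_partial_zero[OF s] by simp
  also have "partial k (\<lambda>x. wave \<xi> x * f x) = (\<lambda>x. wave \<xi> x * partial k f x + (- \<i> * of_real (\<xi> $ k)) * (wave \<xi> x * f x))"
    by (subst partial_mult) (simp_all only: slow_differentiable[OF slow_wave] schwartz_differentiable[OF f] partial_wave mult.assoc)
  also have "(LINT x|lborel. \<dots> x) = fourier (partial k f) \<xi> + (- \<i> * of_real (\<xi> $ k)) * fourier f \<xi>"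
    unfolding fourier_def
    by (subst Bochner_Integration.integral_add)
       (simp_all only: integrable_wave_mult[OF schwartz_integrable[OF pf]] integral_mult_right_zero
          integrable_mult_right[OF schwartz_integrable[OF s]])
  finally show ?thesis by (simp add: algebra_simps)
qed

lemma norm_exp_i_minus_linear: "norm (exp (- \<i> * complex_of_real t) - 1 + \<i> * complex_of_real t) \<le> t\<^sup>2"
proof -
  have "norm (iexp (-t) - (\<Sum>k\<le>1. (\<i> * complex_of_real (-t)) ^ k / fact k)) \<le> \<bar>-t\<bar> ^ Suc 1 / fact (Suc 1)"
    by (rule iexp_approx1)
  then have "norm (exp (- \<i> * complex_of_real t) - 1 + \<i> * complex_of_real t) \<le> t\<^sup>2 / 2"
    by (simp add: algebra_simps power2_eq_square)
  then show ?thesis by (smt (verit) zero_le_power2 field_sum_of_halves)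
qed

text \<open>The Taylor remainder of the exponential bounds the error in the integrand by |x|^2 |h|^2
  |f x|. A finite second moment therefore gives a quadratic error directly, with no differentiation
  under the integral sign.\<close>

lemma fourier_has_derivative:
  assumes f: "integrable lborel f"
    and f1: "\<And>k. integrable lborel (\<lambda>x. of_real (x $ k) * f x)"
    and f2: "integrable lborel (\<lambda>x. of_real ((norm x)\<^sup>2) * f x)"
  shows "(fourier f has_derivative (\<lambda>h. \<Sum>k\<in>UNIV. of_real (h $ k) * fourier (\<lambda>x. - \<i> * of_real (x $ k) * f x) \<xi>)) (at \<xi>)"
    (is "(_ has_derivative ?D) _")
proof -
  let ?C = "LINT x|lborel. norm (of_real ((norm x)\<^sup>2) * f x)"
  have bl: "bounded_linear ?D"
    by (intro bounded_linear_sum bounded_linear_compose[OF bounded_linear_mult_left]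
        bounded_linear_compose[OF bounded_linear_of_real bounded_linear_vec_nth])
  have D: "?D h = (LINT x|lborel. - \<i> * of_real (x \<bullet> h) * (wave \<xi> x * f x))"
    and iD: "integrable lborel (\<lambda>x. - \<i> * of_real (x \<bullet> h) * (wave \<xi> x * f x))" for h
  proof -
    have i: "integrable lborel (\<lambda>x. wave \<xi> x * (- \<i> * of_real (x $ k) * f x))" for k
      using integrable_wave_mult[OF integrable_mult_right[OF f1[of k], of "-\<i>"]] by (simp add: mult.assoc)
    have eq: "(\<lambda>x. - \<i> * of_real (x \<bullet> h) * (wave \<xi> x * f x))
        = (\<lambda>x. \<Sum>k\<in>UNIV. of_real (h $ k) * (wave \<xi> x * (- \<i> * of_real (x $ k) * f x)))"
      by (simp add: sum_2 inner_vec_def algebra_simps fun_eq_iff)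
    show "?D h = (LINT x|lborel. - \<i> * of_real (x \<bullet> h) * (wave \<xi> x * f x))"
      unfolding eq fourier_def
      by (subst Bochner_Integration.integral_sum) (use i in \<open>auto simp only: integral_mult_right_zero intro!: integrable_mult_right\<close>)
    show "integrable lborel (\<lambda>x. - \<i> * of_real (x \<bullet> h) * (wave \<xi> x * f x))"
      unfolding eq using i by (intro Bochner_Integration.integrable_sum integrable_mult_right)
  qed
  have bound: "norm (fourier f (\<xi> + h) - fourier f \<xi> - ?D h) \<le> ?C * (norm h)\<^sup>2" for h
  proof -
    note i = integrable_wave_mult[OF f, of "\<xi> + h"] integrable_wave_mult[OF f, of \<xi>]
    have E: "fourier f (\<xi> + h) - fourier f \<xi> - ?D h =
       (LINT x|lborel. wave (\<xi> + h) x * f x - wave \<xi> x * f x - (- \<i> * of_real (x \<bullet> h) * (wave \<xi> x * f x)))"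
      unfolding D Bochner_Integration.integral_diff[OF Bochner_Integration.integrable_diff[OF i] iD]
        Bochner_Integration.integral_diff[OF i] fourier_def[of f] ..
    have "norm (fourier f (\<xi> + h) - fourier f \<xi> - ?D h) \<le> (LINT x|lborel. norm (wave (\<xi> + h) x * f x - wave \<xi> x * f x - (- \<i> * of_real (x \<bullet> h) * (wave \<xi> x * f x))))"
      unfolding E by (rule integral_norm_bound)
    also have "\<dots> \<le> (LINT x|lborel. norm (of_real ((norm x)\<^sup>2) * f x) * (norm h)\<^sup>2)"
    proof (rule integral_mono)
      fix x :: "real^2"
      have "wave (\<xi> + h) x = wave \<xi> x * exp (- \<i> * complex_of_real (x \<bullet> h))"
        by (simp add: inner_add_right exp_add[symmetric] algebra_simps)
      then have "wave (\<xi> + h) x * f x - wave \<xi> x * f x - (- \<i> * of_real (x \<bullet> h) * (wave \<xi> x * f x))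
         = wave \<xi> x * f x * (exp (- \<i> * complex_of_real (x \<bullet> h)) - 1 + \<i> * complex_of_real (x \<bullet> h))"
        by (simp add: algebra_simps)
      then have "norm (wave (\<xi> + h) x * f x - wave \<xi> x * f x - (- \<i> * of_real (x \<bullet> h) * (wave \<xi> x * f x)))
         = norm (f x) * norm (exp (- \<i> * complex_of_real (x \<bullet> h)) - 1 + \<i> * complex_of_real (x \<bullet> h))"
        by (simp only: norm_mult norm_wave mult_1)
      also have "\<dots> \<le> norm (f x) * (x \<bullet> h)\<^sup>2"
        by (intro mult_left_mono norm_exp_i_minus_linear) simp
      also have "\<dots> \<le> norm (f x) * ((norm x)\<^sup>2 * (norm h)\<^sup>2)"
        using Cauchy_Schwarz_ineq[of x h] by (intro mult_left_mono) (simp_all add: power2_norm_eq_inner)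
      also have "\<dots> = norm (of_real ((norm x)\<^sup>2) * f x) * (norm h)\<^sup>2"
        by (simp add: norm_mult norm_power)
      finally show "norm (wave (\<xi> + h) x * f x - wave \<xi> x * f x - (- \<i> * of_real (x \<bullet> h) * (wave \<xi> x * f x)))
          \<le> norm (of_real ((norm x)\<^sup>2) * f x) * (norm h)\<^sup>2" .
    next
      show "integrable lborel (\<lambda>x. norm (wave (\<xi> + h) x * f x - wave \<xi> x * f x - (- \<i> * of_real (x \<bullet> h) * (wave \<xi> x * f x))))"
        by (intro integrable_norm Bochner_Integration.integrable_diff integrable_wave_mult f iD)
      show "integrable lborel (\<lambda>x. norm (of_real ((norm x)\<^sup>2) * f x) * (norm h)\<^sup>2)"
        by (intro integrable_mult_left integrable_norm f2)
    qed
    also have "\<dots> = ?C * (norm h)\<^sup>2" by simp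
    finally show ?thesis .
  qed
  have "((\<lambda>h. norm (fourier f (\<xi> + h) - fourier f \<xi> - ?D h) / norm h) \<longlongrightarrow> 0) (at 0)"
  proof (rule tendsto_sandwich)
    show "\<forall>\<^sub>F h in at 0. 0 \<le> norm (fourier f (\<xi> + h) - fourier f \<xi> - ?D h) / norm h"
      by (intro always_eventually allI divide_nonneg_nonneg norm_ge_zero)
    have "norm (fourier f (\<xi> + h) - fourier f \<xi> - ?D h) / norm h \<le> ?C * norm h" if "h \<noteq> 0" for h
      using bound[of h] that by (simp add: pos_divide_le_eq power2_eq_square mult.assoc)
    then show "\<forall>\<^sub>F h in at 0. norm (fourier f (\<xi> + h) - fourier f \<xi> - ?D h) / norm h \<le> ?C * norm h"
      by (intro eventually_at_topological[THEN iffD2] exI[of _ UNIV]) auto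
    have "((\<lambda>h::real^2. ?C * norm h) \<longlongrightarrow> ?C * norm (0::real^2)) (at 0)"
      by (intro tendsto_intros)
    then show "((\<lambda>h::real^2. ?C * norm h) \<longlongrightarrow> 0) (at 0)" by simp
  qed simp
  then show ?thesis using bl by (simp add: has_derivative_at)
qed

lemma
  assumes f: "schwartz f"
  shows fourier_differentiable: "fourier f differentiable (at \<xi>)"
    and partial_fourier: "partial k (fourier f) = fourier (\<lambda>x. - \<i> * of_real (x $ k) * f x)"
proof -
  have "slow (\<lambda>x. of_real ((norm x)\<^sup>2))" using slow_norm_sq[of 0] by simp
  then have D: "(fourier f has_derivative (\<lambda>h. \<Sum>k\<in>UNIV. of_real (h $ k) * fourier (\<lambda>x. - \<i> * of_real (x $ k) * f x) \<xi>)) (at \<xi>)" for \<xi>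
    by (intro fourier_has_derivative schwartz_integrable f schwartz_mult slow_coord)
  then show "fourier f differentiable (at \<xi>)" by (auto simp: differentiable_def)
  show "partial k (fourier f) = fourier (\<lambda>x. - \<i> * of_real (x $ k) * f x)"
  proof
    fix \<xi>
    have "partial k (fourier f) \<xi> = (\<Sum>j\<in>UNIV. of_real (axis k 1 $ j) * fourier (\<lambda>x. - \<i> * of_real (x $ j) * f x) \<xi>)"
      by (rule partial_eqI[OF D])
    also have "\<dots> = (\<Sum>j\<in>UNIV. if k = j then fourier (\<lambda>x. - \<i> * of_real (x $ j) * f x) \<xi> else 0)"
      by (intro sum.cong) (auto simp: axis_def)
    finally show "partial k (fourier f) \<xi> = fourier (\<lambda>x. - \<i> * of_real (x $ k) * f x) \<xi>" by simp
  qed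
qed

lemma schwartz_coord_mult: "schwartz f \<Longrightarrow> schwartz (\<lambda>x. c * of_real (x $ k) * f x)"
  by (intro schwartz_mult[of "\<lambda>x. c * of_real (x $ k)"] slow_mult) auto

text \<open>Induction on the power: one factor 1 + |\<xi>| is at most 1 + |\<xi>_1| + |\<xi>_2|, and
  each coordinate factor is absorbed by passing from \<open>f\<close> to a derivative of
  \<open>f\<close>, which is again Schwartz.\<close>

lemma rapid_fourier:
  assumes "schwartz f" shows "rapid (fourier f)"
  unfolding rapid_def
proof
  fix k
  show "\<exists>C. \<forall>\<xi>. (1 + norm \<xi>) ^ k * norm (fourier f \<xi>) \<le> C"
    using assms
  proof (induction k arbitrary: f)
    case 0
    then show ?case using norm_fourier_le[OF schwartz_integrable] by auto
  next
    case (Suc k)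
    from Suc.IH[OF Suc.prems] obtain C0 where C0: "\<And>\<xi>. (1 + norm \<xi>) ^ k * norm (fourier f \<xi>) \<le> C0" by blast
    from Suc.IH[OF schwartz_partial[OF Suc.prems, of 1]]
    obtain C1 where C1: "\<And>\<xi>. (1 + norm \<xi>) ^ k * norm (fourier (partial 1 f) \<xi>) \<le> C1" by blast
    from Suc.IH[OF schwartz_partial[OF Suc.prems, of 2]]
    obtain C2 where C2: "\<And>\<xi>. (1 + norm \<xi>) ^ k * norm (fourier (partial 2 f) \<xi>) \<le> C2" by blast
    have "(1 + norm \<xi>) ^ Suc k * norm (fourier f \<xi>) \<le> C0 + (C1 + C2)" for \<xi> :: "real^2"
    proof -
      have "norm \<xi> \<le> \<bar>\<xi> $ 1\<bar> + \<bar>\<xi> $ 2\<bar>"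
        using norm_le_l1_cart[of \<xi>] by (simp add: sum_2)
      then have "(1 + norm \<xi>) * norm (fourier f \<xi>) \<le> (1 + (\<bar>\<xi> $ 1\<bar> + \<bar>\<xi> $ 2\<bar>)) * norm (fourier f \<xi>)"
        by (intro mult_right_mono) auto
      also have "\<dots> = norm (fourier f \<xi>) + (norm (fourier (partial 1 f) \<xi>) + norm (fourier (partial 2 f) \<xi>))"
        unfolding fourier_partial[OF Suc.prems] by (simp add: norm_mult algebra_simps)
      finally have "(1 + norm \<xi>) ^ k * ((1 + norm \<xi>) * norm (fourier f \<xi>)) \<le>
         (1 + norm \<xi>) ^ k * (norm (fourier f \<xi>) + (norm (fourier (partial 1 f) \<xi>) + norm (fourier (partial 2 f) \<xi>)))"
        by (intro mult_left_mono) auto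
      also have "\<dots> \<le> C0 + (C1 + C2)"
        unfolding distrib_left by (intro add_mono C0 C1 C2)
      finally show ?thesis by (simp add: mult.assoc mult.left_commute)
    qed
    then show ?case by blast
  qed
qed

text \<open>The image of the Schwartz class is itself the stable class: a derivative of a transform
  is the transform of a coordinate multiple.\<close>

lemma schwartz_fourier:
  assumes "schwartz f" shows "schwartz (fourier f)"
proof (rule schwartz_coinduct[where P = "fourier ` Collect schwartz"])
  fix g assume "g \<in> fourier ` Collect schwartz"
  then obtain f where f: "schwartz f" "g = fourier f" by blast
  show "(\<forall>x. g differentiable at x) \<and> rapid g \<and> (\<forall>i. partial i g \<in> fourier ` Collect schwartz)"
    unfolding f(2) partial_fourier[OF f(1)] using f(1) schwartz_coord_mult[OF f(1)]
    by (blast intro: fourier_differentiable rapid_fourier)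
qed (use assms in blast)

section \<open>The multiplication formula\<close>

lemma integrable_pair_mult:
  fixes f g :: "'a::euclidean_space \<Rightarrow> complex"
  assumes f: "integrable lborel f" and g: "integrable lborel g"
  shows "integrable (lborel \<Otimes>\<^sub>M lborel) (\<lambda>(x, y). f x * g y)"
proof (rule lborel_pair.Fubini_integrable)
  have [measurable]: "f \<in> borel_measurable borel" "g \<in> borel_measurable borel" using f g by auto
  show "(\<lambda>(x, y). f x * g y) \<in> borel_measurable (lborel \<Otimes>\<^sub>M lborel)" by measurable
  show "integrable lborel (\<lambda>x. LINT y|lborel. norm (case (x, y) of (x, y) \<Rightarrow> f x * g y))"
    using f by (simp add: norm_mult)
  show "AE x in lborel. integrable lborel (\<lambda>y. case (x, y) of (x, y) \<Rightarrow> f x * g y)"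
    using g by simp
qed

text \<open>An exchange of integrals. Integrability alone is assumed because the formula is later
  applied to the products \<open>u x $ l * u x $ k\<close>, which are known only to be
  integrable.\<close>

lemma fourier_multiplication:
  assumes f: "integrable lborel f" and g: "integrable lborel g"
  shows "(LINT \<xi>|lborel. fourier f \<xi> * g \<xi>) = (LINT x|lborel. f x * fourier g x)"
proof -
  have [measurable]: "f \<in> borel_measurable borel" "g \<in> borel_measurable borel" using f g by auto
  have int: "integrable (lborel \<Otimes>\<^sub>M lborel) (\<lambda>(x, \<xi>). wave \<xi> x * (f x * g \<xi>))"
  proof (rule Bochner_Integration.integrable_bound[OF integrable_pair_mult[OF f g]])
    show "(\<lambda>(x, \<xi>). wave \<xi> x * (f x * g \<xi>)) \<in> borel_measurable (lborel \<Otimes>\<^sub>M lborel)" by measurable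
    show "AE z in lborel \<Otimes>\<^sub>M lborel. norm (case z of (x, \<xi>) \<Rightarrow> wave \<xi> x * (f x * g \<xi>)) \<le> norm (case z of (x, y) \<Rightarrow> f x * g y)"
      by (rule AE_I2) (simp add: norm_mult split: prod.split)
  qed
  have "(LINT \<xi>|lborel. fourier f \<xi> * g \<xi>) = (LINT \<xi>|lborel. LINT x|lborel. wave \<xi> x * (f x * g \<xi>))"
  proof (rule Bochner_Integration.integral_cong[OF refl])
    fix \<xi>
    have "fourier f \<xi> * g \<xi> = (LINT x|lborel. (wave \<xi> x * f x) * g \<xi>)"
      unfolding fourier_def by simp
    then show "fourier f \<xi> * g \<xi> = (LINT x|lborel. wave \<xi> x * (f x * g \<xi>))"
      by (simp add: mult.assoc)
  qed
  also have "\<dots> = (LINT x|lborel. LINT \<xi>|lborel. wave \<xi> x * (f x * g \<xi>))"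
    using lborel_pair.Fubini_integral[OF int] by simp
  also have "\<dots> = (LINT x|lborel. f x * fourier g x)"
  proof (rule Bochner_Integration.integral_cong[OF refl])
    fix x
    have "f x * fourier g x = (LINT \<xi>|lborel. f x * (wave x \<xi> * g \<xi>))"
      unfolding fourier_def by simp
    also have "(\<lambda>\<xi>. f x * (wave x \<xi> * g \<xi>)) = (\<lambda>\<xi>. wave \<xi> x * (f x * g \<xi>))"
      by (simp add: inner_commute mult.left_commute)
    finally show "(LINT \<xi>|lborel. wave \<xi> x * (f x * g \<xi>)) = f x * fourier g x" by simp
  qed
  finally show ?thesis .
qed

section \<open>Fourier inversion\<close>

definition gauss :: "real^2 \<Rightarrow> complex" where
  "gauss x = exp (- of_real (1/2 * (norm x)\<^sup>2))"

lemma schwartz_gauss: "schwartz gauss"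
  unfolding gauss_def using schwartz_gaussian[of "1/2"] by simp

lemma slow_half_norm_sq: "slow (\<lambda>x. c * of_real (1/2 * (norm x)\<^sup>2))"
proof -
  have "slow (\<lambda>x. (c * of_real (1/2)) * of_real ((norm (x - 0))\<^sup>2))"
    by (intro slow_mult slow_norm_sq slow_const)
  then show ?thesis by (simp add: mult.assoc)
qed

lemma partial_half_norm_sq: "partial i (\<lambda>x. c * of_real (1/2 * (norm x)\<^sup>2)) x = c * of_real (x $ i)"
proof -
  have "((\<lambda>x::real^2. c * of_real (1/2 * (norm x)\<^sup>2)) has_derivative (\<lambda>h. c * of_real (x \<bullet> h))) (at x)"
    unfolding power2_norm_eq_inner by (auto intro!: derivative_eq_intros simp: inner_commute)
  from partial_eqI[OF this] show ?thesis by (simp add: inner_axis)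
qed

lemma partial_gauss: "partial i gauss = (\<lambda>x. - of_real (x $ i) * gauss x)"
proof -
  have eq: "gauss = (\<lambda>x. exp ((-1) * of_real (1/2 * (norm x)\<^sup>2)))" by (simp add: gauss_def fun_eq_iff)
  show ?thesis
    unfolding eq partial_exp[OF slow_differentiable[OF slow_half_norm_sq]] partial_half_norm_sq by simp
qed

lemma integral_gauss: "(LINT x|lborel. gauss x) = of_real (2 * pi)"
proof -
  have 1: "integrable lborel (\<lambda>x::real. exp (- x\<^sup>2 / 2))" "(LINT x|lborel. exp (- (x::real)\<^sup>2 / 2)) = sqrt (2 * pi)"
  proof -
    have eq: "(\<lambda>x::real. exp (- x\<^sup>2 / 2)) = (\<lambda>x. sqrt (2 * pi) * std_normal_density x)"
      by (simp add: std_normal_density_def fun_eq_iff)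
    show "integrable lborel (\<lambda>x::real. exp (- x\<^sup>2 / 2))"
      unfolding eq by (intro integrable_mult_right integrable_normal_density) simp
    show "(LINT x|lborel. exp (- (x::real)\<^sup>2 / 2)) = sqrt (2 * pi)"
      unfolding eq integral_mult_right_zero by (simp add: integral_normal_density)
  qed
  have "(\<integral>\<^sup>+x. ennreal (exp (- x\<^sup>2 / 2)) \<partial>lborel) = ennreal (sqrt (2 * pi))"
    using nn_integral_eq_integral[OF 1(1)] 1(2) by simp
  moreover have "(\<integral>\<^sup>+x. (\<Prod>b\<in>(Basis::(real^2) set). ennreal (exp (- (x \<bullet> b)\<^sup>2 / 2))) \<partial>lborel)
      = (\<Prod>b\<in>(Basis::(real^2) set). \<integral>\<^sup>+x. ennreal (exp (- x\<^sup>2 / 2)) \<partial>lborel)"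
    by (rule nn_integral_lborel_prod) auto
  ultimately have "(\<integral>\<^sup>+x. ennreal (exp (- (x $ 1)\<^sup>2 / 2)) * ennreal (exp (- (x $ 2)\<^sup>2 / 2)) \<partial>(lborel :: (real^2) measure))
      = ennreal (sqrt (2 * pi)) * ennreal (sqrt (2 * pi))"
    by (simp add: prod_Basis_real2 inner_axis power2_eq_square)
  also have "(\<lambda>x::real^2. ennreal (exp (- (x $ 1)\<^sup>2 / 2)) * ennreal (exp (- (x $ 2)\<^sup>2 / 2))) =
     (\<lambda>x. ennreal (exp (- (1/2 * (norm x)\<^sup>2))))"
    by (simp add: ennreal_mult[symmetric] exp_add[symmetric] norm_sq_2 field_simps fun_eq_iff)
  also have "ennreal (sqrt (2 * pi)) * ennreal (sqrt (2 * pi)) = ennreal (2 * pi)"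
    by (simp add: ennreal_mult[symmetric])
  finally have I: "(LINT x|lborel. exp (- (1/2 * (norm (x::real^2))\<^sup>2))) = 2 * pi"
    by (subst integral_eq_nn_integral) auto
  have G: "gauss = (\<lambda>x. of_real (exp (- (1/2 * (norm x)\<^sup>2))))"
    by (simp add: gauss_def fun_eq_iff exp_of_real[symmetric])
  show ?thesis unfolding G integral_complex_of_real I ..
qed

text \<open>The Gaussian and its transform both satisfy \<open>\<partial>\<^sub>k g = - x\<^sub>k g\<close>, so they are proportional.\<close>

lemma fourier_gauss: "fourier gauss \<xi> = of_real (2 * pi) * gauss \<xi>"
proof -
  define q where "q x = (1::complex) * of_real (1/2 * (norm x)\<^sup>2)" for x :: "real^2"
  have q: "slow q" unfolding q_def by (rule slow_half_norm_sq)
  define H where "H x = fourier gauss x * exp (q x)" for x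
  have fd: "fourier gauss differentiable (at x)" for x by (rule fourier_differentiable[OF schwartz_gauss])
  have ed: "(\<lambda>x. exp (q x)) differentiable (at x)" for x
    using has_derivative_exp_comp[OF slow_differentiable[OF q]] differentiable_def by blast
  have pf: "partial k (fourier gauss) x = - of_real (x $ k) * fourier gauss x" for k x
  proof -
    have "partial k (fourier gauss) = fourier (\<lambda>x. \<i> * partial k gauss x)"
      unfolding partial_fourier[OF schwartz_gauss] partial_gauss by (simp add: mult.assoc)
    moreover have "\<i> * (\<i> * of_real (x $ k) * z) = - of_real (x $ k) * z" for z
      by (simp add: algebra_simps)
    ultimately show ?thesis
      by (simp only: fourier_cmult fourier_partial[OF schwartz_gauss])
  qed
  have "partial k H = (\<lambda>x. 0)" for k
    unfolding H_def partial_mult[OF fd ed] partial_exp[OF slow_differentiable[OF q]] pf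
    unfolding q_def partial_half_norm_sq by (simp add: fun_eq_iff algebra_simps)
  then have z: "frechet_derivative H (at x) (axis k 1) = 0" for k x
    by (simp only: partial_def fun_eq_iff)
  have Hd: "H differentiable (at x)" for x
    unfolding H_def using fd ed by (rule differentiable_mult)
  have "frechet_derivative H (at x) = (\<lambda>h. 0)" for x
  proof
    fix h :: "real^2"
    have lin: "linear (frechet_derivative H (at x))" by (rule linear_frechet_derivative[OF Hd])
    have "h = (\<Sum>k\<in>UNIV. (h $ k) *\<^sub>R axis k 1)"
      by (simp add: vec_eq_iff sum_2 forall_2 axis_def)
    then have "frechet_derivative H (at x) h = frechet_derivative H (at x) (\<Sum>k\<in>UNIV. (h $ k) *\<^sub>R axis k 1)"
      by (rule arg_cong)
    also have "\<dots> = 0"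
      by (simp only: linear_sum[OF lin] linear_scale[OF lin] z scaleR_zero_right sum.neutral_const)
    finally show "frechet_derivative H (at x) h = 0" .
  qed
  then have "(H has_derivative (\<lambda>h. 0)) (at x within UNIV)" for x
    using differentiable_has_derivative[OF Hd, of x] by simp
  then have "H \<xi> = H 0"
    by (intro has_derivative_zero_unique[of UNIV H]) auto
  moreover have "H 0 = of_real (2 * pi)"
    by (simp add: H_def q_def fourier_def integral_gauss)
  moreover have "exp (q \<xi>) * gauss \<xi> = 1"
    by (simp add: gauss_def q_def exp_minus)
  moreover have "H \<xi> * gauss \<xi> = fourier gauss \<xi> * (exp (q \<xi>) * gauss \<xi>)"
    by (simp only: H_def mult.assoc)
  ultimately show ?thesis
    by (simp only: mult_1_right)
qed

lemma norm_gauss_le: "norm (gauss x) \<le> 1"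
  by (simp add: gauss_def norm_exp_eq_Re)

lemma gauss_scale_tendsto: "(\<lambda>n. gauss ((1 / real (Suc n)) *\<^sub>R x)) \<longlonglongrightarrow> 1"
proof -
  have "isCont gauss 0"
    using schwartz_continuous[OF schwartz_gauss, of UNIV] by (simp add: continuous_on_eq_continuous_at)
  moreover have "(\<lambda>n. (1 / real (Suc n)) *\<^sub>R x) \<longlonglongrightarrow> 0 *\<^sub>R x"
    using LIMSEQ_inverse_real_of_nat by (intro tendsto_scaleR tendsto_const) (simp add: divide_inverse)
  ultimately have "(\<lambda>n. gauss ((1 / real (Suc n)) *\<^sub>R x)) \<longlonglongrightarrow> gauss 0"
    by (intro isCont_tendsto_compose[of 0 gauss]) simp_all
  then show ?thesis by (simp add: gauss_def)
qed

text \<open>The approximate identity for inversion: a wide modulated Gaussian transforms into a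
  Gaussian concentrated at \<open>x\<close>, of total mass \<open>(2 * pi)\<^sup>2\<close> for every
  \<open>N\<close>.\<close>

lemma fourier_modulated_gauss:
  assumes N: "N > 0"
  shows "fourier (\<lambda>\<xi>. wave (- x) \<xi> * gauss ((1/N) *\<^sub>R \<xi>)) y = of_real (N\<^sup>2 * (2 * pi)) * gauss (N *\<^sub>R (y - x))"
proof -
  have [measurable]: "gauss \<in> borel_measurable borel" by (rule schwartz_measurable[OF schwartz_gauss])
  have "wave y \<xi> * wave (- x) \<xi> = wave (y - x) \<xi>" for \<xi>
    unfolding exp_add[symmetric] by (simp add: inner_diff_right algebra_simps)
  then have w: "wave y \<xi> * (wave (- x) \<xi> * g) = wave (y - x) \<xi> * g" for \<xi> g
    by (simp only: mult.assoc[symmetric])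
  have m: "(\<lambda>\<xi>. wave (y - x) \<xi> * gauss ((1/N) *\<^sub>R \<xi>)) \<in> borel_measurable borel"
    by measurable
  have "fourier (\<lambda>\<xi>. wave (- x) \<xi> * gauss ((1/N) *\<^sub>R \<xi>)) y = (LINT \<xi>|lborel. wave (y - x) \<xi> * gauss ((1/N) *\<^sub>R \<xi>))"
    unfolding fourier_def w ..
  also have "\<dots> = N\<^sup>2 *\<^sub>R (LINT \<xi>|lborel. wave (y - x) (N *\<^sub>R \<xi>) * gauss ((1/N) *\<^sub>R (N *\<^sub>R \<xi>)))"
    using N by (intro lborel_integral_scale m) simp
  also have "(\<lambda>\<xi>. wave (y - x) (N *\<^sub>R \<xi>) * gauss ((1/N) *\<^sub>R (N *\<^sub>R \<xi>))) = (\<lambda>\<xi>. wave (N *\<^sub>R (y - x)) \<xi> * gauss \<xi>)"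
    using N by simp
  also have "(LINT \<xi>|lborel. \<dots> \<xi>) = fourier gauss (N *\<^sub>R (y - x))"
    unfolding fourier_def ..
  finally show ?thesis by (simp add: fourier_gauss scaleR_conv_of_real)
qed

text \<open>The Gaussian-regularised integral is computed in two ways. Dominated convergence removes
  the regularisation, while the multiplication formula turns the integral into an average of
  \<open>f\<close> around \<open>x\<close>.\<close>

lemma fourier_inversion:
  assumes f: "schwartz f"
  shows "(LINT \<xi>|lborel. fourier f \<xi> * wave (- x) \<xi>) = of_real ((2 * pi)\<^sup>2) * f x"
proof -
  have [measurable]: "gauss \<in> borel_measurable borel" "f \<in> borel_measurable borel" "fourier f \<in> borel_measurable borel"
    by (auto intro: schwartz_measurable schwartz_gauss schwartz_fourier f)
  define h where "h n = (\<lambda>\<xi>. wave (- x) \<xi> * gauss ((1 / real (Suc n)) *\<^sub>R \<xi>))" for n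
  have sh: "schwartz (h n)" for n
    unfolding h_def by (intro schwartz_mult slow_wave schwartz_scale schwartz_gauss) simp
  have 1: "(\<lambda>n. LINT \<xi>|lborel. fourier f \<xi> * h n \<xi>) \<longlonglongrightarrow> (LINT \<xi>|lborel. fourier f \<xi> * wave (- x) \<xi>)"
  proof (rule integral_dominated_convergence[where w = "\<lambda>\<xi>. norm (fourier f \<xi>)"])
    show "integrable lborel (\<lambda>\<xi>. norm (fourier f \<xi>))"
      by (intro integrable_norm schwartz_integrable schwartz_fourier f)
    have "(\<lambda>n. fourier f \<xi> * (wave (- x) \<xi> * gauss ((1 / real (Suc n)) *\<^sub>R \<xi>))) \<longlonglongrightarrow> fourier f \<xi> * (wave (- x) \<xi> * 1)" for \<xi>
      by (intro tendsto_mult tendsto_const gauss_scale_tendsto)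
    then show "AE \<xi> in lborel. (\<lambda>n. fourier f \<xi> * h n \<xi>) \<longlonglongrightarrow> fourier f \<xi> * wave (- x) \<xi>"
      by (intro AE_I2) (simp only: h_def mult_1_right)
    show "AE \<xi> in lborel. norm (fourier f \<xi> * h n \<xi>) \<le> norm (fourier f \<xi>)" for n
      unfolding h_def norm_mult norm_wave mult_1 by (intro AE_I2 mult_right_le_one_le norm_ge_zero norm_gauss_le)
    show "(\<lambda>\<xi>. fourier f \<xi> * h n \<xi>) \<in> borel_measurable lborel" for n
      unfolding h_def by measurable
    show "(\<lambda>\<xi>. fourier f \<xi> * wave (- x) \<xi>) \<in> borel_measurable lborel" by measurable
  qed
  have 2: "(LINT \<xi>|lborel. fourier f \<xi> * h n \<xi>) = (LINT w|lborel. f (x + (1 / real (Suc n)) *\<^sub>R w) * (of_real (2 * pi) * gauss w))" for n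
  proof -
    define N where "N = real (Suc n)"
    have N: "N > 0" by (simp add: N_def)
    have m: "(\<lambda>w. f (x + w) * (of_real (N\<^sup>2 * (2 * pi)) * gauss (N *\<^sub>R (x + w - x)))) \<in> borel_measurable borel"
      by measurable
    have "(LINT \<xi>|lborel. fourier f \<xi> * h n \<xi>) = (LINT y|lborel. f y * fourier (h n) y)"
      by (intro fourier_multiplication schwartz_integrable f sh)
    also have "\<dots> = (LINT y|lborel. f y * (of_real (N\<^sup>2 * (2 * pi)) * gauss (N *\<^sub>R (y - x))))"
      using fourier_modulated_gauss[OF N, of x] by (simp only: h_def N_def)
    also have "\<dots> = (LINT w|lborel. f (x + w) * (of_real (N\<^sup>2 * (2 * pi)) * gauss (N *\<^sub>R (x + w - x))))"
      by (rule lborel_integral_translate[symmetric]) measurable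
    \<comment> \<open>Rescaling freezes the Gaussian and moves all dependence on \<open>n\<close>
      into the argument of \<open>f\<close>, where continuity applies.\<close>
    also have "\<dots> = (1/N)\<^sup>2 *\<^sub>R (LINT w|lborel. f (x + (1/N) *\<^sub>R w) * (of_real (N\<^sup>2 * (2 * pi)) * gauss (N *\<^sub>R (x + (1/N) *\<^sub>R w - x))))"
      using N by (intro lborel_integral_scale m) simp
    also have "\<dots> = (LINT w|lborel. (1/N)\<^sup>2 *\<^sub>R (f (x + (1/N) *\<^sub>R w) * (of_real (N\<^sup>2 * (2 * pi)) * gauss (N *\<^sub>R (x + (1/N) *\<^sub>R w - x)))))"
      by (simp only: integral_scaleR_right)
    also have "\<dots> = (LINT w|lborel. f (x + (1/N) *\<^sub>R w) * (of_real (2 * pi) * gauss w))"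
    proof (rule Bochner_Integration.integral_cong[OF refl])
      fix w :: "real^2"
      have "N *\<^sub>R (x + (1/N) *\<^sub>R w - x) = w" using N by simp
      moreover have "(1/N)\<^sup>2 *\<^sub>R (a * (of_real (N\<^sup>2 * (2 * pi)) * b)) = a * (of_real (2 * pi) * b)" for a b :: complex
        using N by (simp add: scaleR_conv_of_real power_divide)
      ultimately show "(1/N)\<^sup>2 *\<^sub>R (f (x + (1/N) *\<^sub>R w) * (of_real (N\<^sup>2 * (2 * pi)) * gauss (N *\<^sub>R (x + (1/N) *\<^sub>R w - x))))
          = f (x + (1/N) *\<^sub>R w) * (of_real (2 * pi) * gauss w)"
        by (simp only:)
    qed
    finally show ?thesis by (simp add: N_def)
  qed
  from schwartz_rapid[OF f] obtain C where C: "\<And>x. (1 + norm x) ^ 0 * norm (f x) \<le> C" by (rule rapidE) blast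
  have 3: "(\<lambda>n. LINT w|lborel. f (x + (1 / real (Suc n)) *\<^sub>R w) * (of_real (2 * pi) * gauss w))
     \<longlonglongrightarrow> (LINT w|lborel. f x * (of_real (2 * pi) * gauss w))"
  proof (rule integral_dominated_convergence[where w = "\<lambda>w. C * norm (of_real (2 * pi) * gauss w)"])
    show "integrable lborel (\<lambda>w. C * norm (of_real (2 * pi) * gauss w))"
      by (intro integrable_mult_right integrable_norm schwartz_integrable schwartz_gauss)
    have "(\<lambda>n. f (x + (1 / real (Suc n)) *\<^sub>R w)) \<longlonglongrightarrow> f x" for w
    proof -
      have "isCont f x"
        using schwartz_continuous[OF f, of UNIV] by (simp add: continuous_on_eq_continuous_at)
      moreover have "(\<lambda>n. x + (1 / real (Suc n)) *\<^sub>R w) \<longlonglongrightarrow> x + 0 *\<^sub>R w"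
        using LIMSEQ_inverse_real_of_nat by (intro tendsto_add tendsto_scaleR tendsto_const) (simp add: divide_inverse)
      ultimately show ?thesis
        by (intro isCont_tendsto_compose[of x f]) simp_all
    qed
    then show "AE w in lborel. (\<lambda>n. f (x + (1 / real (Suc n)) *\<^sub>R w) * (of_real (2 * pi) * gauss w))
        \<longlonglongrightarrow> f x * (of_real (2 * pi) * gauss w)"
      by (intro AE_I2 tendsto_mult tendsto_const)
    show "AE w in lborel. norm (f (x + (1 / real (Suc n)) *\<^sub>R w) * (of_real (2 * pi) * gauss w)) \<le> C * norm (of_real (2 * pi) * gauss w)" for n
      using C by (intro AE_I2) (simp only: norm_mult[of "f _"] mult_right_mono norm_ge_zero power_0 mult_1)
  qed measurable
  have "(LINT \<xi>|lborel. fourier f \<xi> * wave (- x) \<xi>) = (LINT w|lborel. f x * (of_real (2 * pi) * gauss w))"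
    by (rule LIMSEQ_unique[OF 1]) (use 3 in \<open>simp only: 2\<close>)
  also have "\<dots> = of_real ((2 * pi)\<^sup>2) * f x"
    by (simp add: integral_gauss power2_eq_square)
  finally show ?thesis .
qed

lemma inv_fourier_altdef: "inv_fourier f x = fourier f (- x) / of_real ((2 * pi)\<^sup>2)"
  unfolding inv_fourier_def fourier_def by (simp add: inner_commute)

lemma schwartz_inv_fourier: "schwartz f \<Longrightarrow> schwartz (inv_fourier f)"
  using schwartz_cmult[OF schwartz_uminus_arg[OF schwartz_fourier[of f]], of "1 / of_real ((2 * pi)\<^sup>2)"]
  unfolding inv_fourier_altdef[abs_def] by simp

lemma inv_fourier_fourier:
  assumes "schwartz f" shows "inv_fourier (fourier f) = f"
proof
  fix x
  have "fourier (fourier f) (- x) = (LINT \<xi>|lborel. fourier f \<xi> * wave (- x) \<xi>)"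
    unfolding fourier_def[of "fourier f"] by (simp only: mult.commute)
  then show "inv_fourier (fourier f) x = f x"
    unfolding inv_fourier_altdef fourier_inversion[OF assms] by simp
qed

lemma fourier_inv_fourier:
  assumes f: "schwartz f" shows "fourier (inv_fourier f) = f"
proof
  fix \<xi>
  have m: "(\<lambda>x. wave (- \<xi>) x * fourier f x) \<in> borel_measurable borel"
    using schwartz_measurable[OF schwartz_fourier[OF f]] by measurable
  have "fourier (inv_fourier f) \<xi> = fourier (\<lambda>x. fourier f (- x)) \<xi> / of_real ((2 * pi)\<^sup>2)"
    unfolding inv_fourier_altdef[abs_def] using fourier_cmult[of "1 / of_real ((2 * pi)\<^sup>2)" "\<lambda>x. fourier f (- x)"] by simp
  also have "fourier (\<lambda>x. fourier f (- x)) \<xi> = fourier (fourier f) (- \<xi>)"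
    using lborel_integral_uminus[OF m] unfolding fourier_def[of "fourier f"] fourier_def[of "\<lambda>x. fourier f (- x)"] by simp
  also have "\<dots> / of_real ((2 * pi)\<^sup>2) = f \<xi>"
    using inv_fourier_fourier[OF f] unfolding inv_fourier_altdef[abs_def] by metis
  finally show "fourier (inv_fourier f) \<xi> = f \<xi>" .
qed

lemma cnj_fourier: "cnj (fourier f \<xi>) = fourier (\<lambda>x. cnj (f x)) (- \<xi>)"
proof -
  have "cnj (wave \<xi> x * f x) = wave (- \<xi>) x * cnj (f x)" for x
    unfolding complex_cnj_mult exp_cnj by simp
  then show ?thesis
    unfolding fourier_def using Bochner_Integration.integral_cnj[of lborel "\<lambda>x. wave \<xi> x * f x"] by (simp only:)
qed

section \<open>Parseval and Plancherel identities\<close>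

lemma parseval:
  assumes f: "schwartz f" and g: "schwartz g"
  shows "(LINT \<xi>|lborel. fourier f \<xi> * cnj (fourier g \<xi>)) = of_real ((2 * pi)\<^sup>2) * (LINT x|lborel. f x * cnj (g x))"
proof -
  let ?g = "\<lambda>x. cnj (g x)"
  have sg: "schwartz ?g" by (rule schwartz_cnj[OF g])
  have "cnj (fourier g \<xi>) = of_real ((2 * pi)\<^sup>2) * inv_fourier ?g \<xi>" for \<xi>
    by (simp add: cnj_fourier inv_fourier_altdef)
  then have "(LINT \<xi>|lborel. fourier f \<xi> * cnj (fourier g \<xi>)) = (LINT \<xi>|lborel. of_real ((2 * pi)\<^sup>2) * (fourier f \<xi> * inv_fourier ?g \<xi>))"
    by (simp add: mult.left_commute)
  also have "\<dots> = of_real ((2 * pi)\<^sup>2) * (LINT \<xi>|lborel. fourier f \<xi> * inv_fourier ?g \<xi>)"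
    by (rule integral_mult_right_zero)
  also have "(LINT \<xi>|lborel. fourier f \<xi> * inv_fourier ?g \<xi>) = (LINT x|lborel. f x * fourier (inv_fourier ?g) x)"
    by (intro fourier_multiplication schwartz_integrable schwartz_inv_fourier f sg)
  finally show ?thesis by (simp add: fourier_inv_fourier[OF sg])
qed

lemma plancherel:
  assumes f: "schwartz f"
  shows "(LINT \<xi>|lborel. (norm (fourier f \<xi>))\<^sup>2) = (2 * pi)\<^sup>2 * (LINT x|lborel. (norm (f x))\<^sup>2)"
proof -
  have "complex_of_real (LINT \<xi>|lborel. (norm (fourier f \<xi>))\<^sup>2) = of_real ((2 * pi)\<^sup>2 * (LINT x|lborel. (norm (f x))\<^sup>2))"
    using parseval[OF f f] by (simp only: complex_norm_square[symmetric] of_real_mult integral_complex_of_real)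
  then show ?thesis by (simp only: of_real_eq_iff)
qed

lemma schwartz_square_integrable:
  assumes "schwartz f" shows "integrable lborel (\<lambda>x. (norm (f x))\<^sup>2)"
proof -
  have "integrable lborel (\<lambda>x. f x * cnj (f x))"
    by (intro schwartz_integrable schwartz_mult' schwartz_slow schwartz_cnj assms)
  then have "integrable lborel (\<lambda>x. Re (f x * cnj (f x)))" by (rule integrable_Re)
  moreover have "Re (z * cnj z) = (norm z)\<^sup>2" for z
    unfolding cmod_power2 by (simp add: power2_eq_square)
  ultimately show ?thesis by (simp only:)
qed

section \<open>Density of Schwartz functions and duality in \<open>L\<^sup>2\<close>\<close>

text \<open>Slow growth makes the product with a Gaussian a Schwartz function, and values in [0, 1]
  give domination. The Gaussian factor takes over the role of compact support.\<close>

definition cutoff :: "(real^2 \<Rightarrow> real) \<Rightarrow> bool" where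
  "cutoff \<psi> \<longleftrightarrow> slow (\<lambda>x. of_real (\<psi> x)) \<and> (\<forall>x. 0 \<le> \<psi> x \<and> \<psi> x \<le> 1)"

lemma slow_continuous: "slow f \<Longrightarrow> continuous_on S f"
  by (meson continuous_at_imp_continuous_on differentiable_imp_continuous_within slow_differentiable)

lemma slow_measurable: "slow f \<Longrightarrow> f \<in> borel_measurable borel"
  by (simp add: borel_measurable_continuous_onI slow_continuous)

lemma cutoff_measurable: 
  assumes "cutoff \<psi>" shows "\<psi> \<in> borel_measurable borel"
proof -
  have "continuous_on UNIV (\<lambda>x. complex_of_real (\<psi> x))"
    using assms unfolding cutoff_def by (blast intro: slow_continuous)
  then have "continuous_on UNIV (\<lambda>x. Re (complex_of_real (\<psi> x)))" by (rule continuous_on_Re)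
  then show ?thesis by (simp add: borel_measurable_continuous_onI)
qed

text \<open>An explicit smooth substitute for a bump function: the base of the power is below 1
  inside the ball and above 1 outside, so the exponential tends to 1 inside and to 0 outside as
  \<open>n\<close> grows.\<close>

definition ball_bump :: "real^2 \<Rightarrow> real \<Rightarrow> nat \<Rightarrow> real^2 \<Rightarrow> real" where
  "ball_bump c r n x = exp (- (((norm (x - c))\<^sup>2 / r\<^sup>2) ^ n))"

lemma cutoff_ball_bump: "cutoff (ball_bump c r n)"
proof -
  have "slow (\<lambda>x. (-1) * (of_real (1 / r\<^sup>2) * of_real ((norm (x - c))\<^sup>2)) ^ n)"
    by (intro slow_mult slow_power slow_norm_sq slow_const)
  then have "slow (\<lambda>x. of_real (- (((norm (x - c))\<^sup>2 / r\<^sup>2) ^ n)))" by simp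
  then have "slow (\<lambda>x. exp (of_real (- (((norm (x - c))\<^sup>2 / r\<^sup>2) ^ n))))"
    by (rule slow_exp_bounded) simp
  then show ?thesis
    unfolding cutoff_def ball_bump_def exp_of_real by simp
qed

lemma ball_bump_tendsto:
  assumes r: "r > 0" and x: "x \<notin> sphere c r"
  shows "(\<lambda>n. ball_bump c r n x) \<longlonglongrightarrow> indicator (ball c r) x"
proof (cases "x \<in> ball c r")
  case True
  then have "norm (x - c) < r" by (simp add: dist_norm norm_minus_commute)
  then have "(norm (x - c))\<^sup>2 / r\<^sup>2 < 1" using r by (simp add: power_strict_mono)
  then have "(\<lambda>n. ((norm (x - c))\<^sup>2 / r\<^sup>2) ^ n) \<longlonglongrightarrow> 0" by (rule LIMSEQ_realpow_zero[rotated]) simp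
  then have "(\<lambda>n. exp (- (((norm (x - c))\<^sup>2 / r\<^sup>2) ^ n))) \<longlonglongrightarrow> exp (- 0)" by (intro tendsto_exp tendsto_minus)
  then show ?thesis using True by (simp add: ball_bump_def)
next
  case False
  then have "norm (x - c) > r" using x by (simp add: dist_norm norm_minus_commute)
  then have "(norm (x - c))\<^sup>2 / r\<^sup>2 > 1" using r by (simp add: power_strict_mono)
  then have t: "1 < (norm (x - c))\<^sup>2 / r\<^sup>2" (is "1 < ?t") .
  have "(\<lambda>n. exp (- (?t ^ n))) \<longlonglongrightarrow> 0"
  proof (rule tendsto_sandwich[OF _ _ tendsto_const LIMSEQ_inverse_realpow_zero[OF t]])
    have "exp (- y) \<le> inverse y" if "y > 0" for y :: real
      using exp_ge_add_one_self[of y] that unfolding exp_minus by (intro le_imp_inverse_le) linarith+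
    moreover have "?t ^ n > 0" for n using t by (intro zero_less_power) linarith
    ultimately show "\<forall>\<^sub>F n in sequentially. exp (- (?t ^ n)) \<le> inverse (?t ^ n)"
      by (intro always_eventually) blast
  qed simp
  then show ?thesis using False by (simp add: ball_bump_def)
qed

text \<open>The complementary product corresponds to a union and keeps values in [0, 1]. Convergence
  can fail only on finitely many spheres, which are null sets.\<close>

lemma union_of_balls_approx:
  assumes I: "finite I" and r: "\<And>i. i \<in> I \<Longrightarrow> r i > 0"
  obtains \<psi> :: "nat \<Rightarrow> real^2 \<Rightarrow> real" where "\<And>n. cutoff (\<psi> n)"
    "AE x in lborel. (\<lambda>n. \<psi> n x) \<longlonglongrightarrow> indicator (\<Union>i\<in>I. ball (c i) (r i)) x"
proof
  let ?\<psi> = "\<lambda>n x. 1 - (\<Prod>i\<in>I. 1 - ball_bump (c i) (r i) n x)"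
  show "cutoff (?\<psi> n)" for n
  proof -
    have b: "slow (\<lambda>x. of_real (ball_bump (c i) (r i) n x))" "0 \<le> ball_bump (c i) (r i) n x" "ball_bump (c i) (r i) n x \<le> 1" for i x
      using cutoff_ball_bump[of "c i" "r i" n] by (auto simp: cutoff_def)
    have "slow (\<lambda>x. 1 - (\<Prod>i\<in>I. 1 - of_real (ball_bump (c i) (r i) n x)))"
      by (intro slow_diff slow_prod slow_const b)
    moreover have "(\<Prod>i\<in>I. 1 - ball_bump (c i) (r i) n x) \<le> 1" "0 \<le> (\<Prod>i\<in>I. 1 - ball_bump (c i) (r i) n x)" for x
      using b by (auto intro!: prod_le_1 prod_nonneg)
    ultimately show ?thesis by (simp add: cutoff_def)
  qed
  have "AE x in lborel. \<forall>i\<in>I. x \<notin> sphere (c i) (r i)"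
  proof (rule AE_finite_allI[OF I])
    fix i
    have "sphere (c i) (r i) \<in> null_sets lborel"
      using negligible_sphere[of "c i" "r i"] by (simp add: negligible_iff_null_sets null_sets_completion_iff closed_sphere)
    then show "AE x in lborel. x \<notin> sphere (c i) (r i)" by (rule AE_not_in)
  qed
  then show "AE x in lborel. (\<lambda>n. ?\<psi> n x) \<longlonglongrightarrow> indicator (\<Union>i\<in>I. ball (c i) (r i)) x"
  proof eventually_elim
    case (elim x)
    then have "(\<lambda>n. ?\<psi> n x) \<longlonglongrightarrow> 1 - (\<Prod>i\<in>I. 1 - indicator (ball (c i) (r i)) x)"
      by (intro tendsto_diff tendsto_const tendsto_prod ball_bump_tendsto r) auto
    also have "1 - (\<Prod>i\<in>I. 1 - indicator (ball (c i) (r i)) x) = (indicator (\<Union>i\<in>I. ball (c i) (r i)) x :: real)"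
      using I by (auto simp: indicator_def)
    finally show ?case .
  qed
qed

text \<open>Regularity squeezes \<open>A\<close> between a compact \<open>K\<close> and an open
  \<open>U\<close>, and a finite union of balls fits between these two. The three thirds of
  \<open>e\<close> are the inner regularity, the outer regularity and the bump errors. Absolute
  continuity is what makes the spheres null for \<open>M\<close> too.\<close>

lemma indicator_approx:
  fixes M :: "(real^2) measure"
  assumes fin: "finite_measure M" and sets: "sets M = sets borel" and ac: "\<And>P. AE x in lborel. P x \<Longrightarrow> AE x in M. P x"
    and A: "A \<in> sets borel" and e: "e > 0"
  obtains \<psi> where "cutoff \<psi>" "(LINT x|M. \<bar>\<psi> x - indicator A x\<bar>) < e"
proof -
  interpret finite_measure M by (rule fin)
  have sp: "space M = UNIV" using sets_eq_imp_space_eq[OF sets] by simp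
  have [measurable_cong]: "sets M = sets borel" by (rule sets)
  have nt: "emeasure M (space M) \<noteq> \<infinity>" by simp
  have "emeasure M A < (\<infinity>::ennreal)" by (simp add: less_top[symmetric])
  have "\<exists>K. K \<subseteq> A \<and> compact K \<and> measure M A - e / 3 < measure M K"
  proof (rule ccontr)
    assume n: "\<not> ?thesis"
    have "emeasure M A \<le> ennreal (measure M A - e / 3)"
      unfolding inner_regular[OF sets nt A]
    proof (rule SUP_least)
      fix K assume "K \<in> {K. K \<subseteq> A \<and> compact K}"
      then have "measure M K \<le> measure M A - e / 3" using n by fastforce
      then show "emeasure M K \<le> ennreal (measure M A - e / 3)"
        unfolding emeasure_eq_measure by (rule ennreal_leI)
    qed
    \<comment> \<open>\<open>ennreal\<close> truncates negative numbers to 0, whence the second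
      alternative; in that case the empty compact set already contradicts the assumption.\<close>
    then have "measure M A \<le> measure M A - e / 3 \<or> measure M A = 0"
      unfolding emeasure_eq_measure using ennreal_le_iff2 by (smt (verit) measure_nonneg)
    then show False using e n by (auto dest!: spec[of _ "{}"])
  qed
  then obtain K where K: "K \<subseteq> A" "compact K" "measure M A - e / 3 < measure M K" by blast
  have "\<exists>U. A \<subseteq> U \<and> open U \<and> measure M U < measure M A + e / 3"
  proof (rule ccontr)
    assume n: "\<not> ?thesis"
    have "ennreal (measure M A + e / 3) \<le> emeasure M A"
      unfolding outer_regular[OF sets nt A]
    proof (rule INF_greatest)
      fix U assume "U \<in> {U. A \<subseteq> U \<and> open U}"
      then have "measure M A + e / 3 \<le> measure M U" using n by fastforce
      then show "ennreal (measure M A + e / 3) \<le> emeasure M U"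
        unfolding emeasure_eq_measure by (rule ennreal_leI)
    qed
    then show False
      unfolding emeasure_eq_measure using e by (simp add: ennreal_le_iff)
  qed
  then obtain U where U: "A \<subseteq> U" "open U" "measure M U < measure M A + e / 3" by blast
  have "\<exists>r. \<forall>x\<in>K. r x > 0 \<and> ball x (r x) \<subseteq> U"
    using K(1) U(1,2) open_contains_ball by (intro bchoice) blast
  then obtain r where r: "\<And>x. x \<in> K \<Longrightarrow> r x > 0 \<and> ball x (r x) \<subseteq> U" by blast
  have "K \<subseteq> (\<Union>x\<in>K. ball x (r x))" using r by fastforce
  then obtain D where D: "D \<subseteq> K" "finite D" "K \<subseteq> (\<Union>x\<in>D. ball x (r x))"
    using compactE_image[OF K(2), of K "\<lambda>x. ball x (r x)"] by auto
  define B where "B = (\<Union>x\<in>D. ball x (r x))"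
  have B: "K \<subseteq> B" "B \<subseteq> U" using D r by (auto simp: B_def)
  obtain \<psi> where \<psi>: "\<And>n. cutoff (\<psi> n)" "AE x in lborel. (\<lambda>n. \<psi> n x) \<longlonglongrightarrow> indicator B x"
    unfolding B_def by (rule union_of_balls_approx[OF D(2), of r "\<lambda>x. x"]) (use r D in auto)
  have [measurable]: "K \<in> sets borel" "U \<in> sets borel" "B \<in> sets borel" "A \<in> sets borel" "\<psi> n \<in> borel_measurable borel" for n
    using K U A \<psi>(1) by (auto simp: B_def compact_imp_closed cutoff_measurable intro!: borel_open open_UN)
  have \<psi>01: "0 \<le> \<psi> n x" "\<psi> n x \<le> 1" for n x using \<psi>(1)[of n] by (auto simp: cutoff_def)
  have "(\<lambda>n. LINT x|M. \<bar>\<psi> n x - indicator B x\<bar>) \<longlonglongrightarrow> (LINT x|M. 0)"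
  proof (rule integral_dominated_convergence[where w = "\<lambda>_. 1"])
    show "AE x in M. (\<lambda>n. \<bar>\<psi> n x - indicator B x\<bar>) \<longlonglongrightarrow> 0"
      using ac[OF \<psi>(2)] by eventually_elim (intro tendsto_rabs_zero LIM_zero)
    show "AE x in M. norm \<bar>\<psi> n x - indicator B x\<bar> \<le> 1" for n
      using \<psi>01[of n] by (intro AE_I2) (auto simp: indicator_def)
  qed measurable
  then have "\<forall>\<^sub>F n in sequentially. (LINT x|M. \<bar>\<psi> n x - indicator B x\<bar>) < e / 3"
    using e by (intro order_tendstoD) auto
  then obtain n where n: "(LINT x|M. \<bar>\<psi> n x - indicator B x\<bar>) < e / 3"
    using eventually_happens'[OF sequentially_bot] by blast
  have i1: "integrable M (\<lambda>x. \<bar>\<psi> n x - indicator B x\<bar>)"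
    by (rule integrable_const_bound[of _ 1]) (use \<psi>01[of n] in \<open>auto simp: indicator_def\<close>)
  have i2: "integrable M (indicator (U - K) :: _ \<Rightarrow> real)"
    by (rule integrable_const_bound[of _ 1]) (auto simp: indicator_def)
  have "(LINT x|M. \<bar>\<psi> n x - indicator A x\<bar>) \<le> (LINT x|M. \<bar>\<psi> n x - indicator B x\<bar> + indicator (U - K) x)"
  proof (rule integral_mono)
    show "integrable M (\<lambda>x. \<bar>\<psi> n x - indicator A x\<bar>)"
      by (rule integrable_const_bound[of _ 1]) (use \<psi>01[of n] in \<open>auto simp: indicator_def\<close>)
    show "integrable M (\<lambda>x. \<bar>\<psi> n x - indicator B x\<bar> + indicator (U - K) x)"
      by (intro Bochner_Integration.integrable_add i1 i2)
    show "\<bar>\<psi> n x - indicator A x\<bar> \<le> \<bar>\<psi> n x - indicator B x\<bar> + indicator (U - K) x" for x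
      using B U K \<psi>01[of n x] by (auto simp: indicator_def)
  qed
  also have "\<dots> = (LINT x|M. \<bar>\<psi> n x - indicator B x\<bar>) + measure M (U - K)"
    using i1 i2 by (simp add: sp)
  also have "measure M (U - K) = measure M U - measure M K"
    using B by (intro finite_measure_Diff) auto
  finally have "(LINT x|M. \<bar>\<psi> n x - indicator A x\<bar>) < e"
    using n K(3) U(3) by linarith
  then show thesis using that \<psi>(1) by blast
qed

text \<open>One cutoff is used for each value of \<open>s\<close>. The bound \<open>L\<close>, the
  sum of the norms of all values, does not depend on the accuracy, so it dominates the whole
  approximating sequence.\<close>

lemma simple_approx:
  fixes M :: "(real^2) measure" and s :: "real^2 \<Rightarrow> complex"
  assumes fin: "finite_measure M" and sets: "sets M = sets borel" and ac: "\<And>P. AE x in lborel. P x \<Longrightarrow> AE x in M. P x"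
    and s: "s \<in> borel_measurable borel" "finite (range s)"
  obtains L where "L \<ge> 0" "\<And>x. norm (s x) \<le> L"
    "\<And>e. e > 0 \<Longrightarrow> \<exists>\<psi>. slow \<psi> \<and> (\<forall>x. norm (\<psi> x) \<le> L) \<and> (LINT x|M. norm (\<psi> x - s x)) < e"
proof -
  interpret finite_measure M by (rule fin)
  have [measurable_cong]: "sets M = sets borel" by (rule sets)
  define L where "L = (\<Sum>y\<in>range s. norm y)"
  have L0: "L \<ge> 0" unfolding L_def by (intro sum_nonneg) auto
  have sL: "norm (s x) \<le> L" for x
    unfolding L_def using s(2) by (intro member_le_sum) auto
  have "\<exists>\<psi>. slow \<psi> \<and> (\<forall>x. norm (\<psi> x) \<le> L) \<and> (LINT x|M. norm (\<psi> x - s x)) < e" if e: "e > 0" for e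
  proof -
    define e' where "e' = e / (L + 1)"
    have e': "e' > 0" using e L0 by (simp add: e'_def)
    have sy: "s -` {y} \<in> sets borel" for y
      using measurable_sets[OF s(1), of "{y}"] by simp
    have "\<exists>\<psi>. cutoff \<psi> \<and> (LINT x|M. \<bar>\<psi> x - indicator (s -` {y}) x\<bar>) < e'" for y
      using indicator_approx[OF fin sets ac sy e'] by metis
    then obtain \<psi> where \<psi>: "\<And>y. cutoff (\<psi> y)" "\<And>y. (LINT x|M. \<bar>\<psi> y x - indicator (s -` {y}) x\<bar>) < e'"
      by metis
    have [measurable]: "\<psi> y \<in> borel_measurable borel" "s -` {y} \<in> sets borel" "s \<in> borel_measurable borel" for y
      using \<psi>(1) by (auto simp: cutoff_measurable sy s(1))
    have \<psi>01: "0 \<le> \<psi> y x" "\<psi> y x \<le> 1" for y x using \<psi>(1)[of y] by (auto simp: cutoff_def)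
    define \<Psi> where "\<Psi> x = (\<Sum>y\<in>range s. y * of_real (\<psi> y x))" for x
    have i: "integrable M (\<lambda>x. \<bar>\<psi> y x - indicator (s -` {y}) x\<bar>)" for y
      by (rule integrable_const_bound[of _ 1]) (use \<psi>01[of y] in \<open>auto simp: indicator_def\<close>)
    have "slow \<Psi>"
      unfolding \<Psi>_def using \<psi>(1) by (intro slow_sum slow_mult slow_const) (simp add: cutoff_def)
    moreover have \<Psi>L: "norm (\<Psi> x) \<le> L" for x
    proof -
      have "norm (\<Psi> x) \<le> (\<Sum>y\<in>range s. norm (y * of_real (\<psi> y x)))"
        unfolding \<Psi>_def by (rule norm_sum)
      also have "\<dots> \<le> L"
        unfolding L_def using \<psi>01 by (intro sum_mono) (simp add: norm_mult mult_right_le_one_le)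
      finally show ?thesis .
    qed
    moreover have "(LINT x|M. norm (\<Psi> x - s x)) < e"
    proof -
      have b: "norm (\<Psi> x - s x) \<le> (\<Sum>y\<in>range s. norm y * \<bar>\<psi> y x - indicator (s -` {y}) x\<bar>)" for x
      proof -
        have "s x = (\<Sum>y\<in>range s. if y = s x then y else 0)" using s(2) by simp
        also have "\<dots> = (\<Sum>y\<in>range s. y * of_real (indicator (s -` {y}) x))"
          by (intro sum.cong refl) (simp add: indicator_def)
        finally have s': "s x = (\<Sum>y\<in>range s. y * of_real (indicator (s -` {y}) x))" .
        have e: "\<Psi> x - s x = (\<Sum>y\<in>range s. y * of_real (\<psi> y x - indicator (s -` {y}) x))"
          unfolding \<Psi>_def of_real_diff right_diff_distrib sum_subtractf s'[symmetric] ..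
        have "norm (\<Psi> x - s x) \<le> (\<Sum>y\<in>range s. norm (y * of_real (\<psi> y x - indicator (s -` {y}) x)))"
          unfolding e by (rule norm_sum)
        then show ?thesis by (simp only: norm_mult norm_of_real)
      qed
      have "(LINT x|M. norm (\<Psi> x - s x)) \<le> (LINT x|M. (\<Sum>y\<in>range s. norm y * \<bar>\<psi> y x - indicator (s -` {y}) x\<bar>))"
      proof (rule integral_mono)
        have [measurable]: "\<Psi> \<in> borel_measurable borel" unfolding \<Psi>_def by measurable
        have m: "(\<lambda>x. norm (\<Psi> x - s x)) \<in> borel_measurable M" by measurable
        show "integrable M (\<lambda>x. norm (\<Psi> x - s x))"
        proof (rule integrable_const_bound[of _ "L + L"])
          show "AE x in M. norm (norm (\<Psi> x - s x)) \<le> L + L"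
            unfolding real_norm_def abs_norm_cancel by (intro AE_I2 order_trans[OF norm_triangle_ineq4 add_mono[OF \<Psi>L sL]])
        qed (rule m)
        show "integrable M (\<lambda>x. \<Sum>y\<in>range s. norm y * \<bar>\<psi> y x - indicator (s -` {y}) x\<bar>)"
          by (intro Bochner_Integration.integrable_sum integrable_mult_right i)
      qed (rule b)
      also have "\<dots> = (\<Sum>y\<in>range s. norm y * (LINT x|M. \<bar>\<psi> y x - indicator (s -` {y}) x\<bar>))"
        using i by (subst Bochner_Integration.integral_sum) (auto intro!: integrable_mult_right)
      also have "\<dots> \<le> (\<Sum>y\<in>range s. norm y * e')"
        using \<psi>(2) by (intro sum_mono mult_left_mono) (auto intro: less_imp_le)
      also have "\<dots> = L * e'" by (simp add: L_def sum_distrib_right)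
      also have "\<dots> < e" using e L0 by (simp add: e'_def field_simps)
      finally show ?thesis .
    qed
    ultimately show ?thesis by blast
  qed
  then show thesis using that L0 sL by blast
qed

section \<open>The duality principle\<close>

text \<open>A single weighted L^1 convergence controls both sides: the part |h| |g| of the weight
  controls the pairing, and the part |g|^2 controls the squared norm. This is the closing step for
  both extensions of the class of multipliers below.\<close>

lemma L2_bound_closed:
  fixes h g :: "real^2 \<Rightarrow> complex" and w :: "real^2 \<Rightarrow> complex" and W :: "nat \<Rightarrow> real^2 \<Rightarrow> complex"
  assumes hg: "integrable lborel (\<lambda>x. norm (h x) * norm (g x))" and gg: "integrable lborel (\<lambda>x. (norm (g x))\<^sup>2)"
    and [measurable]: "h \<in> borel_measurable borel" "g \<in> borel_measurable borel" "w \<in> borel_measurable borel" "\<And>k. W k \<in> borel_measurable borel"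
    and WL: "\<And>k x. norm (W k x) \<le> L" and wL: "\<And>x. norm (w x) \<le> L"
    and conv: "(\<lambda>k. LINT x|lborel. (norm (h x) + norm (g x)) * norm (g x) * norm (W k x - w x)) \<longlonglongrightarrow> 0"
    and bd: "\<And>k. norm (LINT x|lborel. h x * (W k x * g x)) \<le> C * sqrt (LINT x|lborel. (norm (W k x * g x))\<^sup>2)"
  shows "norm (LINT x|lborel. h x * (w x * g x)) \<le> C * sqrt (LINT x|lborel. (norm (w x * g x))\<^sup>2)"
proof -
  have L0: "L \<ge> 0" using wL[of 0] norm_ge_zero order_trans by blast
  let ?\<rho> = "\<lambda>x. (norm (h x) + norm (g x)) * norm (g x)"
  have i\<rho>: "integrable lborel ?\<rho>"
    using Bochner_Integration.integrable_add[OF hg gg] by (simp add: distrib_right power2_eq_square)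
  have ih: "integrable lborel (\<lambda>x. h x * (v x * g x))" if [measurable]: "v \<in> borel_measurable borel" and v: "\<And>x. norm (v x) \<le> L" for v
  proof (rule Bochner_Integration.integrable_bound[OF integrable_mult_right[OF hg, of L]])
    have "norm (h x * (v x * g x)) \<le> norm (L * (norm (h x) * norm (g x)))" for x
    proof -
      have "norm (h x * (v x * g x)) = norm (v x) * (norm (h x) * norm (g x))" by (simp add: norm_mult)
      also have "\<dots> \<le> L * (norm (h x) * norm (g x))" by (intro mult_right_mono v) auto
      finally show ?thesis by (simp add: L0)
    qed
    then show "AE x in lborel. norm (h x * (v x * g x)) \<le> norm (L * (norm (h x) * norm (g x)))" by simp
  qed measurable
  have ig: "integrable lborel (\<lambda>x. (norm (v x * g x))\<^sup>2)" if [measurable]: "v \<in> borel_measurable borel" and v: "\<And>x. norm (v x) \<le> L" for v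
  proof (rule Bochner_Integration.integrable_bound[OF integrable_mult_right[OF gg, of "L\<^sup>2"]])
    have "norm ((norm (v x * g x))\<^sup>2) \<le> norm (L\<^sup>2 * (norm (g x))\<^sup>2)" for x
    proof -
      have "(norm (v x * g x))\<^sup>2 = (norm (v x))\<^sup>2 * (norm (g x))\<^sup>2" by (simp add: norm_mult power_mult_distrib)
      also have "\<dots> \<le> L\<^sup>2 * (norm (g x))\<^sup>2" by (intro mult_right_mono power_mono v) auto
      finally show ?thesis by simp
    qed
    then show "AE x in lborel. norm ((norm (v x * g x))\<^sup>2) \<le> norm (L\<^sup>2 * (norm (g x))\<^sup>2)" by simp
  qed measurable
  let ?D = "\<lambda>k. LINT x|lborel. ?\<rho> x * norm (W k x - w x)"
  have iD: "integrable lborel (\<lambda>x. ?\<rho> x * norm (W k x - w x))" for k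
  proof (rule Bochner_Integration.integrable_bound[OF integrable_mult_right[OF i\<rho>, of "2 * L"]])
    have "norm (?\<rho> x * norm (W k x - w x)) \<le> norm (2 * L * ?\<rho> x)" for x
    proof -
      have "norm (W k x - w x) \<le> 2 * L"
        using norm_triangle_le_diff[OF add_mono[OF WL[of k x] wL[of x]]] by simp
      then have "?\<rho> x * norm (W k x - w x) \<le> ?\<rho> x * (2 * L)" by (intro mult_left_mono) auto
      then show ?thesis by (simp add: L0 mult.commute abs_mult)
    qed
    then show "AE x in lborel. norm (?\<rho> x * norm (W k x - w x)) \<le> norm (2 * L * ?\<rho> x)" by simp
  qed measurable
  have 1: "norm ((LINT x|lborel. h x * (W k x * g x)) - (LINT x|lborel. h x * (w x * g x))) \<le> ?D k" for k
  proof -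
    have eq: "(LINT x|lborel. h x * (W k x * g x)) - (LINT x|lborel. h x * (w x * g x))
        = (LINT x|lborel. h x * (W k x * g x) - h x * (w x * g x))"
      using ih[of "W k"] ih[of w] WL wL by simp
    show ?thesis unfolding eq
    proof (rule order_trans[OF integral_norm_bound integral_mono])
      show "integrable lborel (\<lambda>x. norm (h x * (W k x * g x) - h x * (w x * g x)))"
        using ih[of "W k"] ih[of w] WL wL by (intro integrable_norm Bochner_Integration.integrable_diff) simp_all
      show "norm (h x * (W k x * g x) - h x * (w x * g x)) \<le> ?\<rho> x * norm (W k x - w x)" for x
      proof -
        have "h x * (W k x * g x) - h x * (w x * g x) = h x * g x * (W k x - w x)" by (simp add: algebra_simps)
        then have "norm (h x * (W k x * g x) - h x * (w x * g x)) = norm (h x) * norm (g x) * norm (W k x - w x)"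
          by (simp only: norm_mult)
        also have "\<dots> \<le> ?\<rho> x * norm (W k x - w x)" by (intro mult_right_mono) auto
        finally show ?thesis .
      qed
    qed (rule iD)
  qed
  have 2: "\<bar>(LINT x|lborel. (norm (W k x * g x))\<^sup>2) - (LINT x|lborel. (norm (w x * g x))\<^sup>2)\<bar> \<le> 2 * L * ?D k" for k
  proof -
    have eq: "(LINT x|lborel. (norm (W k x * g x))\<^sup>2) - (LINT x|lborel. (norm (w x * g x))\<^sup>2)
        = (LINT x|lborel. (norm (W k x * g x))\<^sup>2 - (norm (w x * g x))\<^sup>2)"
      using ig[of "W k"] ig[of w] WL wL by simp
    have "norm (LINT x|lborel. (norm (W k x * g x))\<^sup>2 - (norm (w x * g x))\<^sup>2) \<le> (LINT x|lborel. 2 * L * (?\<rho> x * norm (W k x - w x)))"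
    proof (rule order_trans[OF integral_norm_bound integral_mono])
      show "integrable lborel (\<lambda>x. norm ((norm (W k x * g x))\<^sup>2 - (norm (w x * g x))\<^sup>2))"
        using ig[of "W k"] ig[of w] WL wL by (intro integrable_norm Bochner_Integration.integrable_diff) simp_all
      show "integrable lborel (\<lambda>x. 2 * L * (?\<rho> x * norm (W k x - w x)))"
        by (intro integrable_mult_right iD)
      show "norm ((norm (W k x * g x))\<^sup>2 - (norm (w x * g x))\<^sup>2) \<le> 2 * L * (?\<rho> x * norm (W k x - w x))" for x
      proof -
        have "(norm (W k x * g x))\<^sup>2 - (norm (w x * g x))\<^sup>2 = (norm (g x))\<^sup>2 * (norm (W k x) + norm (w x)) * (norm (W k x) - norm (w x))"
          by (simp add: norm_mult power2_eq_square algebra_simps)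
        then have "norm ((norm (W k x * g x))\<^sup>2 - (norm (w x * g x))\<^sup>2) = (norm (g x))\<^sup>2 * (norm (W k x) + norm (w x)) * \<bar>norm (W k x) - norm (w x)\<bar>"
          by (simp add: abs_mult)
        also have "\<dots> \<le> ?\<rho> x * (2 * L) * norm (W k x - w x)"
        proof (intro mult_mono)
          show "norm (W k x) + norm (w x) \<le> 2 * L" using add_mono[OF WL[of k x] wL[of x]] by simp
          show "(norm (g x))\<^sup>2 \<le> ?\<rho> x" by (simp add: power2_eq_square distrib_right)
          show "\<bar>norm (W k x) - norm (w x)\<bar> \<le> norm (W k x - w x)" by (rule norm_triangle_ineq3)
        qed (auto simp: L0)
        finally show ?thesis by (simp only: mult_ac)
      qed
    qed
    then show ?thesis unfolding eq by simp
  qed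
  have A: "(\<lambda>k. LINT x|lborel. h x * (W k x * g x)) \<longlonglongrightarrow> (LINT x|lborel. h x * (w x * g x))"
    by (rule Lim_transform_bound[OF always_eventually, THEN LIM_zero_cancel, OF _ conv]) (use 1 in simp)
  have B: "(\<lambda>k. LINT x|lborel. (norm (W k x * g x))\<^sup>2) \<longlonglongrightarrow> (LINT x|lborel. (norm (w x * g x))\<^sup>2)"
  proof (rule LIM_zero_cancel, rule Lim_null_comparison[OF always_eventually])
    show "(\<lambda>k. 2 * L * ?D k) \<longlonglongrightarrow> 0" using tendsto_mult[OF tendsto_const conv, of "2 * L"] by simp
  qed (use 2 in simp)
  show ?thesis
    by (rule tendsto_le[OF sequentially_bot tendsto_mult[OF tendsto_const tendsto_real_sqrt[OF B]] tendsto_norm[OF A] always_eventually])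
       (use bd in blast)
qed

text \<open>The function \<open>h\<close> is visible only through pairings with Schwartz functions.
  Test functions of the form \<open>w * gauss\<close> allow \<open>w\<close> to be enlarged from
  slow to simple to bounded measurable; then \<open>w * gauss\<close> can be taken to be a
  truncation of the conjugate of \<open>h\<close>, and the bound becomes J \<le> C sqrt J.\<close>

theorem L2_duality:
  fixes h :: "real^2 \<Rightarrow> complex"
  assumes [measurable]: "h \<in> borel_measurable borel"
    and int: "\<And>\<phi>. schwartz \<phi> \<Longrightarrow> integrable lborel (\<lambda>x. h x * \<phi> x)"
    and bd: "\<And>\<phi>. schwartz \<phi> \<Longrightarrow> norm (LINT x|lborel. h x * \<phi> x) \<le> C * sqrt (LINT x|lborel. (norm (\<phi> x))\<^sup>2)"
    and C: "C \<ge> 0"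
  shows "integrable lborel (\<lambda>x. (norm (h x))\<^sup>2)" "(LINT x|lborel. (norm (h x))\<^sup>2) \<le> C\<^sup>2"
proof -
  have [measurable]: "gauss \<in> borel_measurable borel" by (rule schwartz_measurable[OF schwartz_gauss])
  have hg: "integrable lborel (\<lambda>x. norm (h x) * norm (gauss x))"
    using integrable_norm[OF int[OF schwartz_gauss]] by (simp add: norm_mult)
  have gg: "integrable lborel (\<lambda>x. (norm (gauss x))\<^sup>2)" by (rule schwartz_square_integrable[OF schwartz_gauss])
  let ?\<rho> = "\<lambda>x. (norm (h x) + norm (gauss x)) * norm (gauss x)"
  have i\<rho>: "integrable lborel ?\<rho>"
    using Bochner_Integration.integrable_add[OF hg gg] by (simp add: distrib_right power2_eq_square)
  define M where "M = density lborel (\<lambda>x. ennreal (?\<rho> x))"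
  have sets: "sets M = sets borel" by (simp add: M_def)
  have fin: "finite_measure M"
  proof
    have "emeasure M (space M) = (\<integral>\<^sup>+x. ennreal (?\<rho> x) \<partial>lborel)"
      unfolding M_def by (subst emeasure_density) auto
    also have "\<dots> < \<infinity>" using i\<rho> unfolding integrable_iff_bounded by simp
    finally show "emeasure M (space M) \<noteq> \<infinity>" by simp
  qed
  have ac: "AE x in M. P x" if "AE x in lborel. P x" for P
    unfolding M_def using that by (subst AE_density) auto
  have LM: "(LINT x|M. f x) = (LINT x|lborel. ?\<rho> x * f x)" if "f \<in> borel_measurable borel" for f :: "_ \<Rightarrow> real"
    unfolding M_def using that by (subst integral_density) auto
  have simple: "norm (LINT x|lborel. h x * (s x * gauss x)) \<le> C * sqrt (LINT x|lborel. (norm (s x * gauss x))\<^sup>2)"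
    if s: "s \<in> borel_measurable borel" "finite (range s)" for s
  proof -
    obtain L where L: "L \<ge> 0" "\<And>x. norm (s x) \<le> L"
      "\<And>e. e > 0 \<Longrightarrow> \<exists>\<psi>. slow \<psi> \<and> (\<forall>x. norm (\<psi> x) \<le> L) \<and> (LINT x|M. norm (\<psi> x - s x)) < e"
      using simple_approx[OF fin sets ac s] by metis
    have "\<forall>k. \<exists>\<psi>. slow \<psi> \<and> (\<forall>x. norm (\<psi> x) \<le> L) \<and> (LINT x|M. norm (\<psi> x - s x)) < inverse (real (Suc k))"
      using L(3) by simp
    then obtain W where W: "\<And>k. slow (W k)" "\<And>k x. norm (W k x) \<le> L" "\<And>k. (LINT x|M. norm (W k x - s x)) < inverse (real (Suc k))"
      by metis
    have Wm: "W k \<in> borel_measurable borel" for k by (rule slow_measurable[OF W(1)])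
    show ?thesis
    proof (rule L2_bound_closed[OF hg gg _ _ s(1) Wm W(2) L(2)])
      have "(\<lambda>k. LINT x|M. norm (W k x - s x)) \<longlonglongrightarrow> 0"
      proof (rule tendsto_sandwich[OF _ _ tendsto_const LIMSEQ_inverse_real_of_nat])
        show "\<forall>\<^sub>F k in sequentially. 0 \<le> (LINT x|M. norm (W k x - s x))"
          by (intro always_eventually allI integral_nonneg_AE AE_I2 norm_ge_zero)
        show "\<forall>\<^sub>F k in sequentially. (LINT x|M. norm (W k x - s x)) \<le> inverse (real (Suc k))"
          using W(3) by (intro always_eventually allI less_imp_le)
      qed
      moreover have "(LINT x|M. norm (W k x - s x)) = (LINT x|lborel. ?\<rho> x * norm (W k x - s x))" for k
        by (rule LM) (use Wm s(1) in measurable)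
      ultimately show "(\<lambda>k. LINT x|lborel. ?\<rho> x * norm (W k x - s x)) \<longlonglongrightarrow> 0" by simp
      show "norm (LINT x|lborel. h x * (W k x * gauss x)) \<le> C * sqrt (LINT x|lborel. (norm (W k x * gauss x))\<^sup>2)" for k
        by (rule bd) (rule schwartz_mult[OF W(1) schwartz_gauss])
    qed measurable
  qed
  have bounded: "norm (LINT x|lborel. h x * (w x * gauss x)) \<le> C * sqrt (LINT x|lborel. (norm (w x * gauss x))\<^sup>2)"
    if w[measurable]: "w \<in> borel_measurable borel" and wL: "\<And>x. norm (w x) \<le> L" for w L
  proof -
    obtain S where S: "\<And>i. simple_function borel (S i)" "\<And>x. (\<lambda>i. S i x) \<longlonglongrightarrow> w x" "\<And>i x. norm (S i x) \<le> 2 * norm (w x)"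
      using borel_measurable_implies_sequence_metric[OF w, of 0] by auto
    have Sm[measurable]: "S i \<in> borel_measurable borel" for i by (rule borel_measurable_simple_function[OF S(1)])
    have L0: "L \<ge> 0" using wL[of 0] norm_ge_zero order_trans by blast
    have SL: "norm (S i x) \<le> 2 * L" for i x using S(3)[of i x] wL[of x] by linarith
    have wL2: "norm (w x) \<le> 2 * L" for x using wL[of x] L0 by linarith
    show ?thesis
    proof (rule L2_bound_closed[OF hg gg _ _ w Sm SL wL2])
      have "(\<lambda>k. LINT x|lborel. ?\<rho> x * norm (S k x - w x)) \<longlonglongrightarrow> (LINT x|lborel. ?\<rho> x * norm (w x - w x))"
      proof (rule integral_dominated_convergence[where w = "\<lambda>x. 4 * L * ?\<rho> x"])
        show "integrable lborel (\<lambda>x. 4 * L * ?\<rho> x)" by (intro integrable_mult_right i\<rho>)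
        show "AE x in lborel. (\<lambda>k. ?\<rho> x * norm (S k x - w x)) \<longlonglongrightarrow> ?\<rho> x * norm (w x - w x)"
          by (intro AE_I2 tendsto_intros S(2))
        have "norm (?\<rho> x * norm (S k x - w x)) \<le> 4 * L * ?\<rho> x" for k x
        proof -
          have "norm (S k x - w x) \<le> 4 * L"
            using norm_triangle_le_diff[OF add_mono[OF SL[of k x] wL2[of x]]] by simp
          then have "?\<rho> x * norm (S k x - w x) \<le> ?\<rho> x * (4 * L)" by (intro mult_left_mono) auto
          then show ?thesis by (simp add: mult.commute abs_mult)
        qed
        then show "AE x in lborel. norm (?\<rho> x * norm (S k x - w x)) \<le> 4 * L * ?\<rho> x" for k by simp
      qed measurable
      then show "(\<lambda>k. LINT x|lborel. ?\<rho> x * norm (S k x - w x)) \<longlonglongrightarrow> 0" by simp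
      show "norm (LINT x|lborel. h x * (S k x * gauss x)) \<le> C * sqrt (LINT x|lborel. (norm (S k x * gauss x))\<^sup>2)" for k
        using S(1)[of k] by (intro simple Sm) (simp add: simple_function_def)
    qed measurable
  qed
  \<comment> \<open>Both cuts are needed: the bound on \<open>norm x\<close> keeps
    \<open>1 / gauss\<close> bounded, and the bound on \<open>norm (h x)\<close> keeps the conjugate
    of \<open>h\<close> bounded.\<close>
  define E where "E R = {x. norm x \<le> real R \<and> norm (h x) \<le> real R}" for R :: nat
  have Em[measurable]: "E R \<in> sets borel" for R unfolding E_def by measurable
  define J where "J R x = indicator (E R) x * (norm (h x))\<^sup>2" for R x
  have JC: "integrable lborel (J R)" "(LINT x|lborel. J R x) \<le> C\<^sup>2" for R
  proof -
    \<comment> \<open>With this choice both the pairing and the squared norm of the test function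
      equal the integral of \<open>J R\<close>.\<close>
    define w where "w x = indicator (E R) x * cnj (h x) / gauss x" for x
    have "(\<lambda>x. cnj (h x)) \<in> borel_measurable borel"
      by (rule measurable_compose[OF assms(1)]) (intro borel_measurable_continuous_onI continuous_intros)
    then have [measurable]: "w \<in> borel_measurable borel"
      unfolding w_def using schwartz_measurable[OF schwartz_gauss] Em[of R] by measurable
    have g0: "gauss x \<noteq> 0" for x by (simp add: gauss_def)
    have wL: "norm (w x) \<le> real R * exp (1/2 * (real R)\<^sup>2)" for x
    proof (cases "x \<in> E R")
      case True
      have ng: "norm (gauss x) = exp (- (1/2 * (norm x)\<^sup>2))"
        unfolding gauss_def norm_exp_eq_Re by simp
      have w': "w x = cnj (h x) / gauss x" using True by (simp add: w_def)
      have "norm (w x) = norm (h x) * exp (1/2 * (norm x)\<^sup>2)"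
        unfolding w' norm_divide ng by (simp only: complex_mod_cnj exp_minus divide_inverse inverse_inverse_eq)
      also have "\<dots> \<le> real R * exp (1/2 * (real R)\<^sup>2)"
        using True by (intro mult_mono) (auto simp: E_def power_mono)
      finally show ?thesis .
    next
      case False
      then show ?thesis by (simp add: w_def)
    qed
    have wg: "w x * gauss x = indicator (E R) x * cnj (h x)" for x
      using g0[of x] by (simp add: w_def)
    have a: "h x * (w x * gauss x) = of_real (J R x)" for x
      unfolding wg J_def by (cases "x \<in> E R") (simp_all add: complex_norm_square del: of_real_power)
    have b: "(norm (w x * gauss x))\<^sup>2 = J R x" for x
      unfolding wg J_def by (simp add: norm_mult indicator_def)
    have J0: "0 \<le> J R x" for x by (simp add: J_def)
    show iJ: "integrable lborel (J R)"
    proof (rule Bochner_Integration.integrable_bound[OF integrable_mult_right[OF i\<rho>, of "real R * exp (1/2 * (real R)\<^sup>2)"]])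
      have "norm (J R x) \<le> norm (real R * exp (1/2 * (real R)\<^sup>2) * ?\<rho> x)" for x
      proof -
        have "norm (h x * (w x * gauss x)) = norm (w x) * (norm (h x) * norm (gauss x))"
          by (simp add: norm_mult)
        also have "\<dots> \<le> (real R * exp (1/2 * (real R)\<^sup>2)) * ?\<rho> x"
          by (intro mult_mono wL mult_right_mono) auto
        finally have "norm (J R x) \<le> (real R * exp (1/2 * (real R)\<^sup>2)) * ?\<rho> x"
          unfolding a by simp
        from order_trans[OF this abs_ge_self] show ?thesis by (simp only: real_norm_def)
      qed
      then show "AE x in lborel. norm (J R x) \<le> norm (real R * exp (1/2 * (real R)\<^sup>2) * ?\<rho> x)" by simp
    qed (unfold J_def, measurable)
    have "norm (complex_of_real (LINT x|lborel. J R x)) \<le> C * sqrt (LINT x|lborel. J R x)"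
      using bounded[of w, OF _ wL] unfolding a b integral_complex_of_real by simp
    moreover have J0': "0 \<le> (LINT x|lborel. J R x)" using J0 by (intro integral_nonneg_AE) simp
    ultimately have "(LINT x|lborel. J R x) \<le> C * sqrt (LINT x|lborel. J R x)" by simp
    \<comment> \<open>The truncated integral is finite, so one square root can be cancelled; if it
      is zero the bound is trivial.\<close>
    then have "sqrt (LINT x|lborel. J R x) * sqrt (LINT x|lborel. J R x) \<le> C * sqrt (LINT x|lborel. J R x)"
      using J0' by simp
    then have "sqrt (LINT x|lborel. J R x) \<le> C"
      using C real_sqrt_ge_zero[OF J0'] mult_right_le_imp_le[of "sqrt (LINT x|lborel. J R x)" "sqrt (LINT x|lborel. J R x)" C]
      by (cases "sqrt (LINT x|lborel. J R x) = 0") linarith+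
    then show "(LINT x|lborel. J R x) \<le> C\<^sup>2"
      using power_mono[OF _ real_sqrt_ge_zero[OF J0'], of C 2] J0' by simp
  qed
  have mono: "mono (\<lambda>R. J R x)" for x
    unfolding J_def E_def by (rule monoI) (auto simp: indicator_def)
  have lim: "(\<lambda>R. J R x) \<longlonglongrightarrow> (norm (h x))\<^sup>2" for x
  proof (rule tendsto_eventually)
    obtain R0 where "max (norm x) (norm (h x)) \<le> real R0" using real_arch_simple by blast
    then show "\<forall>\<^sub>F R in sequentially. J R x = (norm (h x))\<^sup>2"
      by (intro eventually_sequentiallyI[of R0]) (auto simp: J_def E_def indicator_def)
  qed
  have J0: "0 \<le> J R x" for R x by (simp add: J_def)
  have "(\<integral>\<^sup>+x. ennreal ((norm (h x))\<^sup>2) \<partial>lborel) = (SUP R. \<integral>\<^sup>+x. ennreal (J R x) \<partial>lborel)"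
  proof -
    have "ennreal ((norm (h x))\<^sup>2) = (SUP R. ennreal (J R x))" for x
      using LIMSEQ_unique[OF LIMSEQ_SUP tendsto_ennrealI[OF lim[of x]]] mono[of x]
      by (simp add: incseq_def mono_def ennreal_leI)
    then show ?thesis
      using mono by (subst nn_integral_monotone_convergence_SUP[symmetric])
        (auto simp: incseq_def le_fun_def mono_def ennreal_leI J_def)
  qed
  also have "\<dots> \<le> ennreal (C\<^sup>2)"
  proof (rule SUP_least)
    fix R
    have "(\<integral>\<^sup>+x. ennreal (J R x) \<partial>lborel) = ennreal (LINT x|lborel. J R x)"
      by (rule nn_integral_eq_integral[OF JC(1)]) (simp add: J0)
    then show "(\<integral>\<^sup>+x. ennreal (J R x) \<partial>lborel) \<le> ennreal (C\<^sup>2)"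
      using JC(2)[of R] by (simp add: ennreal_leI)
  qed
  finally have fin2: "(\<integral>\<^sup>+x. ennreal ((norm (h x))\<^sup>2) \<partial>lborel) \<le> ennreal (C\<^sup>2)" .
  then show "integrable lborel (\<lambda>x. (norm (h x))\<^sup>2)"
    unfolding integrable_iff_bounded by (simp add: le_less_trans[OF _ ennreal_less_top])
  then have "ennreal (LINT x|lborel. (norm (h x))\<^sup>2) \<le> ennreal (C\<^sup>2)"
    using fin2 by (simp add: nn_integral_eq_integral)
  then show "(LINT x|lborel. (norm (h x))\<^sup>2) \<le> C\<^sup>2"
    by (simp add: ennreal_le_iff)
qed

section \<open>Littlewood--Paley blocks\<close>

text \<open>The value is 0 if the square is not integrable, so bounds on \<open>l2\<close> carry
  information only together with separate integrability statements.\<close>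

definition l2 :: "(real^2 \<Rightarrow> complex) \<Rightarrow> real" where
  "l2 f = sqrt (LINT x|lborel. (norm (f x))\<^sup>2)"

lemma l2_nonneg [simp]: "0 \<le> l2 f"
  unfolding l2_def by (intro real_sqrt_ge_zero integral_nonneg_AE AE_I2) simp

lemma l2_sq: "(l2 f)\<^sup>2 = (LINT x|lborel. (norm (f x))\<^sup>2)"
  unfolding l2_def by (intro real_sqrt_pow2 integral_nonneg_AE AE_I2) simp

lemma l2_fourier: "schwartz f \<Longrightarrow> l2 (fourier f) = 2 * pi * l2 f"
  unfolding l2_def plancherel real_sqrt_mult real_sqrt_abs by simp

text \<open>In this normalisation the inverse transform divides the L^2 norm by 2 pi > 1. Being a
  contraction is enough for every later use, which avoids carrying the exact factor.\<close>

lemma l2_inv_fourier: "schwartz \<phi> \<Longrightarrow> l2 (inv_fourier \<phi>) \<le> l2 \<phi>"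
proof -
  assume \<phi>: "schwartz \<phi>"
  have "l2 \<phi> = 2 * pi * l2 (inv_fourier \<phi>)"
    using l2_fourier[OF schwartz_inv_fourier[OF \<phi>]] by (simp only: fourier_inv_fourier[OF \<phi>])
  moreover have "1 * l2 (inv_fourier \<phi>) \<le> 2 * pi * l2 (inv_fourier \<phi>)"
    using pi_gt3 by (intro mult_right_mono) auto
  ultimately show ?thesis by simp
qed

lemma l2_mult:
  fixes f g :: "real^2 \<Rightarrow> complex"
  assumes [measurable]: "f \<in> borel_measurable borel" "g \<in> borel_measurable borel"
    and f: "integrable lborel (\<lambda>x. (norm (f x))\<^sup>2)" and g: "integrable lborel (\<lambda>x. (norm (g x))\<^sup>2)"
  shows "integrable lborel (\<lambda>x. f x * g x)" "(LINT x|lborel. norm (f x * g x)) \<le> l2 f * l2 g"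
proof -
  show i: "integrable lborel (\<lambda>x. f x * g x)"
  proof (rule Bochner_Integration.integrable_bound[OF Bochner_Integration.integrable_add[OF f g]])
    have "norm (f x * g x) \<le> norm ((norm (f x))\<^sup>2 + (norm (g x))\<^sup>2)" for x
    proof -
      have "2 * norm (f x) * norm (g x) \<le> (norm (f x))\<^sup>2 + (norm (g x))\<^sup>2" by (rule sum_squares_bound)
      moreover have "0 \<le> norm (f x) * norm (g x)" by simp
      ultimately show ?thesis unfolding norm_mult real_norm_def by linarith
    qed
    then show "AE x in lborel. norm (f x * g x) \<le> norm ((norm (f x))\<^sup>2 + (norm (g x))\<^sup>2)" by simp
  qed measurable
  define L where "L = (LINT x|lborel. norm (f x * g x))"
  have L0: "0 \<le> L" unfolding L_def by (intro integral_nonneg_AE AE_I2) simp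
  have "(\<integral>\<^sup>+x. ennreal (norm (f x)) * ennreal (norm (g x)) \<partial>lborel) = ennreal L"
    unfolding L_def using nn_integral_eq_integral[OF integrable_norm[OF i]] by (simp add: norm_mult ennreal_mult)
  moreover have "(\<integral>\<^sup>+x. ennreal (norm (f x)) ^ 2 \<partial>lborel) = ennreal ((l2 f)\<^sup>2)"
    unfolding l2_sq using nn_integral_eq_integral[OF f] by (simp add: ennreal_power)
  moreover have "(\<integral>\<^sup>+x. ennreal (norm (g x)) ^ 2 \<partial>lborel) = ennreal ((l2 g)\<^sup>2)"
    unfolding l2_sq using nn_integral_eq_integral[OF g] by (simp add: ennreal_power)
  ultimately have "(ennreal L)\<^sup>2 \<le> ennreal ((l2 f)\<^sup>2) * ennreal ((l2 g)\<^sup>2)"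
    using Cauchy_Schwarz_nn_integral[of "\<lambda>x. ennreal (norm (f x))" lborel "\<lambda>x. ennreal (norm (g x))"] by simp
  then have "ennreal (L\<^sup>2) \<le> ennreal ((l2 f * l2 g)\<^sup>2)"
    using L0 by (simp add: ennreal_power ennreal_mult[symmetric] power_mult_distrib)
  then have "L\<^sup>2 \<le> (l2 f * l2 g)\<^sup>2" by (simp add: ennreal_le_iff)
  then show "(LINT x|lborel. norm (f x * g x)) \<le> l2 f * l2 g"
    unfolding L_def[symmetric] by (rule power2_le_imp_le) simp
qed

lemma schwartz_l2_mult:
  assumes "schwartz f" "schwartz g"
  shows "(LINT x|lborel. norm (f x * g x)) \<le> l2 f * l2 g"
  by (intro l2_mult schwartz_measurable schwartz_square_integrable assms)

text \<open>Replaces Hoelder's inequality with a dual exponent. After normalisation by a supremum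
  bound one has b \<le> 1; if b \<ge> a the square wins, and otherwise a b is at most a for a \<ge>
  1 and at most a^2 for a < 1. Both are below a^p precisely because 1 \<le> p \<le> 2.\<close>

lemma mult_le_powr_plus_square:
  fixes a b :: real
  assumes "0 \<le> a" "0 \<le> b" "b \<le> 1" "1 \<le> p" "p \<le> 2"
  shows "a * b \<le> a powr p + b\<^sup>2"
proof -
  consider "a \<le> b" | "b < a" "1 \<le> a" | "b < a" "a < 1" by linarith
  then show ?thesis
  proof cases
    case 1
    then have "a * b \<le> b * b" using assms by (intro mult_right_mono)
    also have "\<dots> \<le> a powr p + b\<^sup>2" by (simp add: power2_eq_square)
    finally show ?thesis .
  next
    case 2
    have "a * b \<le> a * 1" using assms by (intro mult_left_mono)
    also have "\<dots> = a powr 1" using assms by simp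
    also have "\<dots> \<le> a powr p" using 2 assms by (intro powr_mono)
    finally show ?thesis using zero_le_power2[of b] by linarith
  next
    case 3
    then have a: "a > 0" using assms by linarith
    have "a * b \<le> a * a" using 3 assms by (intro mult_left_mono) auto
    also have "\<dots> = a powr 2" using a by (simp add: power2_eq_square)
    also have "\<dots> \<le> a powr p" using 3 a assms by (intro powr_mono') auto
    finally show ?thesis using zero_le_power2[of b] by linarith
  qed
qed

section \<open>The dyadic partition of unity\<close>

locale lp =
  fixes \<Phi> :: "int \<Rightarrow> real^2 \<Rightarrow> complex"
  assumes LP: "littlewood_paley \<Phi>"
begin

abbreviation m :: "int \<Rightarrow> real^2 \<Rightarrow> complex" where "m j \<equiv> fourier (\<Phi> j)"

lemma schwartz_m: "schwartz (m j)"
  using LP by (simp add: littlewood_paley_def schwartz_fourier)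

lemma m_scale: "m j \<xi> = m 0 ((2 powi (-j)) *\<^sub>R \<xi>)"
  using LP unfolding littlewood_paley_def by blast

lemma m_real: "m j \<xi> = of_real (Re (m j \<xi>))" "0 \<le> Re (m j \<xi>)" "Re (m j \<xi>) \<le> 1"
proof -
  have "m 0 \<eta> \<in> \<real> \<and> 0 \<le> Re (m 0 \<eta>) \<and> Re (m 0 \<eta>) \<le> 1" for \<eta>
    using LP unfolding littlewood_paley_def by blast
  then have "m j \<xi> \<in> \<real> \<and> 0 \<le> Re (m j \<xi>) \<and> Re (m j \<xi>) \<le> 1"
    unfolding m_scale[of j \<xi>] .
  then show "m j \<xi> = of_real (Re (m j \<xi>))" "0 \<le> Re (m j \<xi>)" "Re (m j \<xi>) \<le> 1" by simp_all
qed

lemma norm_m_le: "norm (m j \<xi>) \<le> 1"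
  using m_real[of j \<xi>] by (metis abs_of_nonneg norm_of_real)

lemma m_has_sum: "\<xi> \<noteq> 0 \<Longrightarrow> ((\<lambda>j. m j \<xi>) has_sum 1) UNIV"
  using LP unfolding littlewood_paley_def by blast

lemma m_support:
  assumes "m j \<xi> \<noteq> 0" shows "2 powi (j - 1) \<le> norm \<xi>" "norm \<xi> \<le> 2 powi (j + 1)"
proof -
  have "(2 powi (-j)) *\<^sub>R \<xi> \<in> {\<xi>. m 0 \<xi> \<noteq> 0}" using assms m_scale by simp
  moreover have "closure {\<xi>. m 0 \<xi> \<noteq> 0} \<subseteq> {\<xi>. 1/2 \<le> norm \<xi> \<and> norm \<xi> \<le> 2}"
    using LP unfolding littlewood_paley_def by (elim conjE)
  ultimately have "(2 powi (-j)) *\<^sub>R \<xi> \<in> {\<xi>. 1/2 \<le> norm \<xi> \<and> norm \<xi> \<le> 2}"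
    by (rule subsetD[OF subset_trans[OF closure_subset], rotated])
  moreover have "norm ((2 powi (-j)) *\<^sub>R \<xi>) = norm \<xi> / 2 powi j"
    unfolding norm_scaleR power_int_minus by (simp add: divide_inverse)
  ultimately have n: "1/2 \<le> norm \<xi> / 2 powi j" "norm \<xi> / 2 powi j \<le> 2"
    by (simp_all only: mem_Collect_eq)
  have t: "2 powi j > (0::real)" "2 powi (j - 1) = (2 powi j / 2 :: real)" "2 powi (j + 1) = (2 powi j * 2 :: real)"
    using power_int_diff[of "2::real" j 1] power_int_add[of "2::real" j 1] by simp_all
  have aux1: "0 < t \<Longrightarrow> 1/2 \<le> a / t \<Longrightarrow> t / 2 \<le> a" and aux2: "0 < t \<Longrightarrow> a / t \<le> 2 \<Longrightarrow> a \<le> t * 2" for a t :: real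
    by (simp_all add: field_simps)
  show "2 powi (j - 1) \<le> norm \<xi>" "norm \<xi> \<le> 2 powi (j + 1)"
    unfolding t(2,3) by (rule aux1[OF t(1) n(1)], rule aux2[OF t(1) n(2)])
qed

lemma m_near_zero:
  assumes "norm \<xi> < 2 powi (j - 1)" shows "m j \<xi> = 0"
  using assms m_support(1)[of j \<xi>] by fastforce

lemma m_zero [simp]: "m j 0 = 0"
  by (rule m_near_zero) simp

text \<open>By the closed bounds on the supports, the annuli of \<open>j\<close> and
  \<open>j + 2\<close> may share a sphere, hence a window of two indices on each side.\<close>

lemma m_overlap:
  assumes "m j \<xi> \<noteq> 0" "m l \<xi> \<noteq> 0" shows "l \<in> {j-2..j+2}"
proof -
  have "2 powi (j - 1) \<le> (2 powi (l + 1) :: real)" "2 powi (l - 1) \<le> (2 powi (j + 1) :: real)"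
    using m_support[OF assms(1)] m_support[OF assms(2)] by linarith+
  then have "j - 1 \<le> l + 1" "l - 1 \<le> j + 1"
    using power_int_strict_increasing[of "l + 1" "j - 1" "2::real"] power_int_strict_increasing[of "j + 1" "l - 1" "2::real"]
    by linarith+
  then show ?thesis by simp
qed

text \<open>The usual widened symbol, equal to 1 wherever \<open>m j\<close> does not vanish. It has
  five summands, each of norm at most 1.\<close>

definition fat :: "int \<Rightarrow> real^2 \<Rightarrow> complex" where
  "fat j \<xi> = (\<Sum>l\<in>{j-2..j+2}. m l \<xi>)"

lemma sum_m_eq_1:
  assumes "\<xi> \<noteq> 0" "finite J" "\<And>l. m l \<xi> \<noteq> 0 \<Longrightarrow> l \<in> J" shows "(\<Sum>l\<in>J. m l \<xi>) = 1"
proof -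
  have "((\<lambda>j. m j \<xi>) has_sum (\<Sum>l\<in>J. m l \<xi>)) UNIV"
    by (rule has_sum_finite_neutralI[OF assms(2)]) (use assms in auto)
  then show ?thesis using m_has_sum[OF assms(1)] has_sum_unique by blast
qed

lemma m_fat: "m j \<xi> * fat j \<xi> = m j \<xi>"
proof (cases "m j \<xi> = 0")
  case False
  then have "\<xi> \<noteq> 0" by auto
  then have "fat j \<xi> = 1"
    unfolding fat_def using m_overlap[OF False] by (intro sum_m_eq_1) auto
  then show ?thesis by simp
qed simp

lemma schwartz_fat: "schwartz (fat j)"
  unfolding fat_def[abs_def] by (intro schwartz_sum schwartz_m)

lemma fat_scale: "fat j \<xi> = fat 0 ((2 powi (-j)) *\<^sub>R \<xi>)"
proof -
  have "fat j \<xi> = (\<Sum>l\<in>{-2..2}. m (l + j) \<xi>)"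
    unfolding fat_def by (rule sum.reindex_bij_witness[of _ "\<lambda>l. l + j" "\<lambda>l. l - j"]) auto
  also have "\<dots> = (\<Sum>l\<in>{-2..2}. m l ((2 powi (-j)) *\<^sub>R \<xi>))"
  proof (intro sum.cong refl)
    fix l
    have "2 powi (- (l + j)) = (2 powi (-l) * 2 powi (-j) :: real)"
      by (simp add: power_int_add[symmetric])
    then show "m (l + j) \<xi> = m l ((2 powi (-j)) *\<^sub>R \<xi>)"
      unfolding m_scale[of "l + j"] m_scale[of l] by simp
  qed
  finally show ?thesis by (simp add: fat_def)
qed

lemma norm_fat_le: "norm (fat j \<xi>) \<le> 5"
proof -
  have "norm (fat j \<xi>) \<le> (\<Sum>l\<in>{j-2..j+2}. 1)"
    unfolding fat_def by (intro order_trans[OF norm_sum] sum_mono norm_m_le)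
  then show ?thesis by simp
qed

section \<open>Bernstein's inequality in dual form\<close>

lemma l2_fat: "l2 (fat j) = 2 powi j * l2 (fat 0)"
proof -
  have [measurable]: "fat 0 \<in> borel_measurable borel" by (rule schwartz_measurable[OF schwartz_fat])
  have meas: "(\<lambda>x. (norm (fat 0 x))\<^sup>2) \<in> borel_measurable borel" by measurable
  have "(LINT x|lborel. (norm (fat 0 x))\<^sup>2) = (2 powi (-j))\<^sup>2 *\<^sub>R (LINT x|lborel. (norm (fat 0 ((2 powi (-j)) *\<^sub>R x)))\<^sup>2)"
    by (rule lborel_integral_scale[OF meas]) simp
  then have "(l2 (fat 0))\<^sup>2 = (2 powi (-j) * l2 (fat j))\<^sup>2"
    unfolding power_mult_distrib l2_sq fat_scale[of j] by simp
  then have "l2 (fat 0) = 2 powi (-j) * l2 (fat j)"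
    by (rule power2_eq_imp_eq) auto
  then show ?thesis by (simp add: power_int_minus)
qed

text \<open>Test functions are written as transforms from here on: the inverse transform in the
  multiplier then cancels, and a block acts by multiplying the frequency-side test function by
  \<open>m j\<close>.\<close>

lemma LP_block_fourier:
  "schwartz \<theta> \<Longrightarrow> LP_block \<Phi> j T (fourier \<theta>) = T (fourier (\<lambda>\<xi>. m j \<xi> * \<theta> \<xi>))"
  unfolding LP_block_def fmultiplier_def dinv_fourier_def dmult_def dfourier_def
  by (simp only: inv_fourier_fourier)

text \<open>The first factor bounds the supremum of a localised test function, with 1 added to keep
  it positive. The number \<open>100 * pi\<^sup>2\<close> is 25, the square of the bound 5 on
  \<open>fat\<close>, times the Plancherel factor \<open>(2 * pi)\<^sup>2\<close>.\<close>

definition bernstein_const :: real where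
  "bernstein_const = (l2 (fat 0) + 1) * (1 + 100 * pi\<^sup>2)"

lemma bernstein_const_pos: "bernstein_const > 0"
  unfolding bernstein_const_def by (intro mult_pos_pos add_nonneg_pos) auto

text \<open>Inserting \<open>fat j\<close> does not change the pairing but localises the test
  function, so that its supremum and its L^2 norm are both controlled by \<open>l2 \<theta>\<close>.
  The pointwise inequality between these two controls then accepts any L^p bound on the block with p
  between 1 and 2.\<close>

lemma block_bound_representative:
  assumes p: "1 \<le> p" "p \<le> 2" and \<theta>: "schwartz \<theta>"
    and f: "represents f (LP_block \<Phi> j T)" and A: "A > 0" "(\<integral>\<^sup>+x. ennreal (norm (f x) powr p) \<partial>lborel) \<le> ennreal (A powr p)"
  shows "norm (LP_block \<Phi> j T (fourier \<theta>)) \<le> bernstein_const * 2 powr ((2/p - 1) * of_int j) * A * l2 \<theta>"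
proof -
  define g where "g = fourier (\<lambda>\<xi>. fat j \<xi> * \<theta> \<xi>)"
  have s: "schwartz (\<lambda>\<xi>. fat j \<xi> * \<theta> \<xi>)" by (intro schwartz_mult schwartz_slow schwartz_fat \<theta>)
  have sg: "schwartz g" unfolding g_def by (rule schwartz_fourier[OF s])
  have [measurable]: "f \<in> borel_measurable borel" "g \<in> borel_measurable borel"
    using f schwartz_measurable[OF sg] by (auto simp: represents_def)
  have "LP_block \<Phi> j T (fourier \<theta>) = LP_block \<Phi> j T g"
    unfolding g_def LP_block_fourier[OF \<theta>] LP_block_fourier[OF s] by (simp add: mult.assoc[symmetric] m_fat)
  then have eq: "LP_block \<Phi> j T (fourier \<theta>) = (LINT x|lborel. f x * g x)" and ifg: "integrable lborel (\<lambda>x. f x * g x)"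
    using f sg by (auto simp: represents_def)
  have gsup: "norm (g x) \<le> 2 powi j * l2 (fat 0) * l2 \<theta>" for x
  proof -
    have "norm (g x) \<le> (LINT \<xi>|lborel. norm (fat j \<xi> * \<theta> \<xi>))"
      unfolding g_def by (intro norm_fourier_le schwartz_integrable s)
    also have "\<dots> \<le> l2 (fat j) * l2 \<theta>" by (intro schwartz_l2_mult schwartz_fat \<theta>)
    finally show ?thesis by (simp only: l2_fat[of j])
  qed
  have g2: "(LINT x|lborel. (norm (g x))\<^sup>2) \<le> 100 * pi\<^sup>2 * (l2 \<theta>)\<^sup>2"
  proof -
    have "(LINT x|lborel. (norm (g x))\<^sup>2) = (2 * pi)\<^sup>2 * (LINT x|lborel. (norm (fat j x * \<theta> x))\<^sup>2)"
      unfolding g_def by (rule plancherel[OF s])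
    also have "(LINT x|lborel. (norm (fat j x * \<theta> x))\<^sup>2) \<le> (LINT x|lborel. 25 * (norm (\<theta> x))\<^sup>2)"
    proof (rule integral_mono)
      show "(norm (fat j x * \<theta> x))\<^sup>2 \<le> 25 * (norm (\<theta> x))\<^sup>2" for x
      proof -
        have "(norm (fat j x))\<^sup>2 \<le> 25" using power_mono[OF norm_fat_le[of j x] norm_ge_zero, of 2] by simp
        from mult_right_mono[OF this zero_le_power2[of "norm (\<theta> x)"]] show ?thesis
          unfolding norm_mult power_mult_distrib .
      qed
    qed (use schwartz_square_integrable s \<theta> in auto)
    also have "(LINT x|lborel. 25 * (norm (\<theta> x))\<^sup>2) = 25 * (l2 \<theta>)\<^sup>2" by (simp add: l2_sq)
    finally show ?thesis by (simp add: power_mult_distrib)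
  qed
  show ?thesis
  proof (cases "l2 \<theta> = 0")
    case True
    then have "g x = 0" for x using gsup[of x] by simp
    then show ?thesis using eq True by simp
  next
    case False
    then have N: "l2 \<theta> > 0" using l2_nonneg[of \<theta>] by linarith
    define \<beta> where "\<beta> = l2 (fat 0) + 1"
    have \<beta>: "\<beta> \<ge> 1" by (simp add: \<beta>_def)
    have t: "2 powi j = (2::real) powr of_int j" by (simp add: powr_real_of_int')
    \<comment> \<open>A strictly positive majorant of the supremum of \<open>g\<close>, so that
      \<open>norm (g x) / S\<close> is at most 1 as the pointwise inequality requires.\<close>
    define S where "S = 2 powi j * \<beta> * l2 \<theta>"
    have S: "S > 0" using \<beta> N by (simp add: S_def)
    have gS: "norm (g x) \<le> S" for x
    proof -
      have "2 powi j * l2 (fat 0) * l2 \<theta> \<le> S"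
        unfolding S_def \<beta>_def using N by (intro mult_right_mono mult_left_mono) auto
      then show ?thesis using gsup[of x] by linarith
    qed
    \<comment> \<open>Chosen to balance the two terms: both the p-th power of f / X and the square
      of g / S then have integrals of order 2^(-2j).\<close>
    define X where "X = A * 2 powr (2 * of_int j / p)"
    have X: "X > 0" using A by (simp add: X_def)
    have Xp: "X powr p = A powr p * 2 powr (2 * of_int j)"
      unfolding X_def using p A by (simp add: powr_mult powr_powr)
    have ip: "integrable lborel (\<lambda>x. norm (f x) powr p)"
      unfolding integrable_iff_bounded using A(2) by (auto simp: le_less_trans[OF _ ennreal_less_top])
    have iple: "(LINT x|lborel. norm (f x) powr p) \<le> A powr p"
    proof -
      have "ennreal (LINT x|lborel. norm (f x) powr p) \<le> ennreal (A powr p)"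
        using A(2) nn_integral_eq_integral[OF ip] by simp
      then show ?thesis by (simp add: ennreal_le_iff)
    qed
    have ig2: "integrable lborel (\<lambda>x. (norm (g x))\<^sup>2)" by (rule schwartz_square_integrable[OF sg])
    have pw: "norm (f x * g x) \<le> X * S * (norm (f x) powr p / X powr p + (norm (g x))\<^sup>2 / S\<^sup>2)" for x
    proof -
      have "norm (f x) / X * (norm (g x) / S) \<le> (norm (f x) / X) powr p + (norm (g x) / S)\<^sup>2"
        using X S p gS[of x] by (intro mult_le_powr_plus_square) auto
      also have "\<dots> = norm (f x) powr p / X powr p + (norm (g x))\<^sup>2 / S\<^sup>2"
        using X by (simp add: powr_divide power_divide)
      finally have "X * S * (norm (f x) / X * (norm (g x) / S)) \<le> X * S * (norm (f x) powr p / X powr p + (norm (g x))\<^sup>2 / S\<^sup>2)"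
        using X S by (intro mult_left_mono) auto
      then show ?thesis using X S by (simp add: norm_mult)
    qed
    have "norm (LP_block \<Phi> j T (fourier \<theta>)) \<le> (LINT x|lborel. X * S * (norm (f x) powr p / X powr p + (norm (g x))\<^sup>2 / S\<^sup>2))"
      unfolding eq
      by (rule order_trans[OF integral_norm_bound integral_mono[OF integrable_norm[OF ifg] _ pw]])
         (intro integrable_mult_right Bochner_Integration.integrable_add integrable_divide ip ig2)
    also have "\<dots> = X * S * ((LINT x|lborel. norm (f x) powr p) / X powr p + (LINT x|lborel. (norm (g x))\<^sup>2) / S\<^sup>2)"
      using ip ig2 by simp
    also have "\<dots> \<le> X * S * (A powr p / X powr p + 100 * pi\<^sup>2 * (l2 \<theta>)\<^sup>2 / S\<^sup>2)"
      using X S iple g2 by (intro mult_left_mono add_mono divide_right_mono) auto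
    also have "A powr p / X powr p = 2 powr (- 2 * of_int j)"
      using A X unfolding Xp by (simp add: powr_minus divide_inverse)
    also have "100 * pi\<^sup>2 * (l2 \<theta>)\<^sup>2 / S\<^sup>2 \<le> 100 * pi\<^sup>2 * 2 powr (- 2 * of_int j)"
    proof -
      have "S\<^sup>2 = (2 powr (2 * of_int j)) * \<beta>\<^sup>2 * (l2 \<theta>)\<^sup>2"
        unfolding S_def t power_mult_distrib by (simp add: power2_eq_square powr_add[symmetric])
      then have "100 * pi\<^sup>2 * (l2 \<theta>)\<^sup>2 / S\<^sup>2 = 100 * pi\<^sup>2 * 2 powr (- 2 * of_int j) * (1 / \<beta>\<^sup>2)"
        using N \<beta> by (simp add: powr_minus field_simps)
      also have "\<dots> \<le> 100 * pi\<^sup>2 * 2 powr (- 2 * of_int j) * 1"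
        using \<beta> by (intro mult_left_mono) auto
      finally show ?thesis by simp
    qed
    finally have "norm (LP_block \<Phi> j T (fourier \<theta>)) \<le> X * S * (2 powr (- 2 * of_int j) + 100 * pi\<^sup>2 * 2 powr (- 2 * of_int j))"
      using X S by (simp add: mult_left_mono)
    also have "\<dots> = \<beta> * (1 + 100 * pi\<^sup>2) * (2 powr (2 * of_int j / p) * 2 powi j * 2 powr (- 2 * of_int j)) * A * l2 \<theta>"
      by (simp add: X_def S_def algebra_simps)
    also have "2 powr (2 * of_int j / p) * 2 powi j * 2 powr (- 2 * of_int j) = (2::real) powr ((2/p - 1) * of_int j)"
      unfolding t powr_add[symmetric] by (simp add: algebra_simps)
    finally show ?thesis by (simp add: bernstein_const_def \<beta>_def)
  qed
qed

end

section \<open>Fourier densities away from the origin\<close>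

text \<open>The L^p norm of a distribution is an infimum over representing functions, so estimates
  first come with an arbitrary positive slack. This removes it.\<close>

lemma le_mult_add_epsilon:
  fixes x k a :: real
  assumes "k \<ge> 0" "\<And>t. t > 0 \<Longrightarrow> x \<le> k * (a + t)"
  shows "x \<le> k * a"
proof (rule field_le_epsilon)
  fix e :: real assume e: "e > 0"
  have "x \<le> k * (a + e / (k + 1))" using assms e by (intro assms(2)) (simp add: divide_pos_pos)
  also have "\<dots> = k * a + e * (k / (k + 1))" by (simp add: distrib_left)
  also have "\<dots> \<le> k * a + e * 1"
    using assms(1) e by (intro add_left_mono mult_left_mono) (simp_all add: divide_le_eq)
  finally show "x \<le> k * a + e" by simp
qed

context lp begin

section \<open>From the Besov norm to summable L^2 bounds on blocks\<close>

lemma block_bound: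
  fixes T :: "distr^'m"
  assumes p: "1 \<le> p" "p \<le> 2" and \<theta>: "schwartz \<theta>"
    and fin: "dLp_norm p (\<chi> i. LP_block \<Phi> j (T $ i)) < \<infinity>"
  shows "norm (LP_block \<Phi> j (T $ i) (fourier \<theta>)) \<le>
    bernstein_const * (2 powr ((2/p - 1) * of_int j) * enn2real (dLp_norm p (\<chi> i. LP_block \<Phi> j (T $ i)))) * l2 \<theta>"
proof -
  define a where "a = enn2real (dLp_norm p (\<chi> i. LP_block \<Phi> j (T $ i)))"
  have a: "dLp_norm p (\<chi> i. LP_block \<Phi> j (T $ i)) = ennreal a" "a \<ge> 0"
    using fin by (simp_all add: a_def less_top[symmetric])
  have "norm (LP_block \<Phi> j (T $ i) (fourier \<theta>)) \<le> (bernstein_const * 2 powr ((2/p - 1) * of_int j) * l2 \<theta>) * (a + t)" if t: "t > 0" for t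
  proof -
    have "Inf {Lp_norm p f |f. \<forall>i. represents (\<lambda>x. f x $ i) ((\<chi> i. LP_block \<Phi> j (T $ i)) $ i)} < ennreal (a + t)"
      using a t unfolding dLp_norm_def by (simp add: ennreal_less_iff)
    then obtain f where f: "\<And>i. represents (\<lambda>x. f x $ i) (LP_block \<Phi> j (T $ i))" "Lp_norm p f < ennreal (a + t)"
      unfolding Inf_less_iff by auto
    define I where "I = (\<integral>\<^sup>+x. ennreal (norm (f x) powr p) \<partial>lborel)"
    have I: "I \<noteq> \<infinity>" using f(2) by (auto simp: Lp_norm_def I_def[symmetric] Let_def split: if_splits)
    have "ennreal (enn2real I powr (1/p)) < ennreal (a + t)"
      using f(2) I by (simp add: Lp_norm_def I_def[symmetric] Let_def)
    then have "enn2real I powr (1/p) < a + t" by (simp add: ennreal_less_iff)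
    then have "(enn2real I powr (1/p)) powr p \<le> (a + t) powr p"
      using p by (intro powr_mono2) auto
    then have Ip: "enn2real I \<le> (a + t) powr p" using p by (simp add: powr_powr)
    have "(\<integral>\<^sup>+x. ennreal (norm (f x $ i) powr p) \<partial>lborel) \<le> I"
      unfolding I_def using p by (intro nn_integral_mono ennreal_leI powr_mono2 Finite_Cartesian_Product.norm_nth_le) auto
    also have "I = ennreal (enn2real I)" using I by (simp add: less_top[symmetric])
    also have "\<dots> \<le> ennreal ((a + t) powr p)" by (rule ennreal_leI[OF Ip])
    finally have J: "(\<integral>\<^sup>+x. ennreal (norm (f x $ i) powr p) \<partial>lborel) \<le> ennreal ((a + t) powr p)" .
    have at: "a + t > 0" using a t by linarith
    have "norm (LP_block \<Phi> j (T $ i) (fourier \<theta>)) \<le> bernstein_const * 2 powr ((2/p - 1) * of_int j) * (a + t) * l2 \<theta>"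
      by (rule block_bound_representative[OF p \<theta> f(1) at J])
    also have "\<dots> = (bernstein_const * 2 powr ((2/p - 1) * of_int j) * l2 \<theta>) * (a + t)" by (simp only: mult_ac)
    finally show ?thesis .
  qed
  then have "norm (LP_block \<Phi> j (T $ i) (fourier \<theta>)) \<le> (bernstein_const * 2 powr ((2/p - 1) * of_int j) * l2 \<theta>) * a"
    by (rule le_mult_add_epsilon[rotated]) (assumption, intro mult_nonneg_nonneg less_imp_le[OF bernstein_const_pos] powr_ge_zero l2_nonneg)
  also have "\<dots> = bernstein_const * (2 powr ((2/p - 1) * of_int j) * a) * l2 \<theta>" by (simp only: mult_ac)
  finally show ?thesis by (simp only: a_def)
qed

text \<open>\<open>D j\<close> is the term of index \<open>j\<close> in the Besov norm. Its weight
  is the very factor lost in Bernstein's inequality, so the critical norm bounds the sum of the L^2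
  sizes of the blocks. Real numbers with bounded finite sums are easier to handle afterwards than an
  infinite sum in \<open>ennreal\<close>.\<close>

lemma besov_blocks:
  fixes T :: "distr^'m"
  assumes p: "1 \<le> p" "p \<le> 2" and b: "besov_norm \<Phi> (2/p - 1) p T < ennreal \<delta>"
  obtains D :: "int \<Rightarrow> real" where "\<And>j. D j \<ge> 0" "\<And>J. finite J \<Longrightarrow> (\<Sum>j\<in>J. D j) \<le> \<delta>"
    "\<And>j i \<theta>. schwartz \<theta> \<Longrightarrow> norm (LP_block \<Phi> j (T $ i) (fourier \<theta>)) \<le> bernstein_const * D j * l2 \<theta>"
proof -
  define a where "a j = ennreal (2 powr ((2/p - 1) * of_int j)) * dLp_norm p (\<chi> i. LP_block \<Phi> j (T $ i))" for j
  have bn: "besov_norm \<Phi> (2/p - 1) p T = infsum a UNIV"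
    unfolding besov_norm_def a_def ..
  have sum_le: "sum a J < ennreal \<delta>" if "finite J" for J
  proof -
    have "sum a J \<le> (SUP F\<in>{F. finite F \<and> F \<subseteq> UNIV}. sum a F)"
      using that by (intro SUP_upper) auto
    also have "\<dots> = infsum a UNIV"
      by (rule nonneg_infsum_complete[symmetric]) auto
    finally show ?thesis using b unfolding bn by (rule le_less_trans)
  qed
  have afin: "a j < \<infinity>" for j
    using sum_le[of "{j}"] by (simp add: less_top[symmetric]) (metis ennreal_less_top order.strict_trans top.not_eq_extremum)
  have dfin: "dLp_norm p (\<chi> i. LP_block \<Phi> j (T $ i)) < \<infinity>" for j
  proof (rule ccontr)
    assume "\<not> ?thesis"
    then have "dLp_norm p (\<chi> i. LP_block \<Phi> j (T $ i)) = \<infinity>" by (simp add: less_top[symmetric])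
    then have "a j = \<infinity>" by (simp add: a_def ennreal_mult_top)
    then show False using afin[of j] by simp
  qed
  show thesis
  proof (rule that[of "\<lambda>j. enn2real (a j)"])
    show "(\<Sum>j\<in>J. enn2real (a j)) \<le> \<delta>" if J: "finite J" for J
    proof -
      have "ennreal (\<Sum>j\<in>J. enn2real (a j)) = (\<Sum>j\<in>J. ennreal (enn2real (a j)))"
        by (rule sum_ennreal[symmetric]) simp
      also have "\<dots> = sum a J" using afin by (intro sum.cong) (simp_all add: less_top[symmetric])
      finally have "ennreal (\<Sum>j\<in>J. enn2real (a j)) < ennreal \<delta>" using sum_le[OF J] by simp
      then show ?thesis by (meson ennreal_leI leD less_le_not_le linear)
    qed
    show "norm (LP_block \<Phi> j (T $ i) (fourier \<theta>)) \<le> bernstein_const * enn2real (a j) * l2 \<theta>" if "schwartz \<theta>" for j i \<theta>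
      using block_bound[OF p that dfin] unfolding a_def by (simp add: enn2real_mult)
  qed simp
qed

text \<open>Summation exponent 1 enters as the plain triangle inequality over blocks; no
  orthogonality between them is used.\<close>

lemma besov_l2_bound:
  fixes T :: "distr^'m"
  assumes T: "T \<in> besov_space \<Phi> s p" and \<theta>: "schwartz \<theta>"
    and D: "\<And>J. finite J \<Longrightarrow> (\<Sum>j\<in>J. D j) \<le> \<delta>"
      "\<And>j. norm (LP_block \<Phi> j (T $ i) (fourier \<theta>)) \<le> bernstein_const * D j * l2 \<theta>"
  shows "norm ((T $ i) (fourier \<theta>)) \<le> bernstein_const * \<delta> * l2 \<theta>"
proof -
  have "((\<lambda>j. LP_block \<Phi> j (T $ i) (fourier \<theta>)) has_sum (T $ i) (fourier \<theta>)) UNIV"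
    using T schwartz_fourier[OF \<theta>] unfolding besov_space_def by blast
  then have lim: "(sum (\<lambda>j. LP_block \<Phi> j (T $ i) (fourier \<theta>)) \<longlongrightarrow> (T $ i) (fourier \<theta>)) (finite_subsets_at_top UNIV)"
    unfolding has_sum_def .
  show ?thesis
  proof (rule tendsto_upperbound[OF tendsto_norm[OF lim] eventually_finite_subsets_at_top_weakI])
    fix J :: "int set" assume J: "finite J"
    have "norm (\<Sum>j\<in>J. LP_block \<Phi> j (T $ i) (fourier \<theta>)) \<le> (\<Sum>j\<in>J. bernstein_const * D j * l2 \<theta>)"
      by (rule order_trans[OF norm_sum sum_mono]) (rule D(2))
    also have "\<dots> = bernstein_const * (\<Sum>j\<in>J. D j) * l2 \<theta>"
      by (simp add: sum_distrib_left sum_distrib_right)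
    also have "\<dots> \<le> bernstein_const * \<delta> * l2 \<theta>"
      using bernstein_const_pos D(1)[OF J] by (intro mult_right_mono mult_left_mono) auto
    finally show "norm (\<Sum>j\<in>J. LP_block \<Phi> j (T $ i) (fourier \<theta>)) \<le> bernstein_const * \<delta> * l2 \<theta>" .
  qed simp
qed

text \<open>Test functions for which the singularity at the origin is invisible and all sums over
  blocks are finite. The finite set of indices is recorded directly, in place of a compact support,
  since it is what survives multiplication and what the sums need.\<close>

definition annular :: "(real^2 \<Rightarrow> complex) \<Rightarrow> bool" where
  "annular \<psi> \<longleftrightarrow> schwartz \<psi> \<and> (\<exists>r>0. \<forall>\<xi>. norm \<xi> < r \<longrightarrow> \<psi> \<xi> = 0) \<and>
     (\<exists>J. finite J \<and> (\<forall>l \<xi>. \<psi> \<xi> \<noteq> 0 \<longrightarrow> m l \<xi> \<noteq> 0 \<longrightarrow> l \<in> J))"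

lemma annular_schwartz: "annular \<psi> \<Longrightarrow> schwartz \<psi>"
  by (simp add: annular_def)

lemma annular_m: 
  assumes "schwartz \<theta>" shows "annular (\<lambda>\<xi>. m j \<xi> * \<theta> \<xi>)"
  unfolding annular_def
proof (intro conjI)
  show "schwartz (\<lambda>\<xi>. m j \<xi> * \<theta> \<xi>)" by (intro schwartz_mult schwartz_slow schwartz_m assms)
  show "\<exists>r>0. \<forall>\<xi>. norm \<xi> < r \<longrightarrow> m j \<xi> * \<theta> \<xi> = 0"
    using m_near_zero[of _ j] by (intro exI[of _ "2 powi (j - 1)"]) simp
  show "\<exists>J. finite J \<and> (\<forall>l \<xi>. m j \<xi> * \<theta> \<xi> \<noteq> 0 \<longrightarrow> m l \<xi> \<noteq> 0 \<longrightarrow> l \<in> J)"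
  proof (intro exI[of _ "{j-2..j+2}"] conjI allI impI)
    fix l \<xi> assume "m j \<xi> * \<theta> \<xi> \<noteq> 0" "m l \<xi> \<noteq> 0"
    then have "m j \<xi> \<noteq> 0" by auto
    then show "l \<in> {j-2..j+2}" using \<open>m l \<xi> \<noteq> 0\<close> by (rule m_overlap)
  qed simp
qed

lemma annular_slow_mult:
  assumes "annular \<psi>" "slow q" shows "annular (\<lambda>\<xi>. q \<xi> * \<psi> \<xi>)"
proof -
  from assms(1) obtain r J where r: "r > 0" "\<And>\<xi>. norm \<xi> < r \<Longrightarrow> \<psi> \<xi> = 0"
    and J: "finite J" "\<And>l \<xi>. \<psi> \<xi> \<noteq> 0 \<Longrightarrow> m l \<xi> \<noteq> 0 \<Longrightarrow> l \<in> J"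
    unfolding annular_def by blast
  have "schwartz (\<lambda>\<xi>. q \<xi> * \<psi> \<xi>)" using assms by (intro schwartz_mult) (auto simp: annular_def)
  moreover have "\<forall>\<xi>. norm \<xi> < r \<longrightarrow> q \<xi> * \<psi> \<xi> = 0" using r by simp
  moreover have "\<forall>l \<xi>. q \<xi> * \<psi> \<xi> \<noteq> 0 \<longrightarrow> m l \<xi> \<noteq> 0 \<longrightarrow> l \<in> J"
    using J(2) by (metis mult_not_zero)
  ultimately show ?thesis unfolding annular_def using r(1) J(1) by blast
qed

lemma annular_divide:
  assumes "annular \<psi>" shows "annular (\<lambda>\<xi>. \<psi> \<xi> / of_real ((norm \<xi>)\<^sup>2))"
proof -
  from assms obtain r J where r: "r > 0" "\<And>\<xi>. norm \<xi> < r \<Longrightarrow> \<psi> \<xi> = 0"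
    and J: "finite J" "\<And>l \<xi>. \<psi> \<xi> \<noteq> 0 \<Longrightarrow> m l \<xi> \<noteq> 0 \<Longrightarrow> l \<in> J"
    unfolding annular_def by blast
  have "schwartz (\<lambda>\<xi>. \<psi> \<xi> / of_real ((norm \<xi>)\<^sup>2))"
    by (rule schwartz_divide_norm_sq[OF annular_schwartz[OF assms] r])
  moreover have "\<forall>\<xi>. norm \<xi> < r \<longrightarrow> \<psi> \<xi> / of_real ((norm \<xi>)\<^sup>2) = 0" using r by simp
  moreover have "\<forall>l \<xi>. \<psi> \<xi> / of_real ((norm \<xi>)\<^sup>2) \<noteq> 0 \<longrightarrow> m l \<xi> \<noteq> 0 \<longrightarrow> l \<in> J"
    using J(2) by (metis div_0)
  ultimately show ?thesis unfolding annular_def using r(1) J(1) by blast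
qed

text \<open>\<open>adens T g\<close> says that the Fourier transform of \<open>T\<close> coincides with the function \<open>g\<close> away from
  the origin.\<close>

definition adens :: "distr \<Rightarrow> (real^2 \<Rightarrow> complex) \<Rightarrow> bool" where
  "adens T g \<longleftrightarrow> (\<forall>\<psi>. annular \<psi> \<longrightarrow>
     integrable lborel (\<lambda>\<xi>. g \<xi> * \<psi> \<xi>) \<and> T (fourier \<psi>) = (LINT \<xi>|lborel. g \<xi> * \<psi> \<xi>))"

lemma adens_represents:
  assumes f: "integrable lborel f" and T: "represents f T"
  shows "adens T (fourier f)"
  unfolding adens_def
proof (intro allI impI conjI)
  fix \<psi> assume "annular \<psi>"
  then have s: "schwartz \<psi>" by (rule annular_schwartz)
  show "integrable lborel (\<lambda>\<xi>. fourier f \<xi> * \<psi> \<xi>)"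
  proof (rule Bochner_Integration.integrable_bound[OF integrable_mult_right[OF schwartz_integrable[OF s], of "of_real (LINT x|lborel. norm (f x))"]])
    show "(\<lambda>\<xi>. fourier f \<xi> * \<psi> \<xi>) \<in> borel_measurable lborel"
      using fourier_measurable[OF f] schwartz_measurable[OF s] by measurable
    have "0 \<le> (LINT x|lborel. norm (f x))" by (intro integral_nonneg_AE AE_I2) simp
    then show "AE x in lborel. norm (fourier f x * \<psi> x) \<le> norm (of_real (LINT x|lborel. norm (f x)) * \<psi> x)"
      unfolding norm_mult using norm_fourier_le[OF f] by (intro AE_I2 mult_right_mono) simp_all
  qed
  show "T (fourier \<psi>) = (LINT \<xi>|lborel. fourier f \<xi> * \<psi> \<xi>)"
    unfolding fourier_multiplication[OF f schwartz_integrable[OF s]]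
    using T schwartz_fourier[OF s] by (simp add: represents_def)
qed

text \<open>Only the finitely many blocks in \<open>J\<close> meet the test function, and on its
  support their symbols add up to 1. The infinite sum in the definition therefore collapses to the
  expected division by |\<xi>|^2.\<close>

lemma adens_inv_neg_laplacian:
  assumes T: "adens T g"
  shows "adens (inv_neg_laplacian \<Phi> T) (\<lambda>\<xi>. g \<xi> / of_real ((norm \<xi>)\<^sup>2))"
  unfolding adens_def
proof (intro allI impI)
  fix \<psi> assume \<psi>: "annular \<psi>"
  then obtain r J where r: "r > 0" "\<And>\<xi>. norm \<xi> < r \<Longrightarrow> \<psi> \<xi> = 0"
    and J: "finite J" "\<And>l \<xi>. \<psi> \<xi> \<noteq> 0 \<Longrightarrow> m l \<xi> \<noteq> 0 \<Longrightarrow> l \<in> J"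
    unfolding annular_def by blast
  let ?n = "\<lambda>\<xi>::real^2. complex_of_real ((norm \<xi>)\<^sup>2)"
  let ?\<psi> = "\<lambda>l \<xi>. m l \<xi> * (\<psi> \<xi> / ?n \<xi>)"
  have a: "annular (?\<psi> l)" for l
    by (intro annular_slow_mult annular_divide \<psi> schwartz_slow schwartz_m)
  have i: "integrable lborel (\<lambda>\<xi>. g \<xi> * ?\<psi> l \<xi>)" and Tl: "T (fourier (?\<psi> l)) = (LINT \<xi>|lborel. g \<xi> * ?\<psi> l \<xi>)" for l
    using T a[of l] unfolding adens_def by blast+
  have F: "fmultiplier (\<lambda>\<xi>. m l \<xi> / ?n \<xi>) T (fourier \<psi>) = T (fourier (?\<psi> l))" for l
  proof -
    have "(\<lambda>\<xi>. m l \<xi> / ?n \<xi> * \<psi> \<xi>) = ?\<psi> l" by (simp add: fun_eq_iff)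
    then show ?thesis
      unfolding fmultiplier_def dinv_fourier_def dmult_def dfourier_def
      by (simp only: inv_fourier_fourier[OF annular_schwartz[OF \<psi>]])
  qed
  have zero: "?\<psi> l = (\<lambda>_. 0)" if "l \<notin> J" for l
    using J(2) that by (fastforce simp: fun_eq_iff)
  have sum1: "(\<Sum>l\<in>J. g \<xi> * ?\<psi> l \<xi>) = g \<xi> / ?n \<xi> * \<psi> \<xi>" for \<xi>
  proof (cases "\<psi> \<xi> = 0")
    case False
    then have "\<xi> \<noteq> 0" using r by auto
    then have "(\<Sum>l\<in>J. m l \<xi>) = 1" using J False by (intro sum_m_eq_1) auto
    moreover have "(\<Sum>l\<in>J. g \<xi> * ?\<psi> l \<xi>) = (\<Sum>l\<in>J. m l \<xi>) * (g \<xi> / ?n \<xi> * \<psi> \<xi>)"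
      unfolding sum_distrib_right by (intro sum.cong refl) (simp add: mult_ac)
    ultimately show ?thesis by simp
  qed simp
  have "inv_neg_laplacian \<Phi> T (fourier \<psi>) = (\<Sum>\<^sub>\<infinity>l\<in>UNIV. T (fourier (?\<psi> l)))"
    unfolding inv_neg_laplacian_def F ..
  also have "\<dots> = (\<Sum>\<^sub>\<infinity>l\<in>J. T (fourier (?\<psi> l)))"
  proof (rule infsum_cong_neutral)
    \<comment> \<open>Linearity of \<open>T\<close> is not among the hypotheses, so its value at the
      zero function is read off from the integral formula.\<close>
    fix l assume "l \<in> UNIV - J"
    then have z: "?\<psi> l = (\<lambda>_. 0)" using zero by auto
    show "T (fourier (?\<psi> l)) = 0"
      unfolding Tl by (simp only: fun_cong[OF z] mult_zero_right) simp
  qed auto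
  also have "\<dots> = (\<Sum>l\<in>J. (LINT \<xi>|lborel. g \<xi> * ?\<psi> l \<xi>))"
    unfolding Tl infsum_finite[OF J(1)] ..
  also have "\<dots> = (LINT \<xi>|lborel. (\<Sum>l\<in>J. g \<xi> * ?\<psi> l \<xi>))"
    using i by (intro Bochner_Integration.integral_sum[symmetric])
  finally have "inv_neg_laplacian \<Phi> T (fourier \<psi>) = (LINT \<xi>|lborel. g \<xi> / ?n \<xi> * \<psi> \<xi>)"
    unfolding sum1 .
  moreover have "integrable lborel (\<lambda>\<xi>. \<Sum>l\<in>J. g \<xi> * ?\<psi> l \<xi>)"
    using i by (intro Bochner_Integration.integrable_sum)
  ultimately show "integrable lborel (\<lambda>\<xi>. g \<xi> / ?n \<xi> * \<psi> \<xi>) \<and>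
      inv_neg_laplacian \<Phi> T (fourier \<psi>) = (LINT \<xi>|lborel. g \<xi> / ?n \<xi> * \<psi> \<xi>)"
    unfolding sum1 by blast
qed

lemma adens_dpartial:
  assumes T: "adens T g"
  shows "adens (dpartial k T) (\<lambda>\<xi>. \<i> * of_real (\<xi> $ k) * g \<xi>)"
  unfolding adens_def
proof (intro allI impI)
  fix \<psi> assume \<psi>: "annular \<psi>"
  let ?\<psi> = "\<lambda>\<xi>. - \<i> * of_real (\<xi> $ k) * \<psi> \<xi>"
  have "annular ?\<psi>"
    by (intro annular_slow_mult[of \<psi> "\<lambda>\<xi>. - \<i> * of_real (\<xi> $ k)"] \<psi> slow_mult) auto
  then have i: "integrable lborel (\<lambda>\<xi>. g \<xi> * ?\<psi> \<xi>)" and T': "T (fourier ?\<psi>) = (LINT \<xi>|lborel. g \<xi> * ?\<psi> \<xi>)"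
    using T unfolding adens_def by blast+
  have e: "(\<lambda>\<xi>. \<i> * of_real (\<xi> $ k) * g \<xi> * \<psi> \<xi>) = (\<lambda>\<xi>. - (g \<xi> * ?\<psi> \<xi>))"
    by (simp add: fun_eq_iff mult_ac)
  show "integrable lborel (\<lambda>\<xi>. \<i> * of_real (\<xi> $ k) * g \<xi> * \<psi> \<xi>) \<and>
     dpartial k T (fourier \<psi>) = (LINT \<xi>|lborel. \<i> * of_real (\<xi> $ k) * g \<xi> * \<psi> \<xi>)"
    unfolding e dpartial_def partial_fourier[OF annular_schwartz[OF \<psi>]] T' using i by simp
qed

lemma adens_add:
  assumes "adens S f" "adens T g" shows "adens (\<lambda>\<phi>. S \<phi> + T \<phi>) (\<lambda>\<xi>. f \<xi> + g \<xi>)"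
  using assms unfolding adens_def by (simp add: distrib_right)

lemma adens_sum:
  assumes "\<And>k. k \<in> K \<Longrightarrow> adens (T k) (g k)"
  shows "adens (\<lambda>\<phi>. \<Sum>k\<in>K. T k \<phi>) (\<lambda>\<xi>. \<Sum>k\<in>K. g k \<xi>)"
  using assms unfolding adens_def by (simp add: sum_distrib_right)

lemma adens_ddiv:
  assumes "\<And>k. adens (G $ k) (g k)"
  shows "adens (ddiv G) (\<lambda>\<xi>. \<Sum>k\<in>UNIV. \<i> * of_real (\<xi> $ k) * g k \<xi>)"
  unfolding ddiv_def by (intro adens_sum adens_dpartial assms)

lemma adens_helmholtz:
  assumes "\<And>k. adens (F $ k) (g k)"
  shows "adens (helmholtz \<Phi> F $ i) (\<lambda>\<xi>. g i \<xi> + \<i> * of_real (\<xi> $ i) *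
    (\<Sum>k\<in>UNIV. \<i> * of_real (\<xi> $ k) * (g k \<xi> / of_real ((norm \<xi>)\<^sup>2))))"
proof -
  have "adens (\<lambda>\<phi>. (F $ i) \<phi> + dpartial i (ddiv (\<chi> k. inv_neg_laplacian \<Phi> (F $ k))) \<phi>)
     (\<lambda>\<xi>. g i \<xi> + \<i> * of_real (\<xi> $ i) * (\<Sum>k\<in>UNIV. \<i> * of_real (\<xi> $ k) * (g k \<xi> / of_real ((norm \<xi>)\<^sup>2))))"
    by (intro adens_add adens_dpartial adens_ddiv assms) (simp only: vec_lambda_beta adens_inv_neg_laplacian assms)
  then show ?thesis unfolding helmholtz_def by simp
qed

end

section \<open>The external force\<close>

lemma continuous_AE_zero:
  fixes g :: "real^2 \<Rightarrow> 'a::real_normed_vector"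
  assumes c: "continuous_on UNIV g" and z: "AE x in lborel. g x = 0"
  shows "g x = 0"
proof (rule ccontr)
  assume "g x \<noteq> 0"
  let ?S = "{x. g x \<noteq> 0}"
  have "?S = g -` (- {0})" by auto
  then have op: "open ?S" using c by (metis open_vimage open_Compl closed_singleton)
  have "?S \<in> null_sets lborel"
    using z op AE_iff_null_sets[of ?S lborel] by simp
  then have "negligible ?S"
    using op by (simp add: negligible_iff_null_sets null_sets_completionI)
  then have "?S = {}" using open_not_negligible op by blast
  then show False using \<open>g x \<noteq> 0\<close> by blast
qed

text \<open>Along a ray the dyadic dilates of \<open>m 0\<close> sum to 1, so one of them is not
  zero. This provides the points at which identities multiplied by \<open>m 0\<close> are
  evaluated.\<close>

lemma (in lp) m0_nonzero_in_direction:
  assumes "\<omega> \<noteq> 0" obtains t where "t > 0" "m 0 (t *\<^sub>R \<omega>) \<noteq> 0"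
proof -
  have "\<exists>j. m j \<omega> \<noteq> 0"
  proof (rule ccontr)
    assume "\<not> ?thesis"
    then have "(\<lambda>j. m j \<omega>) = (\<lambda>_. 0)" by auto
    then have "((\<lambda>_::int. 0::complex) has_sum 1) UNIV" using m_has_sum[OF assms] by simp
    moreover have "((\<lambda>_::int. 0::complex) has_sum 0) UNIV" by simp
    ultimately show False using has_sum_unique zero_neq_one by metis
  qed
  then obtain j where "m j \<omega> \<noteq> 0" by blast
  then have "m 0 ((2 powi (-j)) *\<^sub>R \<omega>) \<noteq> 0" using m_scale[of j \<omega>] by simp
  then show thesis by (rule that[rotated]) simp
qed

text \<open>Here \<open>f\<close> is the Fourier transform of the velocity field g of the overview.
  Being real and even makes g real, \<open>f_div\<close> makes it divergence free, the annulus
  leaves at most five blocks, and \<open>f_aniso\<close> is its anisotropy seen on the frequency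
  side.\<close>

locale seed = lp +
  fixes f :: "2 \<Rightarrow> real^2 \<Rightarrow> complex"
  assumes f_schwartz: "schwartz (f i)"
    and f_real: "cnj (f i \<xi>) = f i \<xi>"
    and f_even: "f i (- \<xi>) = f i \<xi>"
    and f_div: "of_real (\<xi> $ 1) * f 1 \<xi> + of_real (\<xi> $ 2) * f 2 \<xi> = 0"
    and f_support: "f i \<xi> \<noteq> 0 \<Longrightarrow> 1/2 \<le> norm \<xi> \<and> norm \<xi> \<le> 2"
    and f_aniso: "(LINT \<xi>|lborel. f 1 \<xi> * f 1 \<xi>) \<noteq> (LINT \<xi>|lborel. f 2 \<xi> * f 2 \<xi>)"

text \<open>The candidates are \<open>\<xi>\<^sup>\<bottom> \<xi>\<^sub>a h(\<xi>)\<close> with \<open>a = 1, 2\<close> and \<open>h\<close> even. Their anisotropies differ by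
  \<open>\<integral> (\<xi>\<^sub>2\<^sup>2 - \<xi>\<^sub>1\<^sup>2)\<^sup>2 h\<^sup>2 > 0\<close>, so one of them is not zero.\<close>

lemma (in lp) seed_exists: "\<exists>f. seed \<Phi> f"
proof -
  \<comment> \<open>\<open>m 0\<close> may fail to be even; symmetrising it makes the candidates
    even and hence the force real.\<close>
  define h where "h \<xi> = m 0 \<xi> + m 0 (- \<xi>)" for \<xi>
  define f where "f a i \<xi> = (if i = 1 then - of_real (\<xi> $ 2) else of_real (\<xi> $ 1)) * of_real (\<xi> $ a) * h \<xi>" for a i :: 2 and \<xi>
  have sh: "schwartz h"
    unfolding h_def[abs_def] by (intro schwartz_add schwartz_m schwartz_uminus_arg)
  have cm: "cnj (m 0 \<xi>) = m 0 \<xi>" for \<xi> by (metis m_real(1) complex_cnj_complex_of_real)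
  have sf: "schwartz (f a i)" for a i
  proof (cases "i = 1")
    case True
    have "schwartz (\<lambda>\<xi>. (-1) * of_real (\<xi> $ 2) * of_real (\<xi> $ a) * h \<xi>)"
      by (intro schwartz_mult[OF _ sh] slow_mult slow_coord slow_const)
    then show ?thesis using True by (simp add: f_def[abs_def])
  next
    case False
    have "schwartz (\<lambda>\<xi>. of_real (\<xi> $ 1) * of_real (\<xi> $ a) * h \<xi>)"
      by (intro schwartz_mult[OF _ sh] slow_mult slow_coord)
    then show ?thesis using False by (simp add: f_def[abs_def])
  qed
  have "\<exists>a. (LINT \<xi>|lborel. f a 1 \<xi> * f a 1 \<xi>) \<noteq> (LINT \<xi>|lborel. f a 2 \<xi> * f a 2 \<xi>)"
  proof (rule ccontr)
    assume "\<not> ?thesis"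
    then have eq: "(LINT \<xi>|lborel. f a 1 \<xi> * f a 1 \<xi>) = (LINT \<xi>|lborel. f a 2 \<xi> * f a 2 \<xi>)" for a by blast
    have i: "integrable lborel (\<lambda>\<xi>. f a i \<xi> * f a i \<xi>)" for a i
      by (intro schwartz_integrable schwartz_mult schwartz_slow sf)
    define g where "g \<xi> = ((\<xi> $ 2)\<^sup>2 - (\<xi> $ 1)\<^sup>2)\<^sup>2 * (Re (h \<xi>))\<^sup>2" for \<xi> :: "real^2"
    have hr: "h \<xi> = of_real (Re (h \<xi>))" for \<xi>
      unfolding h_def using m_real(1)[of 0 \<xi>] m_real(1)[of 0 "- \<xi>"] by (simp add: complex_eq_iff)
    have G: "of_real (g \<xi>) = (f 2 1 \<xi> * f 2 1 \<xi> - f 2 2 \<xi> * f 2 2 \<xi>) - (f 1 1 \<xi> * f 1 1 \<xi> - f 1 2 \<xi> * f 1 2 \<xi>)" for \<xi>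
    proof -
      have h2: "(h \<xi>)\<^sup>2 = (of_real (Re (h \<xi>)))\<^sup>2" using hr[of \<xi>] by (rule arg_cong)
      have "of_real (g \<xi>) = (of_real (\<xi> $ 2) ^ 2 - of_real (\<xi> $ 1) ^ 2)\<^sup>2 * (h \<xi>)\<^sup>2"
        unfolding h2 by (simp add: g_def)
      also have "\<dots> = (f 2 1 \<xi> * f 2 1 \<xi> - f 2 2 \<xi> * f 2 2 \<xi>) - (f 1 1 \<xi> * f 1 1 \<xi> - f 1 2 \<xi> * f 1 2 \<xi>)"
        unfolding f_def by (simp add: power2_eq_square algebra_simps)
      finally show ?thesis .
    qed
    have "(LINT \<xi>|lborel. complex_of_real (g \<xi>)) = 0"
      unfolding G using i eq by simp
    then have g0: "(LINT \<xi>|lborel. g \<xi>) = 0" by simp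
    have "integrable lborel (\<lambda>\<xi>. Re (complex_of_real (g \<xi>)))"
      unfolding G using i by (intro integrable_Re Bochner_Integration.integrable_diff)
    then have ig: "integrable lborel g" by simp
    have "AE \<xi> in lborel. g \<xi> = 0"
      using integral_nonneg_eq_0_iff_AE[OF ig] g0 by (simp add: g_def)
    moreover have "continuous_on UNIV g"
      unfolding g_def[abs_def] by (intro continuous_intros schwartz_continuous sh)
    ultimately have gz: "g \<xi> = 0" for \<xi> by (intro continuous_AE_zero)
    \<comment> \<open>On the first axis the polynomial factor is \<xi>_1^4, so a point of this axis
      where \<open>m 0\<close> is positive contradicts g = 0.\<close>
    obtain t where t: "t > 0" "m 0 (t *\<^sub>R axis 1 1) \<noteq> 0"
      using m0_nonzero_in_direction[of "axis 1 1"] by (auto simp: axis_eq_0_iff)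
    have "Re (m 0 (t *\<^sub>R axis 1 1)) \<noteq> 0" using t(2) m_real(1)[of 0 "t *\<^sub>R axis 1 1"] by auto
    then have "Re (h (t *\<^sub>R axis 1 1)) > 0"
      unfolding h_def using m_real(2)[of 0 "t *\<^sub>R axis 1 1"] m_real(2)[of 0 "- (t *\<^sub>R axis 1 1)"] by simp
    then have "g (t *\<^sub>R axis 1 1) \<noteq> 0" using t(1) by (simp add: g_def axis_def)
    then show False using gz by blast
  qed
  then obtain a where a: "(LINT \<xi>|lborel. f a 1 \<xi> * f a 1 \<xi>) \<noteq> (LINT \<xi>|lborel. f a 2 \<xi> * f a 2 \<xi>)" by blast
  have "seed \<Phi> (f a)"
  proof
    show "schwartz (f a i)" for i by (rule sf)
    show "cnj (f a i \<xi>) = f a i \<xi>" for i \<xi> by (simp add: f_def h_def cm)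
    show "f a i (- \<xi>) = f a i \<xi>" for i \<xi> by (simp add: f_def h_def add.commute)
    show "of_real (\<xi> $ 1) * f a 1 \<xi> + of_real (\<xi> $ 2) * f a 2 \<xi> = 0" for \<xi> by (simp add: f_def)
    show "(LINT \<xi>|lborel. f a 1 \<xi> * f a 1 \<xi>) \<noteq> (LINT \<xi>|lborel. f a 2 \<xi> * f a 2 \<xi>)" by (rule a)
    show "1/2 \<le> norm \<xi> \<and> norm \<xi> \<le> 2" if "f a i \<xi> \<noteq> 0" for i \<xi>
    proof -
      have "h \<xi> \<noteq> 0" using that by (auto simp: f_def)
      then have "m 0 \<xi> \<noteq> 0 \<or> m 0 (- \<xi>) \<noteq> 0" by (auto simp: h_def)
      then show ?thesis using m_support[of 0 \<xi>] m_support[of 0 "- \<xi>"] by (auto simp: power_int_minus)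
    qed
  qed
  then show ?thesis by blast
qed

section \<open>Schwartz functions as distributions\<close>

definition fun_distr :: "(real^2 \<Rightarrow> complex) \<Rightarrow> distr" where
  "fun_distr g = (\<lambda>\<phi>. LINT x|lborel. g x * \<phi> x)"

lemma represents_fun_distr:
  assumes "schwartz g" shows "represents g (fun_distr g)"
  unfolding represents_def fun_distr_def
  using assms by (auto intro!: schwartz_measurable schwartz_integrable schwartz_mult schwartz_slow)

lemma tempered_fun_distr:
  assumes g: "schwartz g" shows "tempered (fun_distr g)"
  unfolding tempered_def
proof (intro conjI allI impI exI[of _ "0::nat"] exI[of _ "LINT x|lborel. norm (g x)"])
  have i: "integrable lborel (\<lambda>x. g x * \<phi> x)" if "schwartz \<phi>" for \<phi>
    by (intro schwartz_integrable schwartz_mult schwartz_slow g that)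
  show "fun_distr g (\<lambda>x. a * \<phi> x + b * \<psi> x) = a * fun_distr g \<phi> + b * fun_distr g \<psi>"
    if "schwartz \<phi>" "schwartz \<psi>" for \<phi> \<psi> a b
  proof -
    have "(\<lambda>x. g x * (a * \<phi> x + b * \<psi> x)) = (\<lambda>x. a * (g x * \<phi> x) + b * (g x * \<psi> x))"
      by (simp add: algebra_simps)
    then show ?thesis
      unfolding fun_distr_def using i[OF that(1)] i[OF that(2)] by simp
  qed
  show "norm (fun_distr g \<phi>) \<le> (LINT x|lborel. norm (g x)) * schwartz_seminorm 0 \<phi>" if \<phi>: "schwartz \<phi>" for \<phi>
  proof -
    have "{is :: 2 list. length is \<le> 0} = {[]}" by auto
    then have sn: "schwartz_seminorm 0 \<phi> = (SUP x. norm (\<phi> x))"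
      by (simp add: schwartz_seminorm_def)
    obtain C where "\<And>x. (1 + norm x) ^ 0 * norm (\<phi> x) \<le> C" using schwartz_rapid[OF \<phi>] by (rule rapidE) blast
    then have "bdd_above (range (\<lambda>x. norm (\<phi> x)))" by (auto simp: bdd_above_def)
    then have le: "norm (\<phi> x) \<le> schwartz_seminorm 0 \<phi>" for x
      unfolding sn by (intro cSUP_upper) auto
    have "norm (fun_distr g \<phi>) \<le> (LINT x|lborel. norm (g x) * schwartz_seminorm 0 \<phi>)"
      unfolding fun_distr_def
    proof (rule order_trans[OF integral_norm_bound integral_mono])
      show "norm (g x * \<phi> x) \<le> norm (g x) * schwartz_seminorm 0 \<phi>" for x
        unfolding norm_mult by (intro mult_left_mono le norm_ge_zero)
    qed (intro integrable_norm i \<phi> integrable_mult_left schwartz_integrable g)+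
    then show ?thesis by simp
  qed
qed

lemma real_fun_distr:
  assumes "\<And>x. cnj (g x) = g x" shows "real_distr (fun_distr g)"
  unfolding real_distr_def fun_distr_def
proof (intro allI impI)
  fix \<phi>
  show "(LINT x|lborel. g x * cnj (\<phi> x)) = cnj (LINT x|lborel. g x * \<phi> x)"
    using Bochner_Integration.integral_cnj[of lborel "\<lambda>x. g x * \<phi> x"] by (simp add: assms)
qed

lemma integral_inv_fourier:
  assumes a: "schwartz a" and \<phi>: "schwartz \<phi>"
  shows "(LINT x|lborel. inv_fourier a x * \<phi> x) = (LINT \<xi>|lborel. a \<xi> * inv_fourier \<phi> \<xi>)"
proof -
  have "(LINT \<xi>|lborel. fourier (inv_fourier a) \<xi> * inv_fourier \<phi> \<xi>) = (LINT x|lborel. inv_fourier a x * fourier (inv_fourier \<phi>) x)"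
    by (intro fourier_multiplication schwartz_integrable schwartz_inv_fourier a \<phi>)
  then show ?thesis by (simp only: fourier_inv_fourier a \<phi>)
qed

lemma inv_fourier_real:
  assumes "\<And>\<xi>. cnj (a \<xi>) = a \<xi>" "\<And>\<xi>. a (- \<xi>) = a \<xi>" "schwartz a"
  shows "cnj (inv_fourier a x) = inv_fourier a x"
proof -
  have m: "(\<lambda>y. wave (- x) y * a y) \<in> borel_measurable borel"
    using schwartz_measurable[OF assms(3)] by measurable
  have "cnj (fourier a (- x)) = fourier a x"
    unfolding cnj_fourier by (simp add: assms)
  also have "\<dots> = fourier a (- x)"
    using lborel_integral_uminus[OF m] assms(2) by (simp add: fourier_def)
  finally show ?thesis unfolding inv_fourier_altdef by simp
qed

lemma Lp_norm_scale:
  fixes g :: "real^2 \<Rightarrow> complex^'m"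
  assumes c: "c > 0" and p: "p \<ge> 1" and [measurable]: "(\<lambda>x. norm (g x)) \<in> borel_measurable borel"
    and G: "\<And>x. norm (G x) = c * norm (g x)"
  shows "Lp_norm p G = ennreal c * Lp_norm p g"
proof -
  have "(\<integral>\<^sup>+x. ennreal (norm (G x) powr p) \<partial>lborel) = (\<integral>\<^sup>+x. ennreal (c powr p) * ennreal (norm (g x) powr p) \<partial>lborel)"
    unfolding G using c by (intro nn_integral_cong) (simp add: powr_mult ennreal_mult)
  also have "\<dots> = ennreal (c powr p) * (\<integral>\<^sup>+x. ennreal (norm (g x) powr p) \<partial>lborel)"
    by (rule nn_integral_cmult) measurable
  finally have I: "(\<integral>\<^sup>+x. ennreal (norm (G x) powr p) \<partial>lborel) = ennreal (c powr p) * (\<integral>\<^sup>+x. ennreal (norm (g x) powr p) \<partial>lborel)" .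
  define J where "J = (\<integral>\<^sup>+x. ennreal (norm (g x) powr p) \<partial>lborel)"
  have cp: "c powr p > 0" using c by simp
  show ?thesis
  proof (cases "J = \<infinity>")
    case True
    then show ?thesis
      unfolding Lp_norm_def I J_def[symmetric] Let_def using cp c by (simp add: ennreal_mult_top)
  next
    case False
    then have "ennreal (c powr p) * J \<noteq> \<infinity>" by (simp add: ennreal_mult_eq_top_iff)
    moreover have "(c powr p * enn2real J) powr (1/p) = c * enn2real J powr (1/p)"
      using c p by (simp add: powr_mult powr_powr)
    ultimately show ?thesis
      unfolding Lp_norm_def I J_def[symmetric] Let_def using False c
      by (simp add: enn2real_mult ennreal_mult)
  qed
qed

lemma Lp_norm_schwartz_finite:
  fixes g :: "real^2 \<Rightarrow> complex^2"
  assumes g: "\<And>i. schwartz (\<lambda>x. g x $ i)" and p: "p \<ge> 1"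
  shows "Lp_norm p g < \<infinity>"
proof -
  obtain C1 where C1: "C1 \<ge> 0" "\<And>x. (1 + norm x) ^ 4 * norm (g x $ 1) \<le> C1" using schwartz_rapid[OF g] by (rule rapidE) blast
  obtain C2 where C2: "C2 \<ge> 0" "\<And>x. (1 + norm x) ^ 4 * norm (g x $ 2) \<le> C2" using schwartz_rapid[OF g] by (rule rapidE) blast
  define C where "C = C1 + C2"
  have C0: "C \<ge> 0" using C1 C2 by (simp add: C_def)
  have b: "norm (g x) powr p \<le> C powr p * (1 / (1 + norm x) ^ 4)" for x
  proof -
    have "norm (g x) \<le> norm (g x $ 1) + norm (g x $ 2)"
      using L2_set_le_sum[of UNIV "\<lambda>i. norm (g x $ i)"] by (simp add: norm_vec_def sum_2)
    then have "(1 + norm x) ^ 4 * norm (g x) \<le> (1 + norm x) ^ 4 * (norm (g x $ 1) + norm (g x $ 2))"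
      by (intro mult_left_mono) auto
    also have "\<dots> \<le> C" unfolding C_def distrib_left by (intro add_mono C1 C2)
    finally have "norm (g x) \<le> C * (1 / (1 + norm x) ^ 4)"
      by (simp add: pos_le_divide_eq mult.commute)
    then have "norm (g x) powr p \<le> (C * (1 / (1 + norm x) ^ 4)) powr p"
      using p by (intro powr_mono2) auto
    also have "\<dots> = C powr p * (1 / (1 + norm x) ^ 4) powr p"
      using C0 by (intro powr_mult)
    \<comment> \<open>The base is at most 1, so an exponent p \<ge> 1 only makes it smaller and the
      same integrable weight serves every p.\<close>
    also have "\<dots> \<le> C powr p * (1 / (1 + norm x) ^ 4) powr 1"
    proof (intro mult_left_mono powr_mono')
      show "1 / (1 + norm x) ^ 4 \<le> 1" by simp
    qed (use p in auto)
    finally show ?thesis by simp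
  qed
  have "(\<integral>\<^sup>+x. ennreal (norm (g x) powr p) \<partial>lborel) \<le> (\<integral>\<^sup>+x. ennreal (C powr p * (1 / (1 + norm (x :: real^2)) ^ 4)) \<partial>lborel)"
    by (intro nn_integral_mono ennreal_leI b)
  also have "\<dots> < \<infinity>"
  proof -
    have "integrable lborel (\<lambda>x::real^2. C powr p * (1 / (1 + norm x) ^ 4))"
      by (intro integrable_mult_right integrable_weight)
    then show ?thesis unfolding integrable_iff_bounded by simp
  qed
  finally show ?thesis unfolding Lp_norm_def Let_def by (simp add: less_top[symmetric])
qed

section \<open>The force and its Besov norm\<close>

context seed begin

text \<open>The negative Laplacian is built in, so that the linear part of the equation reproduces
  exactly \<eta> times the seed.\<close>

definition force_hat :: "2 \<Rightarrow> real^2 \<Rightarrow> complex" where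
  "force_hat i \<xi> = of_real ((norm \<xi>)\<^sup>2) * f i \<xi>"

definition force :: "real \<Rightarrow> distr^2" where
  "force \<eta> = (\<chi> i. fun_distr (\<lambda>x. of_real \<eta> * inv_fourier (force_hat i) x))"

lemma schwartz_force_hat: "schwartz (force_hat i)"
proof -
  have "slow (\<lambda>\<xi>::real^2. of_real ((norm \<xi>)\<^sup>2))" using slow_norm_sq[of 0] by simp
  then show ?thesis unfolding force_hat_def[abs_def] by (intro schwartz_mult f_schwartz)
qed

lemma schwartz_force: "schwartz (\<lambda>x. of_real \<eta> * inv_fourier (force_hat i) x)"
  by (intro schwartz_cmult schwartz_inv_fourier schwartz_force_hat)

lemma fourier_force: "fourier (\<lambda>x. of_real \<eta> * inv_fourier (force_hat i) x) \<xi> = of_real \<eta> * force_hat i \<xi>"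
  by (simp only: fourier_cmult fourier_inv_fourier[OF schwartz_force_hat])

lemma real_force: "real_distr (force \<eta> $ i)"
proof -
  have "cnj (inv_fourier (force_hat i) x) = inv_fourier (force_hat i) x" for x
    by (rule inv_fourier_real[OF _ _ schwartz_force_hat]) (simp_all add: force_hat_def f_real f_even)
  then show ?thesis unfolding force_def by (simp add: real_fun_distr)
qed

lemma f_m_index:
  assumes "f i \<xi> \<noteq> 0" "m j \<xi> \<noteq> 0" shows "j \<in> {-2..2}"
proof -
  have "2 powi (j - 1) \<le> (2 powi 1 :: real)" "2 powi (-1) \<le> (2 powi (j + 1) :: real)"
    using m_support[OF assms(2)] f_support[OF assms(1)] by (simp_all add: power_int_minus)
  then have "j - 1 \<le> 1" "-1 \<le> j + 1"
    using power_int_strict_increasing[of 1 "j - 1" "2::real"] power_int_strict_increasing[of "j + 1" "-1" "2::real"]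
    by linarith+
  then show ?thesis by simp
qed

lemma f_zero [simp]: "f i 0 = 0"
  using f_support[of i 0] by auto

text \<open>Two forms of one pairing: the frequency form is convenient for summing over blocks, the
  spatial form exhibits the function whose L^p norm is to be taken.\<close>

lemma LP_block_force:
  assumes \<phi>: "schwartz \<phi>"
  shows "LP_block \<Phi> j (force \<eta> $ i) \<phi> = of_real \<eta> * (LINT \<xi>|lborel. force_hat i \<xi> * (m j \<xi> * inv_fourier \<phi> \<xi>))"
    "LP_block \<Phi> j (force \<eta> $ i) \<phi> = (LINT x|lborel. (of_real \<eta> * inv_fourier (\<lambda>\<xi>. m j \<xi> * force_hat i \<xi>) x) * \<phi> x)"
proof -
  let ?\<theta> = "inv_fourier \<phi>"
  have \<theta>: "schwartz ?\<theta>" "fourier ?\<theta> = \<phi>" using \<phi> by (simp_all add: schwartz_inv_fourier fourier_inv_fourier)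
  have s: "schwartz (\<lambda>\<xi>. m j \<xi> * ?\<theta> \<xi>)" "schwartz (\<lambda>\<xi>. m j \<xi> * force_hat i \<xi>)"
    by (intro schwartz_mult schwartz_slow schwartz_m \<theta> schwartz_force_hat)+
  have "LP_block \<Phi> j (force \<eta> $ i) \<phi> = (force \<eta> $ i) (fourier (\<lambda>\<xi>. m j \<xi> * ?\<theta> \<xi>))"
    using LP_block_fourier[OF \<theta>(1), of j "force \<eta> $ i"] by (simp only: \<theta>(2))
  also have "\<dots> = (LINT x|lborel. (of_real \<eta> * inv_fourier (force_hat i) x) * fourier (\<lambda>\<xi>. m j \<xi> * ?\<theta> \<xi>) x)"
    unfolding force_def fun_distr_def by simp
  also have "\<dots> = (LINT \<xi>|lborel. fourier (\<lambda>x. of_real \<eta> * inv_fourier (force_hat i) x) \<xi> * (m j \<xi> * ?\<theta> \<xi>))"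
    by (intro fourier_multiplication[symmetric] schwartz_integrable schwartz_force s)
  also have "\<dots> = (LINT \<xi>|lborel. of_real \<eta> * (force_hat i \<xi> * (m j \<xi> * ?\<theta> \<xi>)))"
    unfolding fourier_force by (simp only: mult.assoc)
  finally show 1: "LP_block \<Phi> j (force \<eta> $ i) \<phi> = of_real \<eta> * (LINT \<xi>|lborel. force_hat i \<xi> * (m j \<xi> * ?\<theta> \<xi>))"
    by (simp only: integral_mult_right_zero)
  have "(LINT \<xi>|lborel. force_hat i \<xi> * (m j \<xi> * ?\<theta> \<xi>)) = (LINT \<xi>|lborel. (m j \<xi> * force_hat i \<xi>) * ?\<theta> \<xi>)"
    by (intro Bochner_Integration.integral_cong refl) (simp only: mult_ac)
  also have "\<dots> = (LINT x|lborel. inv_fourier (\<lambda>\<xi>. m j \<xi> * force_hat i \<xi>) x * \<phi> x)"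
    by (rule integral_inv_fourier[OF s(2) \<phi>, symmetric])
  finally show "LP_block \<Phi> j (force \<eta> $ i) \<phi> = (LINT x|lborel. (of_real \<eta> * inv_fourier (\<lambda>\<xi>. m j \<xi> * force_hat i \<xi>) x) * \<phi> x)"
    unfolding 1 by (simp only: mult.assoc integral_mult_right_zero)
qed

lemma force_block_zero:
  assumes "j \<notin> {-2..2}" shows "m j \<xi> * force_hat i \<xi> = 0"
  using f_m_index[of i \<xi> j] assms by (auto simp: force_hat_def)

lemma force_has_sum:
  assumes \<phi>: "schwartz \<phi>"
  shows "((\<lambda>j. LP_block \<Phi> j (force \<eta> $ i) \<phi>) has_sum (force \<eta> $ i) \<phi>) UNIV"
proof (rule has_sum_finite_neutralI[of "{-2..2}"])
  let ?\<theta> = "inv_fourier \<phi>"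
  have \<theta>: "schwartz ?\<theta>" by (rule schwartz_inv_fourier[OF \<phi>])
  have sum1: "(\<Sum>j\<in>{-2..2}. force_hat i \<xi> * (m j \<xi> * ?\<theta> \<xi>)) = force_hat i \<xi> * ?\<theta> \<xi>" for \<xi>
  proof (cases "f i \<xi> = 0")
    case True
    then show ?thesis by (simp add: force_hat_def)
  next
    case False
    then have "\<xi> \<noteq> 0" by auto
    then have "(\<Sum>j\<in>{-2..2}. m j \<xi>) = 1" using f_m_index[OF False] by (intro sum_m_eq_1) auto
    moreover have "(\<Sum>j\<in>{-2..2}. force_hat i \<xi> * (m j \<xi> * ?\<theta> \<xi>)) = (\<Sum>j\<in>{-2..2}. m j \<xi>) * (force_hat i \<xi> * ?\<theta> \<xi>)"
      unfolding sum_distrib_right by (intro sum.cong refl) (simp only: mult_ac)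
    ultimately show ?thesis by simp
  qed
  have i: "integrable lborel (\<lambda>\<xi>. force_hat i \<xi> * (m j \<xi> * ?\<theta> \<xi>))" for j
    by (intro schwartz_integrable schwartz_mult schwartz_slow schwartz_m schwartz_force_hat \<theta>)
  have "(force \<eta> $ i) \<phi> = (LINT x|lborel. (of_real \<eta> * inv_fourier (force_hat i) x) * \<phi> x)"
    unfolding force_def fun_distr_def by simp
  also have "\<dots> = of_real \<eta> * (LINT x|lborel. inv_fourier (force_hat i) x * \<phi> x)"
    by (simp only: mult.assoc integral_mult_right_zero)
  also have "\<dots> = of_real \<eta> * (LINT \<xi>|lborel. force_hat i \<xi> * ?\<theta> \<xi>)"
    by (simp only: integral_inv_fourier[OF schwartz_force_hat \<phi>])
  also have "\<dots> = of_real \<eta> * (\<Sum>j\<in>{-2..2}. LINT \<xi>|lborel. force_hat i \<xi> * (m j \<xi> * ?\<theta> \<xi>))"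
    unfolding sum1[symmetric] by (subst Bochner_Integration.integral_sum) (use i in simp_all)
  also have "\<dots> = (\<Sum>j\<in>{-2..2}. LP_block \<Phi> j (force \<eta> $ i) \<phi>)"
    by (simp only: LP_block_force(1)[OF \<phi>] sum_distrib_left)
  finally show "(force \<eta> $ i) \<phi> = (\<Sum>j\<in>{-2..2}. LP_block \<Phi> j (force \<eta> $ i) \<phi>)" .
  show "LP_block \<Phi> j (force \<eta> $ i) \<phi> = 0" if "j \<in> UNIV - {-2..2}" for j
  proof -
    have "force_hat i \<xi> * (m j \<xi> * ?\<theta> \<xi>) = 0" for \<xi>
      using force_block_zero[of j \<xi> i] that by auto
    then show ?thesis unfolding LP_block_force(1)[OF \<phi>] by (simp only: Bochner_Integration.integral_zero mult_zero_right)
  qed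
qed auto

text \<open>At most five blocks are non-zero and each is linear in \<eta>, so the constant does not
  depend on \<eta>. This allows \<eta> to be a fixed multiple of \<epsilon> in the end.\<close>

lemma force_besov:
  assumes p: "p \<ge> 1"
  obtains B where "B \<ge> 0" "\<And>\<eta>. \<eta> > 0 \<Longrightarrow> besov_norm \<Phi> s p (force \<eta>) \<le> ennreal (\<eta> * B)"
proof -
  define G :: "int \<Rightarrow> real^2 \<Rightarrow> complex^2" where "G j x = (\<chi> i. inv_fourier (\<lambda>\<xi>. m j \<xi> * force_hat i \<xi>) x)" for j x
  have sG: "schwartz (\<lambda>x. G j x $ i)" for i j
    unfolding G_def by (simp add: schwartz_inv_fourier schwartz_mult schwartz_slow schwartz_m schwartz_force_hat)
  define c where "c j = enn2real (Lp_norm p (G j))" for j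
  have c: "Lp_norm p (G j) = ennreal (c j)" "c j \<ge> 0" for j
    using Lp_norm_schwartz_finite[OF sG p, of j] by (simp_all add: c_def less_top[symmetric])
  define B where "B = (\<Sum>j\<in>{-2..2::int}. 2 powr (s * of_int j) * c j)"
  have B0: "B \<ge> 0" unfolding B_def using c by (intro sum_nonneg) simp
  have "besov_norm \<Phi> s p (force \<eta>) \<le> ennreal (\<eta> * B)" if \<eta>: "\<eta> > 0" for \<eta>
  proof -
    define a where "a j = ennreal (2 powr (s * of_int j)) * dLp_norm p (\<chi> i. LP_block \<Phi> j (force \<eta> $ i))" for j :: int
    have d: "dLp_norm p (\<chi> i. LP_block \<Phi> j (force \<eta> $ i)) \<le> ennreal (\<eta> * c j)" for j
    proof -
      define g :: "real^2 \<Rightarrow> complex^2" where "g x = (\<chi> i. of_real \<eta> * inv_fourier (\<lambda>\<xi>. m j \<xi> * force_hat i \<xi>) x)" for x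
      have sg: "schwartz (\<lambda>x. of_real \<eta> * inv_fourier (\<lambda>\<xi>. m j \<xi> * force_hat i \<xi>) x)" for i
        by (intro schwartz_cmult schwartz_inv_fourier schwartz_mult schwartz_slow schwartz_m schwartz_force_hat)
      have "represents (\<lambda>x. g x $ i) (LP_block \<Phi> j (force \<eta> $ i))" for i
        using represents_fun_distr[OF sg[of i]] LP_block_force(2)[of _ j \<eta> i]
        unfolding represents_def fun_distr_def g_def by simp
      then have "dLp_norm p (\<chi> i. LP_block \<Phi> j (force \<eta> $ i)) \<le> Lp_norm p g"
        unfolding dLp_norm_def by (intro Inf_lower) auto
      also have "Lp_norm p g = ennreal \<eta> * Lp_norm p (G j)"
      proof (rule Lp_norm_scale[OF \<eta> p])
        have "(\<lambda>x. norm (G j x)) = (\<lambda>x. sqrt ((norm (G j x $ 1))\<^sup>2 + (norm (G j x $ 2))\<^sup>2))"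
          by (simp add: norm_vec_def L2_set_def sum_2)
        then show "(\<lambda>x. norm (G j x)) \<in> borel_measurable borel"
          using sG[THEN schwartz_measurable, of j] by simp
        fix x
        have "g x = \<eta> *\<^sub>R G j x"
          by (simp only: vec_eq_iff g_def G_def vector_scaleR_component vec_lambda_beta) (simp add: scaleR_conv_of_real)
        then show "norm (g x) = \<eta> * norm (G j x)" using \<eta> by simp
      qed
      also have "\<dots> = ennreal (\<eta> * c j)" using \<eta> c(2)[of j] by (simp add: c(1) ennreal_mult)
      finally show ?thesis .
    qed
    have c0: "c j = 0" if "j \<notin> {-2..2}" for j
    proof -
      have "G j = (\<lambda>x. 0)"
        unfolding G_def by (simp add: force_block_zero[OF that] inv_fourier_altdef fun_eq_iff vec_eq_iff)
      then show ?thesis using p by (simp add: c_def Lp_norm_def)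
    qed
    have "besov_norm \<Phi> s p (force \<eta>) = infsum a UNIV"
      unfolding besov_norm_def a_def ..
    also have "\<dots> = infsum a {-2..2}"
    proof (rule infsum_cong_neutral)
      fix j :: int assume "j \<in> UNIV - {-2..2}"
      then have "dLp_norm p (\<chi> i. LP_block \<Phi> j (force \<eta> $ i)) \<le> 0" using d[of j] c0[of j] by simp
      then show "a j = 0" by (simp add: a_def)
    qed auto
    also have "\<dots> = (\<Sum>j\<in>{-2..2}. a j)" by simp
    also have "\<dots> \<le> (\<Sum>j\<in>{-2..2::int}. ennreal (\<eta> * (2 powr (s * of_int j) * c j)))"
    proof (rule sum_mono)
      fix j :: int
      have "a j \<le> ennreal (2 powr (s * of_int j)) * ennreal (\<eta> * c j)"
        unfolding a_def by (intro mult_left_mono d) simp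
      also have "\<dots> = ennreal (\<eta> * (2 powr (s * of_int j) * c j))"
        using \<eta> c(2)[of j] by (simp add: ennreal_mult[symmetric] mult.left_commute)
      finally show "a j \<le> ennreal (\<eta> * (2 powr (s * of_int j) * c j))" .
    qed
    also have "\<dots> = ennreal (\<Sum>j\<in>{-2..2::int}. \<eta> * (2 powr (s * of_int j) * c j))"
      using \<eta> c(2) by (intro sum_ennreal) simp
    also have "(\<Sum>j\<in>{-2..2::int}. \<eta> * (2 powr (s * of_int j) * c j)) = \<eta> * B"
      by (simp only: B_def sum_distrib_left)
    finally show ?thesis .
  qed
  then show thesis using that B0 by blast
qed

lemma force_in_besov_space:
  assumes p: "p \<ge> 1" and \<eta>: "\<eta> > 0"
  shows "force \<eta> \<in> besov_space \<Phi> s p"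
proof -
  obtain B where B: "besov_norm \<Phi> s p (force \<eta>) \<le> ennreal (\<eta> * B)"
    using force_besov[OF p, of s] \<eta> by blast
  have "tempered (force \<eta> $ i)" for i
    unfolding force_def using tempered_fun_distr[OF schwartz_force] by simp
  then show ?thesis
    unfolding besov_space_def using force_has_sum le_less_trans[OF B ennreal_less_top] by simp
qed

end

section \<open>Estimates for a solution\<close>

text \<open>This is the Fourier multiplier of \<open>(-\<Delta>)\<^sup>-\<^sup>1 \<bbbP>\<close>; division by zero makes it vanish at the origin.\<close>

definition leray :: "(2 \<Rightarrow> real^2 \<Rightarrow> complex) \<Rightarrow> 2 \<Rightarrow> real^2 \<Rightarrow> complex" where
  "leray G i \<xi> = (G i \<xi> + \<i> * of_real (\<xi> $ i) *
    (\<Sum>k\<in>UNIV. \<i> * of_real (\<xi> $ k) * (G k \<xi> / of_real ((norm \<xi>)\<^sup>2)))) / of_real ((norm \<xi>)\<^sup>2)"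

text \<open>The constant 3 counts \<open>G i\<close> itself and the two summands of the divergence
  in the projection; orthogonality of the projection would only improve it.\<close>

lemma norm_leray_le:
  assumes "\<And>k. norm (G k \<xi>) \<le> norm \<xi> * C"
  shows "norm (leray G i \<xi>) \<le> 3 * C / norm \<xi>"
proof (cases "\<xi> = 0")
  case True
  then show ?thesis by (simp add: leray_def)
next
  case False
  define n where "n = norm \<xi>"
  have n: "n > 0" using False by (simp add: n_def)
  have x: "\<bar>\<xi> $ k\<bar> \<le> n" for k unfolding n_def by (rule component_le_norm_cart)
  have G: "norm (G k \<xi>) \<le> n * C" for k using assms unfolding n_def .
  have C: "C \<ge> 0" using order_trans[OF norm_ge_zero G[of 1]] n by (simp add: zero_le_mult_iff)
  have 1: "norm (\<i> * of_real (\<xi> $ k) * (G k \<xi> / of_real (n\<^sup>2))) \<le> C" for k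
  proof -
    have "norm (\<i> * of_real (\<xi> $ k) * (G k \<xi> / of_real (n\<^sup>2))) = \<bar>\<xi> $ k\<bar> * (norm (G k \<xi>) / n\<^sup>2)"
      using n by (simp add: norm_mult norm_divide norm_power)
    also have "\<dots> \<le> n * (n * C / n\<^sup>2)"
      using n by (intro mult_mono divide_right_mono x G) auto
    also have "\<dots> = C" using n by (simp add: power2_eq_square)
    finally show ?thesis .
  qed
  have "norm (\<Sum>k\<in>UNIV. \<i> * of_real (\<xi> $ k) * (G k \<xi> / of_real (n\<^sup>2))) \<le> C + C"
    unfolding sum_2 by (rule order_trans[OF norm_triangle_ineq add_mono[OF 1 1]])
  then have "\<bar>\<xi> $ i\<bar> * norm (\<Sum>k\<in>UNIV. \<i> * of_real (\<xi> $ k) * (G k \<xi> / of_real (n\<^sup>2))) \<le> n * (C + C)"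
    using n by (intro mult_mono x) auto
  then have "norm (\<i> * of_real (\<xi> $ i) * (\<Sum>k\<in>UNIV. \<i> * of_real (\<xi> $ k) * (G k \<xi> / of_real (n\<^sup>2)))) \<le> n * (C + C)"
    unfolding norm_mult by simp
  then have "norm (G i \<xi> + \<i> * of_real (\<xi> $ i) * (\<Sum>k\<in>UNIV. \<i> * of_real (\<xi> $ k) * (G k \<xi> / of_real (n\<^sup>2)))) \<le> n * C + n * (C + C)"
    by (intro order_trans[OF norm_triangle_ineq add_mono[OF G]])
  then have "norm (leray G i \<xi>) \<le> (n * C + n * (C + C)) / n\<^sup>2"
    unfolding leray_def norm_divide n_def[symmetric] using n by (simp add: norm_power divide_right_mono)
  also have "\<dots> = 3 * C / n" using n by (simp add: power2_eq_square field_simps)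
  finally show ?thesis by (simp only: n_def)
qed

lemma leray_measurable:
  assumes [measurable]: "\<And>k. G k \<in> borel_measurable borel"
  shows "leray G i \<in> borel_measurable borel"
  unfolding leray_def[abs_def] by measurable

lemma exhaust_int:
  assumes "finite J" shows "\<forall>\<^sub>F n in sequentially. J \<subseteq> {- int n..int n}"
proof -
  obtain N where N: "\<And>j. j \<in> J \<Longrightarrow> nat \<bar>j\<bar> \<le> N"
    using finite_nat_set_iff_bounded_le[of "(\<lambda>j. nat \<bar>j\<bar>) ` J"] assms by auto
  show ?thesis
  proof (rule eventually_sequentiallyI[of N])
    fix n assume "N \<le> n"
    then show "J \<subseteq> {- int n..int n}" using N by fastforce
  qed
qed

text \<open>Replaces the net of finite index sets by symmetric intervals, since dominated
  convergence is applied along sequences.\<close>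

lemma has_sum_int_LIMSEQ:
  fixes a :: "int \<Rightarrow> complex"
  assumes "(a has_sum s) UNIV" shows "(\<lambda>n. \<Sum>j\<in>{- int n..int n}. a j) \<longlonglongrightarrow> s"
proof -
  have "filterlim (\<lambda>n. {- int n..int n}) (finite_subsets_at_top UNIV) sequentially"
    unfolding filterlim_finite_subsets_at_top using exhaust_int by auto
  then show ?thesis using assms unfolding has_sum_def by (rule filterlim_compose[rotated])
qed

context lp begin

lemma adens_leray:
  assumes "\<And>k. adens (F $ k) (G k)"
  shows "adens (inv_neg_laplacian \<Phi> (helmholtz \<Phi> F $ i)) (leray G i)"
  unfolding leray_def[abs_def] by (intro adens_inv_neg_laplacian adens_helmholtz assms)

definition weighted_fat :: "int \<Rightarrow> real^2 \<Rightarrow> complex" where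
  "weighted_fat j \<xi> = fat j \<xi> / of_real (norm \<xi>)"

lemma fat_near_zero: "norm \<xi> < 2 powi (j - 3) \<Longrightarrow> fat j \<xi> = 0"
proof -
  assume a: "norm \<xi> < 2 powi (j - 3)"
  have "m l \<xi> = 0" if "l \<in> {j-2..j+2}" for l
  proof (rule m_near_zero)
    have "2 powi (j - 3) \<le> (2 powi (l - 1) :: real)" using that by (intro power_int_increasing) auto
    then show "norm \<xi> < 2 powi (l - 1)" using a by linarith
  qed
  then show ?thesis unfolding fat_def by (rule sum.neutral[rule_format])
qed

lemma weighted_fat_integrable: "integrable lborel (\<lambda>\<xi>. (norm (weighted_fat j \<xi>))\<^sup>2)"
proof -
  have "schwartz (\<lambda>\<xi>. (fat j \<xi> * cnj (fat j \<xi>)) / of_real ((norm \<xi>)\<^sup>2))"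
  proof (rule schwartz_divide_norm_sq)
    show "schwartz (\<lambda>\<xi>. fat j \<xi> * cnj (fat j \<xi>))"
      by (intro schwartz_mult schwartz_slow schwartz_cnj schwartz_fat)
    show "(2 powi (j - 3) :: real) > 0" by simp
    show "fat j \<xi> * cnj (fat j \<xi>) = 0" if "norm \<xi> < 2 powi (j - 3)" for \<xi>
      using fat_near_zero[OF that] by simp
  qed
  then have "integrable lborel (\<lambda>\<xi>. norm ((fat j \<xi> * cnj (fat j \<xi>)) / of_real ((norm \<xi>)\<^sup>2)))"
    by (intro integrable_norm schwartz_integrable)
  moreover have "norm ((fat j \<xi> * cnj (fat j \<xi>)) / of_real ((norm \<xi>)\<^sup>2)) = (norm (weighted_fat j \<xi>))\<^sup>2" for \<xi>
    unfolding weighted_fat_def norm_divide norm_mult by (simp add: power_divide power2_eq_square norm_mult)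
  ultimately show ?thesis by (simp only:)
qed

lemma weighted_fat_measurable: "weighted_fat j \<in> borel_measurable borel"
  unfolding weighted_fat_def[abs_def] using schwartz_measurable[OF schwartz_fat] by measurable

text \<open>In the plane the measure d\<xi> / |\<xi>|^2 is invariant under dilation, so every
  annulus carries the same weight. Hence a sum of pairings of blocks with 1/|\<xi>| is controlled by
  the sum of their L^2 norms alone.\<close>

lemma l2_weighted_fat: "l2 (weighted_fat j) = l2 (weighted_fat 0)"
proof -
  have [measurable]: "weighted_fat 0 \<in> borel_measurable borel" by (rule weighted_fat_measurable)
  have meas: "(\<lambda>x. (norm (weighted_fat 0 x))\<^sup>2) \<in> borel_measurable borel" by measurable
  define c :: real where "c = 2 powi (-j)"
  have c: "c > 0" by (simp add: c_def)
  have s: "c\<^sup>2 * (norm (weighted_fat 0 (c *\<^sub>R x)))\<^sup>2 = (norm (weighted_fat j x))\<^sup>2" for x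
    unfolding weighted_fat_def fat_scale[of j] c_def[symmetric] norm_divide norm_of_real abs_norm_cancel norm_scaleR
    using c by (simp add: power_divide power_mult_distrib)
  have "(LINT x|lborel. (norm (weighted_fat 0 x))\<^sup>2) = c\<^sup>2 *\<^sub>R (LINT x|lborel. (norm (weighted_fat 0 (c *\<^sub>R x)))\<^sup>2)"
    by (rule lborel_integral_scale[OF meas]) (use c in simp)
  also have "\<dots> = (LINT x|lborel. c\<^sup>2 * (norm (weighted_fat 0 (c *\<^sub>R x)))\<^sup>2)"
    by (simp only: real_scaleR_def integral_mult_right_zero)
  finally show ?thesis unfolding l2_def s by simp
qed

text \<open>A sequence of cutoffs away from 0 and infinity: bounded by 1, and eventually equal to 1
  at each non-zero frequency.\<close>

definition partition_sum :: "nat \<Rightarrow> real^2 \<Rightarrow> complex" where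
  "partition_sum n \<xi> = (\<Sum>j\<in>{- int n..int n}. m j \<xi>)"

lemma partition_sum_alt: "partition_sum n \<xi> = of_real (\<Sum>j\<in>{- int n..int n}. Re (m j \<xi>))"
  unfolding partition_sum_def of_real_sum by (intro sum.cong refl m_real(1))

lemma Re_sum_m_le_1:
  assumes "finite J" shows "(\<Sum>j\<in>J. Re (m j \<xi>)) \<le> 1"
proof (cases "\<xi> = 0")
  case False
  have "((\<lambda>j. Re (m j \<xi>)) has_sum Re 1) UNIV"
    by (rule has_sum_Re[OF m_has_sum[OF False]])
  then have "(\<Sum>j\<in>J. Re (m j \<xi>)) \<le> Re 1"
    by (rule has_sum_mono2[OF has_sum_finite[OF assms]]) (auto simp: m_real(2))
  then show ?thesis by simp
qed simp

lemma norm_partition_sum_le: "norm (partition_sum n \<xi>) \<le> 1"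
proof -
  have "0 \<le> (\<Sum>j\<in>{- int n..int n}. Re (m j \<xi>))" by (intro sum_nonneg m_real(2))
  then show ?thesis unfolding partition_sum_alt norm_of_real using Re_sum_m_le_1[of "{- int n..int n}" \<xi>] by simp
qed

lemma partition_sum_eventually:
  assumes "\<xi> \<noteq> 0" shows "\<forall>\<^sub>F n in sequentially. partition_sum n \<xi> = 1"
proof -
  have "\<exists>j. m j \<xi> \<noteq> 0"
  proof -
    obtain t where "t > 0" "m 0 (t *\<^sub>R \<xi>) \<noteq> 0" using m0_nonzero_in_direction[OF assms] .
    show ?thesis
    proof (rule ccontr)
      assume "\<not> ?thesis"
      then have "(\<Sum>l\<in>{}. m l \<xi>) = 1" by (intro sum_m_eq_1 assms) auto
      then show False by simp
    qed
  qed
  then obtain j where j: "m j \<xi> \<noteq> 0" by blast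
  have "\<forall>\<^sub>F n in sequentially. {j-2..j+2} \<subseteq> {- int n..int n}" by (rule exhaust_int) simp
  then show ?thesis
  proof eventually_elim
    case (elim n)
    show ?case
      unfolding partition_sum_def using subsetD[OF elim m_overlap[OF j]] by (intro sum_m_eq_1 assms) simp_all
  qed
qed

end

text \<open>A hypothetical solution with its data unpacked. The size of its Besov norm enters only
  through the block bounds \<open>D\<close>, so the remaining argument takes place in L^2.\<close>

locale solution = seed +
  fixes p \<delta> \<eta> :: real and U :: "distr^2" and u :: "real^2 \<Rightarrow> complex^2" and W :: "distr^2^2" and D :: "int \<Rightarrow> real"
  assumes eta: "\<eta> > 0"
    and U_besov: "U \<in> besov_space \<Phi> (2/p - 1) p"
    and D_nonneg: "\<And>j. D j \<ge> 0"
    and D_sum: "\<And>J. finite J \<Longrightarrow> (\<Sum>j\<in>J. D j) \<le> \<delta>"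
    and D_block: "\<And>j i \<theta>. schwartz \<theta> \<Longrightarrow> norm (LP_block \<Phi> j (U $ i) (fourier \<theta>)) \<le> bernstein_const * D j * l2 \<theta>"
    and rep_u: "\<And>i. represents (\<lambda>x. u x $ i) (U $ i)"
    and rep_W: "\<And>i k. represents (\<lambda>x. u x $ i * u x $ k) (W $ i $ k)"
    and eqn: "\<And>i \<phi>. schwartz \<phi> \<Longrightarrow> (U $ i) \<phi> =
       inv_neg_laplacian \<Phi> (helmholtz \<Phi> (force \<eta>) $ i) \<phi>
       - inv_neg_laplacian \<Phi> (helmholtz \<Phi> (\<chi> l. ddiv (W $ l)) $ i) \<phi>"
begin

lemma delta_nonneg: "\<delta> \<ge> 0"
  using D_sum[of "{}"] by simp

lemma u_measurable [measurable]: "(\<lambda>x. u x $ i) \<in> borel_measurable borel"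
  using rep_u[of i] by (simp add: represents_def)

text \<open>The block bounds add up to an L^2 bound on the pairing of \<open>U\<close> with every
  test function, which duality transfers to the representing function.\<close>

lemma u_square_integrable: "integrable lborel (\<lambda>x. (norm (u x $ i))\<^sup>2)"
proof (rule L2_duality(1))
  show "integrable lborel (\<lambda>x. u x $ i * \<phi> x)" if "schwartz \<phi>" for \<phi>
    using rep_u[of i] that by (simp add: represents_def)
  show "norm (LINT x|lborel. u x $ i * \<phi> x) \<le> bernstein_const * \<delta> * sqrt (LINT x|lborel. (norm (\<phi> x))\<^sup>2)" if \<phi>: "schwartz \<phi>" for \<phi>
  proof -
    have s: "schwartz (inv_fourier \<phi>)" by (rule schwartz_inv_fourier[OF \<phi>])
    have "norm ((U $ i) (fourier (inv_fourier \<phi>))) \<le> bernstein_const * \<delta> * l2 (inv_fourier \<phi>)"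
      by (rule besov_l2_bound[OF U_besov s D_sum D_block[OF s]])
    also have "\<dots> \<le> bernstein_const * \<delta> * l2 \<phi>"
      using bernstein_const_pos delta_nonneg by (intro mult_left_mono l2_inv_fourier \<phi>) simp
    finally have "norm ((U $ i) \<phi>) \<le> bernstein_const * \<delta> * l2 \<phi>" by (simp only: fourier_inv_fourier[OF \<phi>])
    then show ?thesis using rep_u[of i] \<phi> by (simp add: represents_def l2_def)
  qed
  show "0 \<le> bernstein_const * \<delta>" using bernstein_const_pos delta_nonneg by simp
qed measurable

section \<open>The nonlinear term on the Fourier side\<close>

abbreviation u_comp :: "2 \<Rightarrow> real^2 \<Rightarrow> complex" where "u_comp i \<equiv> \<lambda>x. u x $ i"

definition energy :: real where "energy = (l2 (u_comp 1))\<^sup>2 + (l2 (u_comp 2))\<^sup>2"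

lemma energy_nonneg: "energy \<ge> 0" by (simp add: energy_def)

lemma uu_integrable: "integrable lborel (\<lambda>x. u x $ l * u x $ k)"
  by (intro l2_mult u_square_integrable) measurable

definition W_hat :: "2 \<Rightarrow> 2 \<Rightarrow> real^2 \<Rightarrow> complex" where
  "W_hat l k = fourier (\<lambda>x. u x $ l * u x $ k)"

lemma l2_u_comp_sq_le: "(l2 (u_comp l))\<^sup>2 \<le> energy"
  using exhaust_2[of l] by (auto simp: energy_def)

lemma norm_W_hat_le: "norm (W_hat l k \<xi>) \<le> energy"
proof -
  have "norm (W_hat l k \<xi>) \<le> (LINT x|lborel. norm (u x $ l * u x $ k))"
    unfolding W_hat_def by (rule norm_fourier_le[OF uu_integrable])
  also have "\<dots> \<le> l2 (u_comp l) * l2 (u_comp k)"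
    by (intro l2_mult u_square_integrable) measurable
  also have "\<dots> \<le> energy"
  proof -
    have "2 * l2 (u_comp l) * l2 (u_comp k) \<le> (l2 (u_comp l))\<^sup>2 + (l2 (u_comp k))\<^sup>2" by (rule sum_squares_bound)
    then show ?thesis using l2_u_comp_sq_le[of l] l2_u_comp_sq_le[of k] by linarith
  qed
  finally show ?thesis .
qed

lemma continuous_W_hat: "continuous_on UNIV (W_hat l k)"
  unfolding W_hat_def by (rule continuous_fourier[OF uu_integrable])

lemma W_hat_measurable [measurable]: "W_hat l k \<in> borel_measurable borel"
  by (rule borel_measurable_continuous_onI[OF continuous_W_hat])

definition div_W_hat :: "2 \<Rightarrow> real^2 \<Rightarrow> complex" where
  "div_W_hat l \<xi> = (\<Sum>k\<in>UNIV. \<i> * of_real (\<xi> $ k) * W_hat l k \<xi>)"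

lemma norm_div_W_hat_le:
  fixes a :: "2 \<Rightarrow> complex"
  assumes "\<And>k. norm (a k) \<le> energy"
  shows "norm (\<Sum>k\<in>UNIV. \<i> * of_real (\<xi> $ k) * a k) \<le> norm \<xi> * (2 * energy)"
proof -
  have 1: "norm (\<i> * of_real (\<xi> $ k) * a k) \<le> norm \<xi> * energy" for k
    unfolding norm_mult using component_le_norm_cart[of \<xi> k] assms[of k] by (simp add: mult_mono)
  have "norm (\<Sum>k\<in>UNIV. \<i> * of_real (\<xi> $ k) * a k) \<le> norm \<xi> * energy + norm \<xi> * energy"
    unfolding sum_2 by (rule order_trans[OF norm_triangle_ineq add_mono[OF 1 1]])
  also have "\<dots> = norm \<xi> * (2 * energy)" by simp
  finally show ?thesis .
qed

text \<open>The function called k in the overview.\<close>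

definition nonlinear_hat :: "2 \<Rightarrow> real^2 \<Rightarrow> complex" where
  "nonlinear_hat i = leray div_W_hat i"

lemma div_W_hat_measurable [measurable]: "div_W_hat l \<in> borel_measurable borel"
  unfolding div_W_hat_def[abs_def] by measurable

lemma nonlinear_hat_measurable [measurable]: "nonlinear_hat i \<in> borel_measurable borel"
  unfolding nonlinear_hat_def by (rule leray_measurable) measurable

lemma norm_nonlinear_hat_le: "norm (nonlinear_hat i \<xi>) \<le> 6 * energy / norm \<xi>"
proof -
  have "norm (div_W_hat l \<xi>) \<le> norm \<xi> * (2 * energy)" for l
    unfolding div_W_hat_def by (rule norm_div_W_hat_le) (rule norm_W_hat_le)
  from norm_leray_le[of div_W_hat \<xi>, OF this] show ?thesis unfolding nonlinear_hat_def by simp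
qed

text \<open>Divergence freeness removes the gradient part of the projection, and the factor
  |\<xi>|^2 in \<open>force_hat\<close> cancels the inverse Laplacian.\<close>

lemma leray_force: "leray (\<lambda>i \<xi>. of_real \<eta> * force_hat i \<xi>) i \<xi> = of_real \<eta> * f i \<xi>"
proof (cases "\<xi> = 0")
  case True
  then show ?thesis by (simp add: leray_def)
next
  case False
  define n where "n = complex_of_real ((norm \<xi>)\<^sup>2)"
  have n: "n \<noteq> 0" using False by (simp add: n_def)
  have c: "of_real \<eta> * (n * f k \<xi>) / n = of_real \<eta> * f k \<xi>" for k using n by simp
  have "(\<Sum>k\<in>UNIV. \<i> * of_real (\<xi> $ k) * (of_real \<eta> * (n * f k \<xi>) / n)) =
     \<i> * of_real \<eta> * (of_real (\<xi> $ 1) * f 1 \<xi> + of_real (\<xi> $ 2) * f 2 \<xi>)"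
    unfolding c sum_2 by (simp add: algebra_simps)
  then have "(\<Sum>k\<in>UNIV. \<i> * of_real (\<xi> $ k) * (of_real \<eta> * (n * f k \<xi>) / n)) = 0"
    by (simp only: f_div mult_zero_right)
  then have "leray (\<lambda>i \<xi>. of_real \<eta> * force_hat i \<xi>) i \<xi> = of_real \<eta> * (n * f i \<xi>) / n"
    unfolding leray_def force_hat_def n_def[symmetric] by (simp only: mult_zero_right add_0_right)
  then show ?thesis by (simp only: c)
qed

text \<open>The equation is tested with annular functions only; at this stage nothing is claimed
  about the transform of \<open>U\<close> at the origin.\<close>

lemma U_fourier:
  assumes \<psi>: "annular \<psi>"
  shows "integrable lborel (\<lambda>\<xi>. (of_real \<eta> * f i \<xi> - nonlinear_hat i \<xi>) * \<psi> \<xi>)"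
    "(U $ i) (fourier \<psi>) = (LINT \<xi>|lborel. (of_real \<eta> * f i \<xi> - nonlinear_hat i \<xi>) * \<psi> \<xi>)"
proof -
  have "adens (force \<eta> $ k) (\<lambda>\<xi>. of_real \<eta> * force_hat k \<xi>)" for k
    using adens_represents[OF schwartz_integrable[OF schwartz_force] represents_fun_distr[OF schwartz_force], of \<eta> k]
    by (simp only: force_def vec_lambda_beta fourier_force[abs_def])
  from adens_leray[OF this, of i]
  have 1: "integrable lborel (\<lambda>\<xi>. of_real \<eta> * f i \<xi> * \<psi> \<xi>)"
    "inv_neg_laplacian \<Phi> (helmholtz \<Phi> (force \<eta>) $ i) (fourier \<psi>) = (LINT \<xi>|lborel. of_real \<eta> * f i \<xi> * \<psi> \<xi>)"
    unfolding adens_def leray_force using \<psi> by blast+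
  have "adens ((\<chi> l. ddiv (W $ l)) $ l) (div_W_hat l)" for l
    unfolding div_W_hat_def[abs_def] W_hat_def vec_lambda_beta
    by (intro adens_ddiv adens_represents uu_integrable rep_W)
  from adens_leray[OF this, of i]
  have 2: "integrable lborel (\<lambda>\<xi>. nonlinear_hat i \<xi> * \<psi> \<xi>)"
    "inv_neg_laplacian \<Phi> (helmholtz \<Phi> (\<chi> l. ddiv (W $ l)) $ i) (fourier \<psi>) = (LINT \<xi>|lborel. nonlinear_hat i \<xi> * \<psi> \<xi>)"
    unfolding adens_def nonlinear_hat_def using \<psi> by blast+
  have e: "(\<lambda>\<xi>. (of_real \<eta> * f i \<xi> - nonlinear_hat i \<xi>) * \<psi> \<xi>) = (\<lambda>\<xi>. of_real \<eta> * f i \<xi> * \<psi> \<xi> - nonlinear_hat i \<xi> * \<psi> \<xi>)"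
    by (simp only: left_diff_distrib)
  show "integrable lborel (\<lambda>\<xi>. (of_real \<eta> * f i \<xi> - nonlinear_hat i \<xi>) * \<psi> \<xi>)"
    unfolding e by (rule Bochner_Integration.integrable_diff[OF 1(1) 2(1)])
  show "(U $ i) (fourier \<psi>) = (LINT \<xi>|lborel. (of_real \<eta> * f i \<xi> - nonlinear_hat i \<xi>) * \<psi> \<xi>)"
    unfolding e Bochner_Integration.integral_diff[OF 1(1) 2(1)] eqn[OF schwartz_fourier[OF annular_schwartz[OF \<psi>]]] 1(2) 2(2) ..
qed

section \<open>Square integrability of the nonlinear term\<close>

definition block_hat :: "int \<Rightarrow> 2 \<Rightarrow> real^2 \<Rightarrow> complex" where
  "block_hat j i \<xi> = (of_real \<eta> * f i \<xi> - nonlinear_hat i \<xi>) * m j \<xi>"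

lemma f_measurable [measurable]: "f i \<in> borel_measurable borel"
  by (rule schwartz_measurable[OF f_schwartz])

lemma m_measurable [measurable]: "m j \<in> borel_measurable borel"
  by (rule schwartz_measurable[OF schwartz_m])

lemma block_hat_measurable [measurable]: "block_hat j i \<in> borel_measurable borel"
  unfolding block_hat_def[abs_def] by measurable

lemma block_hat_pairing:
  assumes \<theta>: "schwartz \<theta>"
  shows "integrable lborel (\<lambda>\<xi>. block_hat j i \<xi> * \<theta> \<xi>)"
    "LP_block \<Phi> j (U $ i) (fourier \<theta>) = (LINT \<xi>|lborel. block_hat j i \<xi> * \<theta> \<xi>)"
  unfolding LP_block_fourier[OF \<theta>] block_hat_def mult.assoc
  by (rule U_fourier[OF annular_m[OF \<theta>]])+

text \<open>Duality is applied on the frequency side, where the block of \<open>U\<close> pairs as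
  an explicit function. The abstract block bound thus becomes a bound on that function.\<close>

lemma block_hat_square_integrable: "integrable lborel (\<lambda>\<xi>. (norm (block_hat j i \<xi>))\<^sup>2)"
  and block_hat_square_le: "(LINT \<xi>|lborel. (norm (block_hat j i \<xi>))\<^sup>2) \<le> (bernstein_const * D j)\<^sup>2"
proof -
  have b: "norm (LINT \<xi>|lborel. block_hat j i \<xi> * \<theta> \<xi>) \<le> bernstein_const * D j * sqrt (LINT x|lborel. (norm (\<theta> x))\<^sup>2)"
    if "schwartz \<theta>" for \<theta>
    using D_block[OF that, of j i] unfolding block_hat_pairing(2)[OF that] l2_def .
  have c: "0 \<le> bernstein_const * D j" using bernstein_const_pos D_nonneg by simp
  show "integrable lborel (\<lambda>\<xi>. (norm (block_hat j i \<xi>))\<^sup>2)"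
    by (rule L2_duality(1)[OF block_hat_measurable block_hat_pairing(1) b c])
  show "(LINT \<xi>|lborel. (norm (block_hat j i \<xi>))\<^sup>2) \<le> (bernstein_const * D j)\<^sup>2"
    by (rule L2_duality(2)[OF block_hat_measurable block_hat_pairing(1) b c])
qed

lemma l2_block_hat_le: "l2 (block_hat j i) \<le> bernstein_const * D j"
proof -
  have "0 \<le> bernstein_const * D j" using bernstein_const_pos D_nonneg by simp
  then show ?thesis
    using block_hat_square_le[of j i] unfolding l2_sq[symmetric] by (rule power2_le_imp_le[rotated])
qed

text \<open>The smallness parameter of order \<delta> + \<eta>. The first summand collects the
  blocks of \<open>U\<close>; the second pays for removing \<eta> f, where the factor 2 comes from
  |\<xi>| \<ge> 1/2 on the support of the seed.\<close>

definition tau :: "2 \<Rightarrow> real" where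
  "tau i = bernstein_const * l2 (weighted_fat 0) * \<delta> + 2 * \<eta> * (LINT \<xi>|lborel. norm (f i \<xi>))"

text \<open>Where \<open>m j\<close> does not vanish the widened symbol is 1, so the product of
  \<open>block_hat\<close> and \<open>weighted_fat\<close> is exactly (\<eta> f - k) m_j / |\<xi>|.
  The triangle inequality then isolates k at the price of \<eta> |f| / |\<xi>|.\<close>

lemma nonlinear_hat_block_le:
  "norm (nonlinear_hat i \<xi>) / norm \<xi> * Re (m j \<xi>) \<le> norm (block_hat j i \<xi> * weighted_fat j \<xi>) + 2 * \<eta> * (norm (f i \<xi>) * Re (m j \<xi>))"
proof (cases "m j \<xi> = 0")
  case True
  then show ?thesis by simp
next
  case False
  then have \<xi>: "norm \<xi> > 0" by auto
  define r where "r = Re (m j \<xi>)"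
  have mr: "m j \<xi> = of_real r" and r0: "r \<ge> 0" unfolding r_def by (rule m_real)+
  have "fat j \<xi> = 1" using m_fat[of j \<xi>] False by simp
  then have h: "norm (block_hat j i \<xi> * weighted_fat j \<xi>) = norm (of_real \<eta> * f i \<xi> - nonlinear_hat i \<xi>) * r / norm \<xi>"
    unfolding block_hat_def weighted_fat_def mr using r0 by (simp add: norm_mult norm_divide)
  have fx: "norm (f i \<xi>) / norm \<xi> \<le> 2 * norm (f i \<xi>)"
  proof (cases "f i \<xi> = 0")
    case False
    then have "1 \<le> 2 * norm \<xi>" using f_support[of i \<xi>] by simp
    then have "1 * norm (f i \<xi>) \<le> 2 * norm \<xi> * norm (f i \<xi>)" by (intro mult_right_mono) auto
    then show ?thesis using \<xi> by (simp add: pos_divide_le_eq mult_ac)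
  qed simp
  have "norm (nonlinear_hat i \<xi>) \<le> norm (of_real \<eta> * f i \<xi> - nonlinear_hat i \<xi>) + norm (of_real \<eta> * f i \<xi>)"
    using norm_triangle_ineq4[of "of_real \<eta> * f i \<xi>" "of_real \<eta> * f i \<xi> - nonlinear_hat i \<xi>"] by (simp add: add.commute)
  also have "norm (of_real \<eta> * f i \<xi>) = \<eta> * norm (f i \<xi>)" using eta by (simp add: norm_mult)
  finally have "norm (nonlinear_hat i \<xi>) * (r / norm \<xi>) \<le> (norm (of_real \<eta> * f i \<xi> - nonlinear_hat i \<xi>) + \<eta> * norm (f i \<xi>)) * (r / norm \<xi>)"
    using r0 by (intro mult_right_mono) auto
  also have "\<dots> = norm (of_real \<eta> * f i \<xi> - nonlinear_hat i \<xi>) * r / norm \<xi> + \<eta> * r * (norm (f i \<xi>) / norm \<xi>)"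
    by (simp add: algebra_simps add_divide_distrib)
  also have "\<dots> \<le> norm (of_real \<eta> * f i \<xi> - nonlinear_hat i \<xi>) * r / norm \<xi> + \<eta> * r * (2 * norm (f i \<xi>))"
    using eta r0 by (intro add_left_mono mult_left_mono fx) auto
  finally show ?thesis unfolding h r_def[symmetric] by (simp add: mult_ac)
qed

text \<open>One factor k is replaced by its pointwise bound and the other is split into blocks. The
  truncation keeps the sum finite while the square integrability of k is still unknown.\<close>

lemma nonlinear_hat_partial_le:
  "(norm (nonlinear_hat i \<xi>))\<^sup>2 * norm (partition_sum n \<xi>) \<le> 6 * energy *
    ((\<Sum>j\<in>{- int n..int n}. norm (block_hat j i \<xi> * weighted_fat j \<xi>)) + 2 * \<eta> * norm (f i \<xi>))"
proof -
  let ?J = "{- int n..int n}"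
  have s0: "0 \<le> (\<Sum>j\<in>?J. Re (m j \<xi>))" by (intro sum_nonneg m_real(2))
  have s1: "(\<Sum>j\<in>?J. Re (m j \<xi>)) \<le> 1" by (rule Re_sum_m_le_1) simp
  have ns: "norm (partition_sum n \<xi>) = (\<Sum>j\<in>?J. Re (m j \<xi>))"
    unfolding partition_sum_alt norm_of_real using s0 by simp
  have "(norm (nonlinear_hat i \<xi>))\<^sup>2 \<le> (6 * energy / norm \<xi>) * norm (nonlinear_hat i \<xi>)"
    unfolding power2_eq_square by (intro mult_right_mono norm_nonlinear_hat_le) simp
  then have "(norm (nonlinear_hat i \<xi>))\<^sup>2 * norm (partition_sum n \<xi>) \<le> (6 * energy / norm \<xi>) * norm (nonlinear_hat i \<xi>) * (\<Sum>j\<in>?J. Re (m j \<xi>))"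
    unfolding ns using s0 by (intro mult_right_mono)
  also have "\<dots> = 6 * energy * (\<Sum>j\<in>?J. norm (nonlinear_hat i \<xi>) / norm \<xi> * Re (m j \<xi>))"
    unfolding sum_distrib_left[symmetric] by simp
  also have "\<dots> \<le> 6 * energy * (\<Sum>j\<in>?J. norm (block_hat j i \<xi> * weighted_fat j \<xi>) + 2 * \<eta> * (norm (f i \<xi>) * Re (m j \<xi>)))"
    using energy_nonneg by (intro mult_left_mono sum_mono nonlinear_hat_block_le) simp
  also have "(\<Sum>j\<in>?J. norm (block_hat j i \<xi> * weighted_fat j \<xi>) + 2 * \<eta> * (norm (f i \<xi>) * Re (m j \<xi>)))
      = (\<Sum>j\<in>?J. norm (block_hat j i \<xi> * weighted_fat j \<xi>)) + 2 * \<eta> * (norm (f i \<xi>) * (\<Sum>j\<in>?J. Re (m j \<xi>)))"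
    by (simp only: sum.distrib sum_distrib_left)
  also have "6 * energy * \<dots> \<le> 6 * energy * ((\<Sum>j\<in>?J. norm (block_hat j i \<xi> * weighted_fat j \<xi>)) + 2 * \<eta> * norm (f i \<xi>))"
    using energy_nonneg eta s1 s0 by (intro mult_left_mono add_left_mono mult_right_le_one_le) auto
  finally show ?thesis .
qed

text \<open>The truncated integrals are bounded uniformly in \<open>n\<close>, and Fatou's lemma
  yields integrability together with the bound.\<close>

lemma nonlinear_hat_square_integrable: "integrable lborel (\<lambda>\<xi>. (norm (nonlinear_hat i \<xi>))\<^sup>2)"
  and nonlinear_hat_square_le: "(LINT \<xi>|lborel. (norm (nonlinear_hat i \<xi>))\<^sup>2) \<le> 6 * energy * tau i"
proof -
  let ?J = "\<lambda>n. {- int n..int n}"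
  let ?B = "\<lambda>n \<xi>. 6 * energy * ((\<Sum>j\<in>?J n. norm (block_hat j i \<xi> * weighted_fat j \<xi>)) + 2 * \<eta> * norm (f i \<xi>))"
  have hw: "integrable lborel (\<lambda>\<xi>. block_hat j i \<xi> * weighted_fat j \<xi>)"
    "(LINT \<xi>|lborel. norm (block_hat j i \<xi> * weighted_fat j \<xi>)) \<le> bernstein_const * l2 (weighted_fat 0) * D j" for j
  proof -
    show "integrable lborel (\<lambda>\<xi>. block_hat j i \<xi> * weighted_fat j \<xi>)"
      by (intro l2_mult block_hat_measurable weighted_fat_measurable block_hat_square_integrable weighted_fat_integrable)
    have "(LINT \<xi>|lborel. norm (block_hat j i \<xi> * weighted_fat j \<xi>)) \<le> l2 (block_hat j i) * l2 (weighted_fat j)"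
      by (intro l2_mult block_hat_measurable weighted_fat_measurable block_hat_square_integrable weighted_fat_integrable)
    also have "\<dots> \<le> bernstein_const * D j * l2 (weighted_fat 0)"
      unfolding l2_weighted_fat[of j] by (intro mult_right_mono l2_block_hat_le l2_nonneg)
    finally show "(LINT \<xi>|lborel. norm (block_hat j i \<xi> * weighted_fat j \<xi>)) \<le> bernstein_const * l2 (weighted_fat 0) * D j"
      by (simp only: mult_ac)
  qed
  have fi: "integrable lborel (\<lambda>\<xi>. norm (f i \<xi>))" by (intro integrable_norm schwartz_integrable f_schwartz)
  have iB: "integrable lborel (?B n)" for n
    by (intro integrable_mult_right Bochner_Integration.integrable_add Bochner_Integration.integrable_sum integrable_norm hw fi schwartz_integrable f_schwartz)
  have "(LINT \<xi>|lborel. ?B n \<xi>) = 6 * energy * ((\<Sum>j\<in>?J n. LINT \<xi>|lborel. norm (block_hat j i \<xi> * weighted_fat j \<xi>)) + 2 * \<eta> * (LINT \<xi>|lborel. norm (f i \<xi>)))" for n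
    using hw(1) fi by (simp add: Bochner_Integration.integral_sum)
  also have "6 * energy * ((\<Sum>j\<in>?J n. LINT \<xi>|lborel. norm (block_hat j i \<xi> * weighted_fat j \<xi>)) + 2 * \<eta> * (LINT \<xi>|lborel. norm (f i \<xi>))) \<le> 6 * energy * tau i" for n
  proof -
    have "(\<Sum>j\<in>?J n. LINT \<xi>|lborel. norm (block_hat j i \<xi> * weighted_fat j \<xi>)) \<le> (\<Sum>j\<in>?J n. bernstein_const * l2 (weighted_fat 0) * D j)"
      by (intro sum_mono hw)
    also have "\<dots> = bernstein_const * l2 (weighted_fat 0) * (\<Sum>j\<in>?J n. D j)" by (simp only: sum_distrib_left)
    also have "\<dots> \<le> bernstein_const * l2 (weighted_fat 0) * \<delta>"
      using bernstein_const_pos by (intro mult_left_mono D_sum) simp_all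
    finally show ?thesis unfolding tau_def using energy_nonneg by (intro mult_left_mono add_right_mono) simp_all
  qed
  finally have B: "(LINT \<xi>|lborel. ?B n \<xi>) \<le> 6 * energy * tau i" for n .
  have pm: "partition_sum n \<in> borel_measurable borel" for n
    unfolding partition_sum_def[abs_def] by measurable
  have le: "(\<integral>\<^sup>+\<xi>. ennreal ((norm (nonlinear_hat i \<xi>))\<^sup>2 * norm (partition_sum n \<xi>)) \<partial>lborel) \<le> ennreal (6 * energy * tau i)" for n
  proof -
    have "(\<integral>\<^sup>+\<xi>. ennreal ((norm (nonlinear_hat i \<xi>))\<^sup>2 * norm (partition_sum n \<xi>)) \<partial>lborel) \<le> (\<integral>\<^sup>+\<xi>. ennreal (?B n \<xi>) \<partial>lborel)"
      by (intro nn_integral_mono ennreal_leI nonlinear_hat_partial_le)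
    also have "\<dots> = ennreal (LINT \<xi>|lborel. ?B n \<xi>)"
      using energy_nonneg eta by (intro nn_integral_eq_integral iB AE_I2 mult_nonneg_nonneg add_nonneg_nonneg sum_nonneg) auto
    also have "\<dots> \<le> ennreal (6 * energy * tau i)" by (rule ennreal_leI[OF B])
    finally show ?thesis .
  qed
  have "(\<integral>\<^sup>+\<xi>. ennreal ((norm (nonlinear_hat i \<xi>))\<^sup>2) \<partial>lborel) = (\<integral>\<^sup>+\<xi>. liminf (\<lambda>n. ennreal ((norm (nonlinear_hat i \<xi>))\<^sup>2 * norm (partition_sum n \<xi>))) \<partial>lborel)"
  proof (rule nn_integral_cong)
    fix \<xi>
    have "(\<lambda>n. ennreal ((norm (nonlinear_hat i \<xi>))\<^sup>2 * norm (partition_sum n \<xi>))) \<longlonglongrightarrow> ennreal ((norm (nonlinear_hat i \<xi>))\<^sup>2)"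
    proof (cases "\<xi> = 0")
      case True
      \<comment> \<open>At the origin every \<open>partition_sum\<close> vanishes, but division by
        zero gives k the value 0 there, so the limit still holds.\<close>
      then have "nonlinear_hat i \<xi> = 0" using norm_nonlinear_hat_le[of i 0] by simp
      then show ?thesis by simp
    next
      case False
      show ?thesis
        by (rule tendsto_eventually, rule eventually_mono[OF partition_sum_eventually[OF False]]) simp
    qed
    then show "ennreal ((norm (nonlinear_hat i \<xi>))\<^sup>2) = liminf (\<lambda>n. ennreal ((norm (nonlinear_hat i \<xi>))\<^sup>2 * norm (partition_sum n \<xi>)))"
      by (rule lim_imp_Liminf[symmetric, rotated]) simp
  qed
  also have "\<dots> \<le> liminf (\<lambda>n. \<integral>\<^sup>+\<xi>. ennreal ((norm (nonlinear_hat i \<xi>))\<^sup>2 * norm (partition_sum n \<xi>)) \<partial>lborel)"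
    by (rule nn_integral_liminf) (use pm nonlinear_hat_measurable in measurable)
  also have "\<dots> \<le> limsup (\<lambda>n. \<integral>\<^sup>+\<xi>. ennreal ((norm (nonlinear_hat i \<xi>))\<^sup>2 * norm (partition_sum n \<xi>)) \<partial>lborel)"
    by (rule Liminf_le_Limsup) simp
  also have "\<dots> \<le> ennreal (6 * energy * tau i)"
    by (rule Limsup_bounded) (use le in simp)
  finally have fin: "(\<integral>\<^sup>+\<xi>. ennreal ((norm (nonlinear_hat i \<xi>))\<^sup>2) \<partial>lborel) \<le> ennreal (6 * energy * tau i)" .
  show int: "integrable lborel (\<lambda>\<xi>. (norm (nonlinear_hat i \<xi>))\<^sup>2)"
    unfolding integrable_iff_bounded using le_less_trans[OF fin ennreal_less_top] by simp
  have t0: "0 \<le> 6 * energy * tau i"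
    unfolding tau_def using energy_nonneg eta delta_nonneg bernstein_const_pos
    by (intro mult_nonneg_nonneg add_nonneg_nonneg integral_nonneg_AE AE_I2) simp_all
  have "ennreal (LINT \<xi>|lborel. (norm (nonlinear_hat i \<xi>))\<^sup>2) \<le> ennreal (6 * energy * tau i)"
    using fin nn_integral_eq_integral[OF int] by simp
  then show "(LINT \<xi>|lborel. (norm (nonlinear_hat i \<xi>))\<^sup>2) \<le> 6 * energy * tau i"
    using t0 by (simp add: ennreal_le_iff)
qed

end

text \<open>The multiplier has degree -2 and its argument degree 1, leaving degree -1. This is the
  critical degree in the plane: squared L^2 norms over dilated annuli are unchanged.\<close>

lemma leray_scale:
  assumes c: "c > 0" and G: "\<And>k. G k (c *\<^sub>R \<xi>) = of_real c * H k \<xi>"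
  shows "of_real c * leray G i (c *\<^sub>R \<xi>) = leray H i \<xi>"
proof (cases "\<xi> = 0")
  case True
  then show ?thesis by (simp add: leray_def)
next
  case False
  define n where "n = complex_of_real ((norm \<xi>)\<^sup>2)"
  have n: "n \<noteq> 0" using False by (simp add: n_def)
  define C where "C = complex_of_real c"
  have C: "C \<noteq> 0" using c by (simp add: C_def)
  have nc: "complex_of_real ((norm (c *\<^sub>R \<xi>))\<^sup>2) = C\<^sup>2 * n"
    unfolding norm_scaleR by (simp add: C_def n_def power_mult_distrib)
  have comp: "complex_of_real ((c *\<^sub>R \<xi>) $ k) = C * of_real (\<xi> $ k)" for k
    by (simp add: C_def)
  have s: "(\<Sum>k\<in>UNIV. \<i> * (C * of_real (\<xi> $ k)) * (C * H k \<xi> / (C\<^sup>2 * n))) = (\<Sum>k\<in>UNIV. \<i> * of_real (\<xi> $ k) * (H k \<xi> / n))"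
    using C n by (intro sum.cong refl) (simp add: power2_eq_square field_simps)
  show ?thesis
    unfolding leray_def G comp nc C_def[symmetric] n_def[symmetric] s
    using C n by (simp add: power2_eq_square field_simps)
qed

context seed begin

definition profile :: "2 \<Rightarrow> real^2 \<Rightarrow> complex" where
  "profile i = inv_fourier (f i)"

lemma schwartz_profile: "schwartz (profile i)"
  unfolding profile_def by (intro schwartz_inv_fourier f_schwartz)

text \<open>Both the profile and its transform are real, so Parseval's identity holds for them
  without conjugates and carries the anisotropy to the spatial side.\<close>

lemma profile_aniso: "(LINT x|lborel. profile 1 x * profile 1 x) \<noteq> (LINT x|lborel. profile 2 x * profile 2 x)"
proof -
  have "(LINT \<xi>|lborel. f i \<xi> * f i \<xi>) = of_real ((2 * pi)\<^sup>2) * (LINT x|lborel. profile i x * profile i x)" for i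
  proof -
    have "cnj (profile i x) = profile i x" for x
      unfolding profile_def by (rule inv_fourier_real) (simp_all add: f_real f_even f_schwartz)
    moreover have "fourier (profile i) = f i" unfolding profile_def by (rule fourier_inv_fourier[OF f_schwartz])
    ultimately show ?thesis
      using parseval[OF schwartz_profile[of i] schwartz_profile[of i]] by (simp only: f_real)
  qed
  then show ?thesis using f_aniso by auto
qed

end

section \<open>The perturbation in physical space\<close>

context solution begin

definition perturbation :: "2 \<Rightarrow> real^2 \<Rightarrow> complex" where
  "perturbation i x = u x $ i - of_real \<eta> * profile i x"

lemma profile_measurable [measurable]: "profile i \<in> borel_measurable borel"
  by (rule schwartz_measurable[OF schwartz_profile])

lemma perturbation_measurable [measurable]: "perturbation i \<in> borel_measurable borel"
  unfolding perturbation_def[abs_def] by measurable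

lemma nonlinear_hat_integrable_mult: "schwartz \<theta> \<Longrightarrow> integrable lborel (\<lambda>\<xi>. nonlinear_hat i \<xi> * \<theta> \<xi>)"
  by (intro l2_mult nonlinear_hat_measurable schwartz_measurable nonlinear_hat_square_integrable schwartz_square_integrable)

text \<open>Extends the Fourier formula across the origin. Square integrability of k makes the
  integral meaningful for every Schwartz function, and the requirement that \<open>U\<close> be the
  sum of its blocks rules out an additional part supported at 0, such as a polynomial.\<close>

lemma U_fourier_schwartz:
  assumes \<theta>: "schwartz \<theta>"
  shows "(U $ i) (fourier \<theta>) = of_real \<eta> * (LINT \<xi>|lborel. f i \<xi> * \<theta> \<xi>) - (LINT \<xi>|lborel. nonlinear_hat i \<xi> * \<theta> \<xi>)"
proof -
  let ?g = "\<lambda>\<xi>. (of_real \<eta> * f i \<xi> - nonlinear_hat i \<xi>) * \<theta> \<xi>"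
  have f\<theta>: "integrable lborel (\<lambda>\<xi>. f i \<xi> * \<theta> \<xi>)"
    by (intro schwartz_integrable schwartz_mult schwartz_slow f_schwartz \<theta>)
  note k\<theta> = nonlinear_hat_integrable_mult[OF \<theta>, of i]
  have g: "?g = (\<lambda>\<xi>. of_real \<eta> * (f i \<xi> * \<theta> \<xi>) - nonlinear_hat i \<xi> * \<theta> \<xi>)"
    by (simp only: left_diff_distrib mult.assoc)
  have ig: "integrable lborel ?g"
    unfolding g by (intro Bochner_Integration.integrable_diff integrable_mult_right f\<theta> k\<theta>)
  have "((\<lambda>j. LP_block \<Phi> j (U $ i) (fourier \<theta>)) has_sum (U $ i) (fourier \<theta>)) UNIV"
    using U_besov schwartz_fourier[OF \<theta>] unfolding besov_space_def by blast
  then have 1: "(\<lambda>n. \<Sum>j\<in>{- int n..int n}. LP_block \<Phi> j (U $ i) (fourier \<theta>)) \<longlonglongrightarrow> (U $ i) (fourier \<theta>)"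
    by (rule has_sum_int_LIMSEQ)
  have 2: "(\<Sum>j\<in>{- int n..int n}. LP_block \<Phi> j (U $ i) (fourier \<theta>)) = (LINT \<xi>|lborel. ?g \<xi> * partition_sum n \<xi>)" for n
  proof -
    have "(\<Sum>j\<in>{- int n..int n}. LP_block \<Phi> j (U $ i) (fourier \<theta>)) = (LINT \<xi>|lborel. (\<Sum>j\<in>{- int n..int n}. block_hat j i \<xi> * \<theta> \<xi>))"
      unfolding block_hat_pairing(2)[OF \<theta>]
      by (rule Bochner_Integration.integral_sum[symmetric]) (rule block_hat_pairing(1)[OF \<theta>])
    also have "(\<lambda>\<xi>. \<Sum>j\<in>{- int n..int n}. block_hat j i \<xi> * \<theta> \<xi>) = (\<lambda>\<xi>. ?g \<xi> * partition_sum n \<xi>)"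
      unfolding partition_sum_def sum_distrib_left block_hat_def by (simp only: mult_ac)
    finally show ?thesis .
  qed
  have 3: "(\<lambda>n. LINT \<xi>|lborel. ?g \<xi> * partition_sum n \<xi>) \<longlonglongrightarrow> (LINT \<xi>|lborel. ?g \<xi>)"
  proof (rule integral_dominated_convergence[where w = "\<lambda>\<xi>. norm (?g \<xi>)"])
    have pm: "partition_sum n \<in> borel_measurable borel" for n
      unfolding partition_sum_def[abs_def] by measurable
    show gm: "?g \<in> borel_measurable lborel" using borel_measurable_integrable[OF ig] .
    show "(\<lambda>\<xi>. ?g \<xi> * partition_sum n \<xi>) \<in> borel_measurable lborel" for n
      by (rule borel_measurable_times[OF gm]) (use pm in simp)
    show "integrable lborel (\<lambda>\<xi>. norm (?g \<xi>))" by (rule integrable_norm[OF ig])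
    show "AE \<xi> in lborel. norm (?g \<xi> * partition_sum n \<xi>) \<le> norm (?g \<xi>)" for n
      unfolding norm_mult[of "_ * _" "partition_sum _ _"] by (intro AE_I2 mult_right_le_one_le norm_ge_zero norm_partition_sum_le)
    have "AE \<xi> in lborel. \<xi> \<noteq> (0::real^2)" by (rule AE_lborel_singleton)
    then show "AE \<xi> in lborel. (\<lambda>n. ?g \<xi> * partition_sum n \<xi>) \<longlonglongrightarrow> ?g \<xi>"
    proof eventually_elim
      case (elim \<xi>)
      show ?case
        by (rule tendsto_eventually, rule eventually_mono[OF partition_sum_eventually[OF elim]]) simp
    qed
  qed
  have "(U $ i) (fourier \<theta>) = (LINT \<xi>|lborel. ?g \<xi>)"
    by (rule LIMSEQ_unique[OF 1]) (use 3 in \<open>simp only: 2\<close>)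
  also have "\<dots> = of_real \<eta> * (LINT \<xi>|lborel. f i \<xi> * \<theta> \<xi>) - (LINT \<xi>|lborel. nonlinear_hat i \<xi> * \<theta> \<xi>)"
    unfolding g using f\<theta> k\<theta> by simp
  finally show ?thesis .
qed

lemma perturbation_pairing:
  assumes \<phi>: "schwartz \<phi>"
  shows "integrable lborel (\<lambda>x. perturbation i x * \<phi> x)"
    "(LINT x|lborel. perturbation i x * \<phi> x) = - (LINT \<xi>|lborel. nonlinear_hat i \<xi> * inv_fourier \<phi> \<xi>)"
proof -
  have u: "integrable lborel (\<lambda>x. u x $ i * \<phi> x)" "(U $ i) \<phi> = (LINT x|lborel. u x $ i * \<phi> x)"
    using rep_u[of i] \<phi> by (auto simp: represents_def)
  have g: "integrable lborel (\<lambda>x. of_real \<eta> * (profile i x * \<phi> x))"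
    by (intro integrable_mult_right schwartz_integrable schwartz_mult schwartz_slow schwartz_profile \<phi>)
  have e: "(\<lambda>x. perturbation i x * \<phi> x) = (\<lambda>x. u x $ i * \<phi> x - of_real \<eta> * (profile i x * \<phi> x))"
    by (simp only: perturbation_def left_diff_distrib mult.assoc)
  show "integrable lborel (\<lambda>x. perturbation i x * \<phi> x)"
    unfolding e by (rule Bochner_Integration.integrable_diff[OF u(1) g])
  have "(LINT x|lborel. perturbation i x * \<phi> x) = (U $ i) \<phi> - of_real \<eta> * (LINT x|lborel. profile i x * \<phi> x)"
    unfolding e Bochner_Integration.integral_diff[OF u(1) g] u(2) integral_mult_right_zero ..
  also have "(LINT x|lborel. profile i x * \<phi> x) = (LINT \<xi>|lborel. f i \<xi> * inv_fourier \<phi> \<xi>)"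
    unfolding profile_def by (rule integral_inv_fourier[OF f_schwartz \<phi>])
  also have "(U $ i) \<phi> = of_real \<eta> * (LINT \<xi>|lborel. f i \<xi> * inv_fourier \<phi> \<xi>) - (LINT \<xi>|lborel. nonlinear_hat i \<xi> * inv_fourier \<phi> \<xi>)"
    using U_fourier_schwartz[OF schwartz_inv_fourier[OF \<phi>], of i] by (simp only: fourier_inv_fourier[OF \<phi>])
  finally show "(LINT x|lborel. perturbation i x * \<phi> x) = - (LINT \<xi>|lborel. nonlinear_hat i \<xi> * inv_fourier \<phi> \<xi>)" by simp
qed

text \<open>The perturbation pairs like minus the inverse transform of k, and that transform is a
  contraction on L^2; duality then carries the bound on k over to the spatial side.\<close>

lemma perturbation_square_integrable: "integrable lborel (\<lambda>x. (norm (perturbation i x))\<^sup>2)"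
  and perturbation_square_le: "(l2 (perturbation i))\<^sup>2 \<le> 6 * energy * tau i"
proof -
  have b: "norm (LINT x|lborel. perturbation i x * \<phi> x) \<le> l2 (nonlinear_hat i) * sqrt (LINT x|lborel. (norm (\<phi> x))\<^sup>2)" if \<phi>: "schwartz \<phi>" for \<phi>
  proof -
    let ?\<theta> = "inv_fourier \<phi>"
    have \<theta>: "schwartz ?\<theta>" by (rule schwartz_inv_fourier[OF \<phi>])
    have "norm (LINT x|lborel. perturbation i x * \<phi> x) = norm (LINT \<xi>|lborel. nonlinear_hat i \<xi> * ?\<theta> \<xi>)"
      by (simp only: perturbation_pairing[OF \<phi>] norm_minus_cancel)
    also have "\<dots> \<le> (LINT \<xi>|lborel. norm (nonlinear_hat i \<xi> * ?\<theta> \<xi>))" by (rule integral_norm_bound)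
    also have "\<dots> \<le> l2 (nonlinear_hat i) * l2 ?\<theta>"
      by (intro l2_mult nonlinear_hat_measurable schwartz_measurable nonlinear_hat_square_integrable schwartz_square_integrable \<theta>)
    also have "\<dots> \<le> l2 (nonlinear_hat i) * l2 \<phi>" by (intro mult_left_mono l2_inv_fourier \<phi> l2_nonneg)
    finally show ?thesis by (simp only: l2_def)
  qed
  show "integrable lborel (\<lambda>x. (norm (perturbation i x))\<^sup>2)"
    by (rule L2_duality(1)[OF perturbation_measurable perturbation_pairing(1) b l2_nonneg])
  have "(l2 (perturbation i))\<^sup>2 \<le> (l2 (nonlinear_hat i))\<^sup>2"
    unfolding l2_sq[of "perturbation i"] by (rule L2_duality(2)[OF perturbation_measurable perturbation_pairing(1) b l2_nonneg])
  then show "(l2 (perturbation i))\<^sup>2 \<le> 6 * energy * tau i"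
    using nonlinear_hat_square_le[of i] unfolding l2_sq[of "nonlinear_hat i"] by (rule order_trans)
qed

section \<open>Low frequencies\<close>

lemma D_tendsto_zero: "(\<lambda>n. D (- int n)) \<longlonglongrightarrow> 0"
proof (rule summable_LIMSEQ_zero, rule summableI_nonneg_bounded)
  fix n
  have "(\<Sum>i<n. D (- int i)) = (\<Sum>j\<in>(\<lambda>i. - int i) ` {..<n}. D j)"
    by (subst sum.reindex) (auto simp: inj_on_def)
  also have "\<dots> \<le> \<delta>" by (rule D_sum) simp
  finally show "(\<Sum>i<n. D (- int i)) \<le> \<delta>" .
qed (rule D_nonneg)

text \<open>The symbol of the divergence after zooming in by the factor \<open>c\<close>: the
  derivative is taken at \<xi> but the transform of \<open>W\<close> at c \<xi>. For c = 0 only the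
  integral of \<open>W\<close> is left, which is the leading term at the origin.\<close>

definition shifted_div :: "real \<Rightarrow> 2 \<Rightarrow> real^2 \<Rightarrow> complex" where
  "shifted_div c l \<xi> = (\<Sum>k\<in>UNIV. \<i> * of_real (\<xi> $ k) * W_hat l k (c *\<^sub>R \<xi>))"

lemma shifted_div_measurable [measurable]: "shifted_div c l \<in> borel_measurable borel"
  unfolding shifted_div_def[abs_def] by measurable

lemma norm_leray_shifted_le: "norm (leray (shifted_div c) i \<xi>) \<le> 6 * energy / norm \<xi>"
proof -
  have "norm (shifted_div c l \<xi>) \<le> norm \<xi> * (2 * energy)" for l
    unfolding shifted_div_def by (rule norm_div_W_hat_le) (rule norm_W_hat_le)
  from norm_leray_le[of "shifted_div c" \<xi>, OF this] show ?thesis by simp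
qed

text \<open>Outside the window of indices met by the seed, the block of \<open>U\<close> is minus
  the block of k. By critical scaling it can be moved to the unit annulus without changing its L^2
  norm, so \<open>D j\<close> bounds the zoomed multiplier there.\<close>

lemma shifted_div_square_small:
  assumes "j \<notin> {-2..2}"
  shows "(LINT \<xi>|lborel. (norm (leray (shifted_div (2 powi j)) i \<xi> * m 0 \<xi>))\<^sup>2) \<le> (bernstein_const * D j)\<^sup>2"
proof -
  define c :: real where "c = 2 powi j"
  have c: "c > 0" by (simp add: c_def)
  have bh: "norm (block_hat j i \<xi>) = norm (nonlinear_hat i \<xi> * m j \<xi>)" for \<xi>
  proof (cases "m j \<xi> = 0")
    case False
    then have "f i \<xi> = 0" using f_m_index[of i \<xi> j] assms by blast
    then show ?thesis by (simp add: block_hat_def norm_mult)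
  qed (simp add: block_hat_def)
  have mj: "m j (c *\<^sub>R \<xi>) = m 0 \<xi>" for \<xi>
    using m_scale[of j "c *\<^sub>R \<xi>"] by (simp add: c_def power_int_minus)
  have "div_W_hat l (c *\<^sub>R \<xi>) = of_real c * shifted_div c l \<xi>" for l \<xi>
    unfolding div_W_hat_def shifted_div_def sum_distrib_left by (intro sum.cong refl) simp
  from leray_scale[OF c, of div_W_hat, OF this]
  have k: "of_real c * nonlinear_hat i (c *\<^sub>R \<xi>) = leray (shifted_div c) i \<xi>" for \<xi> unfolding nonlinear_hat_def .
  have sq: "c\<^sup>2 * (norm (nonlinear_hat i (c *\<^sub>R \<xi>) * m j (c *\<^sub>R \<xi>)))\<^sup>2 = (norm (leray (shifted_div c) i \<xi> * m 0 \<xi>))\<^sup>2" for \<xi>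
    unfolding k[symmetric] mj using c by (simp add: norm_mult power_mult_distrib)
  have meas: "(\<lambda>\<xi>. (norm (nonlinear_hat i \<xi> * m j \<xi>))\<^sup>2) \<in> borel_measurable borel" by measurable
  have "(LINT \<xi>|lborel. (norm (block_hat j i \<xi>))\<^sup>2) = c\<^sup>2 *\<^sub>R (LINT \<xi>|lborel. (norm (nonlinear_hat i (c *\<^sub>R \<xi>) * m j (c *\<^sub>R \<xi>)))\<^sup>2)"
    unfolding bh by (rule lborel_integral_scale[OF meas]) (use c in simp)
  also have "\<dots> = (LINT \<xi>|lborel. (norm (leray (shifted_div c) i \<xi> * m 0 \<xi>))\<^sup>2)"
    unfolding sq[symmetric] by (simp only: real_scaleR_def integral_mult_right_zero)
  finally show ?thesis using block_hat_square_le[of j i] unfolding c_def by simp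
qed

text \<open>A majorant independent of \<open>c\<close>, which is what the limit of zooming in to the
  origin requires.\<close>

lemma leray_shifted_square_le:
  "(norm (leray (shifted_div c) i \<xi> * m 0 \<xi>))\<^sup>2 \<le> (6 * energy)\<^sup>2 * (norm (weighted_fat 0 \<xi>))\<^sup>2"
proof -
  have "norm (m 0 \<xi>) = norm (m 0 \<xi>) * norm (fat 0 \<xi>)" by (metis m_fat norm_mult)
  also have "\<dots> \<le> norm (fat 0 \<xi>)" by (intro mult_left_le_one_le norm_ge_zero norm_m_le)
  finally have "norm (leray (shifted_div c) i \<xi>) * norm (m 0 \<xi>) \<le> 6 * energy / norm \<xi> * norm (fat 0 \<xi>)"
    using energy_nonneg by (intro mult_mono norm_leray_shifted_le) simp_all
  then have "norm (leray (shifted_div c) i \<xi> * m 0 \<xi>) \<le> 6 * energy * norm (weighted_fat 0 \<xi>)"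
    unfolding weighted_fat_def by (simp add: norm_mult norm_divide)
  from power_mono[OF this norm_ge_zero, of 2] show ?thesis by (simp only: power_mult_distrib)
qed

text \<open>Zooming in along dyadic scales, the integrals on the unit annulus tend to that of the
  leading term, yet they are bounded by squares of summable numbers. A non-zero leading term would
  put the same L^2 mass into every low annulus, which is the failure of 1/|\<xi>| to be square
  integrable in dyadic form.\<close>

lemma leray_limit_zero: "(LINT \<xi>|lborel. (norm (leray (shifted_div 0) i \<xi> * m 0 \<xi>))\<^sup>2) = 0"
proof -
  define c where "c n = (2::real) powi (- int n)" for n :: nat
  have c0: "c \<longlonglongrightarrow> 0"
  proof -
    have "c = (\<lambda>n. (1/2) ^ n)"
      by (simp add: c_def power_int_minus power_int_of_nat power_one_over fun_eq_iff inverse_eq_divide)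
    then show ?thesis using LIMSEQ_realpow_zero[of "1/2"] by simp
  qed
  have lim: "(\<lambda>n. LINT \<xi>|lborel. (norm (leray (shifted_div (c n)) i \<xi> * m 0 \<xi>))\<^sup>2) \<longlonglongrightarrow> (LINT \<xi>|lborel. (norm (leray (shifted_div 0) i \<xi> * m 0 \<xi>))\<^sup>2)"
  proof (rule integral_dominated_convergence[where w = "\<lambda>\<xi>. (6 * energy)\<^sup>2 * (norm (weighted_fat 0 \<xi>))\<^sup>2"])
    have [measurable]: "leray (shifted_div s) i \<in> borel_measurable borel" for s
      by (rule leray_measurable) measurable
    show "(\<lambda>\<xi>. (norm (leray (shifted_div (c n)) i \<xi> * m 0 \<xi>))\<^sup>2) \<in> borel_measurable lborel" for n by measurable
    show "(\<lambda>\<xi>. (norm (leray (shifted_div 0) i \<xi> * m 0 \<xi>))\<^sup>2) \<in> borel_measurable lborel" by measurable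
    show "integrable lborel (\<lambda>\<xi>. (6 * energy)\<^sup>2 * (norm (weighted_fat 0 \<xi>))\<^sup>2)"
      by (intro integrable_mult_right weighted_fat_integrable)
    show "AE \<xi> in lborel. norm ((norm (leray (shifted_div (c n)) i \<xi> * m 0 \<xi>))\<^sup>2) \<le> (6 * energy)\<^sup>2 * (norm (weighted_fat 0 \<xi>))\<^sup>2" for n
      by (intro AE_I2) (simp only: real_norm_def abs_power2 leray_shifted_square_le)
    have w: "(\<lambda>n. W_hat l k (c n *\<^sub>R \<xi>)) \<longlonglongrightarrow> W_hat l k (0 *\<^sub>R \<xi>)" for l k \<xi>
      by (rule continuous_on_tendsto_compose[OF continuous_W_hat tendsto_scaleR[OF c0 tendsto_const]]) simp_all
    have s: "(\<lambda>n. shifted_div (c n) l \<xi>) \<longlonglongrightarrow> shifted_div 0 l \<xi>" for l \<xi>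
      unfolding shifted_div_def by (intro tendsto_sum tendsto_mult tendsto_const w)
    have "(\<lambda>n. leray (shifted_div (c n)) i \<xi>) \<longlonglongrightarrow> leray (shifted_div 0) i \<xi>" for \<xi>
      \<comment> \<open>The denominators do not depend on \<open>n\<close>; with division written as
        multiplication the limit also holds at \<xi> = 0.\<close>
      unfolding leray_def divide_inverse
      by (intro tendsto_mult tendsto_add tendsto_sum tendsto_const s)
    then show "AE \<xi> in lborel. (\<lambda>n. (norm (leray (shifted_div (c n)) i \<xi> * m 0 \<xi>))\<^sup>2) \<longlonglongrightarrow> (norm (leray (shifted_div 0) i \<xi> * m 0 \<xi>))\<^sup>2"
      by (intro AE_I2 tendsto_power tendsto_norm tendsto_mult tendsto_const)
  qed
  have zero: "(\<lambda>n. LINT \<xi>|lborel. (norm (leray (shifted_div (c n)) i \<xi> * m 0 \<xi>))\<^sup>2) \<longlonglongrightarrow> 0"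
  proof (rule tendsto_sandwich)
    show "\<forall>\<^sub>F n in sequentially. 0 \<le> (LINT \<xi>|lborel. (norm (leray (shifted_div (c n)) i \<xi> * m 0 \<xi>))\<^sup>2)"
      by (intro always_eventually allI integral_nonneg_AE AE_I2) simp
    show "\<forall>\<^sub>F n in sequentially. (LINT \<xi>|lborel. (norm (leray (shifted_div (c n)) i \<xi> * m 0 \<xi>))\<^sup>2) \<le> (bernstein_const * D (- int n))\<^sup>2"
      \<comment> \<open>From n = 3 on the index -n lies outside -2..2, so the seed no longer
        contributes.\<close>
      unfolding c_def by (intro eventually_sequentiallyI[of 3] shifted_div_square_small) simp
    have "(\<lambda>n. (bernstein_const * D (- int n))\<^sup>2) \<longlonglongrightarrow> (bernstein_const * 0)\<^sup>2"
      by (intro tendsto_power tendsto_mult tendsto_const D_tendsto_zero)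
    then show "(\<lambda>n. (bernstein_const * D (- int n))\<^sup>2) \<longlonglongrightarrow> 0" by simp
  qed simp
  show ?thesis by (rule LIMSEQ_unique[OF lim zero])
qed

end

context solution begin

lemma W_hat_symmetric: "W_hat l k = W_hat k l"
  unfolding W_hat_def by (simp only: mult.commute)

lemma W_hat_zero: "W_hat l k 0 = (LINT x|lborel. u x $ l * u x $ k)"
  unfolding W_hat_def fourier_def by simp

text \<open>Square integrability of \<open>U\<close> forces the limiting multiplier to vanish, and in the direction
  \<open>(1, 1)\<close> this says that the two diagonal entries of \<open>\<integral> U \<otimes> U\<close> agree.\<close>

lemma u_isotropic: "(LINT x|lborel. u x $ 1 * u x $ 1) = (LINT x|lborel. u x $ 2 * u x $ 2)"
proof -
  define H where "H l \<xi> = (\<Sum>k\<in>UNIV. \<i> * of_real (\<xi> $ k) * W_hat l k 0)" for l and \<xi> :: "real^2"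
  have H: "shifted_div 0 l \<xi> = H l \<xi>" for l \<xi>
    by (simp only: shifted_div_def H_def scaleR_zero_left)
  \<comment> \<open>Clearing both denominators leaves a polynomial, continuous at the origin too, so
    an identity valid almost everywhere can be evaluated at a point.\<close>
  define q where "q \<xi> = complex_of_real ((norm \<xi>)\<^sup>2) * H 1 \<xi> - of_real (\<xi> $ 1) * (\<Sum>k\<in>UNIV. of_real (\<xi> $ k) * H k \<xi>)" for \<xi>
  have q: "(of_real ((norm \<xi>)\<^sup>2))\<^sup>2 * leray (shifted_div 0) 1 \<xi> = q \<xi>" for \<xi>
  proof (cases "\<xi> = 0")
    case True
    then show ?thesis by (simp add: q_def)
  next
    case False
    define n where "n = complex_of_real ((norm \<xi>)\<^sup>2)"
    have n: "n \<noteq> 0" using False by (simp add: n_def)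
    define S where "S = (\<Sum>k\<in>UNIV. of_real (\<xi> $ k) * H k \<xi>)"
    have s: "(\<Sum>k\<in>UNIV. \<i> * of_real (\<xi> $ k) * (H k \<xi> / n)) = \<i> * S / n"
      unfolding S_def sum_2 by (simp add: distrib_left add_divide_distrib mult.assoc)
    have "n\<^sup>2 * ((a + \<i> * b * (\<i> * S / n)) / n) = n * a - b * S" for a b
      using n by (simp add: power2_eq_square field_simps)
    then show ?thesis
      unfolding leray_def H q_def n_def[symmetric] s S_def[symmetric] .
  qed
  have int: "integrable lborel (\<lambda>\<xi>. (norm (leray (shifted_div 0) 1 \<xi> * m 0 \<xi>))\<^sup>2)"
  proof (rule Bochner_Integration.integrable_bound[OF integrable_mult_right[OF weighted_fat_integrable[of 0], of "(6 * energy)\<^sup>2"]])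
    have [measurable]: "leray (shifted_div 0) 1 \<in> borel_measurable borel" by (rule leray_measurable) measurable
    show "(\<lambda>\<xi>. (norm (leray (shifted_div 0) 1 \<xi> * m 0 \<xi>))\<^sup>2) \<in> borel_measurable lborel" by measurable
    have "norm ((norm (leray (shifted_div 0) 1 \<xi> * m 0 \<xi>))\<^sup>2) \<le> norm ((6 * energy)\<^sup>2 * (norm (weighted_fat 0 \<xi>))\<^sup>2)" for \<xi>
      using leray_shifted_square_le[of 0 1 \<xi>] by simp
    then show "AE \<xi> in lborel. norm ((norm (leray (shifted_div 0) 1 \<xi> * m 0 \<xi>))\<^sup>2) \<le> norm ((6 * energy)\<^sup>2 * (norm (weighted_fat 0 \<xi>))\<^sup>2)"
      by (rule AE_I2)
  qed
  have "AE \<xi> in lborel. (norm (leray (shifted_div 0) 1 \<xi> * m 0 \<xi>))\<^sup>2 = 0"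
    using integral_nonneg_eq_0_iff_AE[OF int] leray_limit_zero[of 1] by simp
  then have "AE \<xi> in lborel. q \<xi> * m 0 \<xi> = 0"
  proof eventually_elim
    case (elim \<xi>)
    then have "leray (shifted_div 0) 1 \<xi> * m 0 \<xi> = 0" by simp
    then show ?case unfolding q[symmetric] by (simp only: mult.assoc mult_zero_right)
  qed
  moreover have "continuous_on UNIV (\<lambda>\<xi>. q \<xi> * m 0 \<xi>)"
    unfolding q_def H_def by (intro continuous_intros schwartz_continuous schwartz_m)
  ultimately have z: "q \<xi> * m 0 \<xi> = 0" for \<xi> by (rule continuous_AE_zero[rotated])
  define \<omega> :: "real^2" where "\<omega> = (\<chi> i. 1)"
  have "\<omega> \<noteq> 0" by (simp add: \<omega>_def vec_eq_iff)
  then obtain t where t: "t > 0" "m 0 (t *\<^sub>R \<omega>) \<noteq> 0" by (rule m0_nonzero_in_direction)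
  have "q (t *\<^sub>R \<omega>) = 0" using z[of "t *\<^sub>R \<omega>"] t(2) by simp
  moreover have c: "(t *\<^sub>R \<omega>) $ k = t" for k by (simp only: \<omega>_def vector_scaleR_component vec_lambda_beta real_scaleR_def mult_1_right)
  \<comment> \<open>On the diagonal both coordinates are equal, so the off-diagonal entries cancel
    by symmetry of \<open>W_hat\<close> and only the difference of the diagonal ones
    survives.\<close>
  have "q (t *\<^sub>R \<omega>) = \<i> * of_real t ^ 3 * (W_hat 1 1 0 - W_hat 2 2 0)"
    unfolding q_def H_def norm_sq_2 c sum_2 W_hat_symmetric[of 2 1] by (simp add: algebra_simps power2_eq_square power3_eq_cube)
  ultimately have "W_hat 1 1 0 = W_hat 2 2 0" using t(1) by simp
  then show ?thesis by (simp only: W_hat_zero)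
qed

section \<open>Comparison of energies and second moments\<close>

lemma u_eq: "u x $ i = perturbation i x + of_real \<eta> * profile i x"
  by (simp add: perturbation_def)

lemma energy_le: "energy \<le> 2 * ((l2 (perturbation 1))\<^sup>2 + (l2 (perturbation 2))\<^sup>2) + 2 * \<eta>\<^sup>2 * ((l2 (profile 1))\<^sup>2 + (l2 (profile 2))\<^sup>2)"
proof -
  have "(l2 (u_comp i))\<^sup>2 \<le> 2 * (l2 (perturbation i))\<^sup>2 + 2 * \<eta>\<^sup>2 * (l2 (profile i))\<^sup>2" for i
  proof -
    have ip: "integrable lborel (\<lambda>x. (norm (profile i x))\<^sup>2)" by (rule schwartz_square_integrable[OF schwartz_profile])
    have "(l2 (u_comp i))\<^sup>2 \<le> (LINT x|lborel. 2 * (norm (perturbation i x))\<^sup>2 + 2 * \<eta>\<^sup>2 * (norm (profile i x))\<^sup>2)"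
      unfolding l2_sq
    proof (rule integral_mono)
      show "(norm (u x $ i))\<^sup>2 \<le> 2 * (norm (perturbation i x))\<^sup>2 + 2 * \<eta>\<^sup>2 * (norm (profile i x))\<^sup>2" for x
      proof -
        have "norm (u x $ i) \<le> norm (perturbation i x) + \<eta> * norm (profile i x)"
          unfolding u_eq using norm_triangle_ineq[of "perturbation i x" "of_real \<eta> * profile i x"] eta by (simp add: norm_mult)
        then have "(norm (u x $ i))\<^sup>2 \<le> (norm (perturbation i x) + \<eta> * norm (profile i x))\<^sup>2" by (intro power_mono) auto
        also have "\<dots> \<le> 2 * (norm (perturbation i x))\<^sup>2 + 2 * (\<eta> * norm (profile i x))\<^sup>2"
          using sum_squares_bound[of "norm (perturbation i x)" "\<eta> * norm (profile i x)"] unfolding power2_sum by linarith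
        finally show ?thesis by (simp add: power_mult_distrib)
      qed
    qed (intro u_square_integrable Bochner_Integration.integrable_add integrable_mult_right perturbation_square_integrable ip)+
    also have "\<dots> = 2 * (l2 (perturbation i))\<^sup>2 + 2 * \<eta>\<^sup>2 * (l2 (profile i))\<^sup>2"
      unfolding l2_sq using perturbation_square_integrable[of i] ip by simp
    finally show ?thesis .
  qed
  from add_mono[OF this[of 1] this[of 2]] show ?thesis unfolding energy_def by (simp add: algebra_simps)
qed

text \<open>Young's inequality with parameter \<open>s\<close> splits the cross term: the profile
  receives the small factor \<open>s\<close>, while the perturbation, which is much smaller, pays
  1/s.\<close>

lemma u_moment:
  assumes s: "s > 0"
  shows "norm ((LINT x|lborel. u x $ i * u x $ i) - of_real (\<eta>\<^sup>2) * (LINT x|lborel. profile i x * profile i x))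
    \<le> s * \<eta>\<^sup>2 * (l2 (profile i))\<^sup>2 + (1 + 1 / s) * (l2 (perturbation i))\<^sup>2"
proof -
  have i1: "integrable lborel (\<lambda>x. perturbation i x * perturbation i x)" by (intro l2_mult perturbation_measurable perturbation_square_integrable)
  have i2: "integrable lborel (\<lambda>x. profile i x * perturbation i x)"
    by (intro l2_mult perturbation_measurable profile_measurable perturbation_square_integrable schwartz_square_integrable schwartz_profile)
  have i3: "integrable lborel (\<lambda>x. profile i x * profile i x)"
    by (intro l2_mult profile_measurable schwartz_square_integrable schwartz_profile)
  have "(\<lambda>x. u x $ i * u x $ i) = (\<lambda>x. perturbation i x * perturbation i x + (of_real (2 * \<eta>) * (profile i x * perturbation i x) + of_real (\<eta>\<^sup>2) * (profile i x * profile i x)))"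
    unfolding u_eq by (simp add: fun_eq_iff algebra_simps power2_eq_square)
  then have "(LINT x|lborel. u x $ i * u x $ i) = (LINT x|lborel. perturbation i x * perturbation i x) + (of_real (2 * \<eta>) * (LINT x|lborel. profile i x * perturbation i x) + of_real (\<eta>\<^sup>2) * (LINT x|lborel. profile i x * profile i x))"
    using i1 i2 i3 by simp
  then have e: "(LINT x|lborel. u x $ i * u x $ i) - of_real (\<eta>\<^sup>2) * (LINT x|lborel. profile i x * profile i x) = (LINT x|lborel. perturbation i x * perturbation i x) + of_real (2 * \<eta>) * (LINT x|lborel. profile i x * perturbation i x)"
    by simp
  have n1: "norm (LINT x|lborel. perturbation i x * perturbation i x) \<le> l2 (perturbation i) * l2 (perturbation i)"
    by (rule order_trans[OF integral_norm_bound]) (intro l2_mult perturbation_measurable perturbation_square_integrable)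
  have n2: "norm (LINT x|lborel. profile i x * perturbation i x) \<le> l2 (profile i) * l2 (perturbation i)"
    by (rule order_trans[OF integral_norm_bound])
      (intro l2_mult perturbation_measurable profile_measurable perturbation_square_integrable schwartz_square_integrable schwartz_profile)
  have "norm (of_real (2 * \<eta>) * (LINT x|lborel. profile i x * perturbation i x)) \<le> 2 * \<eta> * (l2 (profile i) * l2 (perturbation i))"
    unfolding norm_mult norm_of_real using n2 eta by (simp add: mult_left_mono)
  then have "norm ((LINT x|lborel. perturbation i x * perturbation i x) + of_real (2 * \<eta>) * (LINT x|lborel. profile i x * perturbation i x)) \<le> l2 (perturbation i) * l2 (perturbation i) + 2 * \<eta> * (l2 (profile i) * l2 (perturbation i))"
    by (rule norm_triangle_le[OF add_mono[OF n1]])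
  also have "2 * \<eta> * (l2 (profile i) * l2 (perturbation i)) \<le> s * (\<eta> * l2 (profile i))\<^sup>2 + (l2 (perturbation i))\<^sup>2 / s"
  proof -
    have "0 \<le> (s * (\<eta> * l2 (profile i)) - l2 (perturbation i))\<^sup>2 / s" using s by simp
    also have "\<dots> = s * (\<eta> * l2 (profile i))\<^sup>2 + (l2 (perturbation i))\<^sup>2 / s - 2 * \<eta> * (l2 (profile i) * l2 (perturbation i))"
      using s by (simp add: power2_eq_square field_simps)
    finally show ?thesis by simp
  qed
  finally show ?thesis unfolding e by (simp add: power2_eq_square algebra_simps)
qed

end

context solution begin

text \<open>The perturbation is bounded by the energy, and the energy by perturbation plus profile.
  The threshold 1/48 allows 24 t V \<le> V/2 to be absorbed, leaving V \<le> 48 t \<eta>^2 B.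
  Isotropy of \<open>u\<close> then expresses \<eta>^2 times the anisotropy as a difference of two
  moment errors, each side carrying \<eta>^2; after cancellation the thresholds involve only the
  seed.\<close>

lemma small_forcing_contradiction:
  fixes s t :: real
  defines "B \<equiv> (l2 (profile 1))\<^sup>2 + (l2 (profile 2))\<^sup>2"
  assumes tau: "\<And>i. tau i \<le> t" and t: "0 \<le> t" "t \<le> 1/48" and s: "s > 0" "48 * t * (1 + 1 / s) \<le> s"
    and big: "2 * s * B < norm ((LINT x|lborel. profile 1 x * profile 1 x) - (LINT x|lborel. profile 2 x * profile 2 x))"
  shows False
proof -
  define V where "V = (l2 (perturbation 1))\<^sup>2 + (l2 (perturbation 2))\<^sup>2"
  have V0: "V \<ge> 0" and B0: "B \<ge> 0" by (simp_all add: V_def B_def)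
  have "(l2 (perturbation i))\<^sup>2 \<le> 6 * energy * t" for i
    using perturbation_square_le[of i] mult_left_mono[OF tau[of i], of "6 * energy"] energy_nonneg by linarith
  from add_mono[OF this[of 1] this[of 2]] have "V \<le> 12 * t * energy" unfolding V_def by simp
  also have "\<dots> \<le> 12 * t * (2 * V + 2 * \<eta>\<^sup>2 * B)"
    using energy_le t unfolding V_def B_def by (intro mult_left_mono) auto
  also have "\<dots> = 24 * t * V + 24 * t * (\<eta>\<^sup>2 * B)" by (simp add: algebra_simps)
  also have "24 * t * V \<le> 1/2 * V" using t V0 by (intro mult_right_mono) auto
  finally have V: "V \<le> 48 * t * (\<eta>\<^sup>2 * B)" by simp
  let ?\<alpha> = "(LINT x|lborel. profile 1 x * profile 1 x) - (LINT x|lborel. profile 2 x * profile 2 x)"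
  let ?d = "\<lambda>i. (LINT x|lborel. u x $ i * u x $ i) - of_real (\<eta>\<^sup>2) * (LINT x|lborel. profile i x * profile i x)"
  have "of_real (\<eta>\<^sup>2) * ?\<alpha> = ?d 2 - ?d 1"
    unfolding u_isotropic by (simp add: algebra_simps)
  then have "norm (of_real (\<eta>\<^sup>2) * ?\<alpha>) \<le> norm (?d 2) + norm (?d 1)"
    by (simp only: norm_triangle_ineq4)
  also have "\<dots> \<le> (s * \<eta>\<^sup>2 * (l2 (profile 2))\<^sup>2 + (1 + 1 / s) * (l2 (perturbation 2))\<^sup>2) + (s * \<eta>\<^sup>2 * (l2 (profile 1))\<^sup>2 + (1 + 1 / s) * (l2 (perturbation 1))\<^sup>2)"
    by (intro add_mono u_moment s(1))
  also have "\<dots> = s * (\<eta>\<^sup>2 * B) + (1 + 1 / s) * V"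
    unfolding B_def V_def by (simp add: algebra_simps)
  also have "\<dots> \<le> s * (\<eta>\<^sup>2 * B) + (1 + 1 / s) * (48 * t * (\<eta>\<^sup>2 * B))"
    using s by (intro add_left_mono mult_left_mono V) simp
  also have "(1 + 1 / s) * (48 * t * (\<eta>\<^sup>2 * B)) = 48 * t * (1 + 1 / s) * (\<eta>\<^sup>2 * B)"
    by (simp only: mult_ac)
  also have "\<dots> \<le> s * (\<eta>\<^sup>2 * B)" using s(2) B0 by (intro mult_right_mono) simp_all
  finally have "norm (of_real (\<eta>\<^sup>2) * ?\<alpha>) \<le> \<eta>\<^sup>2 * (2 * s * B)" by (simp add: mult_ac)
  moreover have "norm (of_real (\<eta>\<^sup>2) * z) = \<eta>\<^sup>2 * norm z" for z :: complex
    by (simp add: norm_mult norm_power)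
  ultimately have "\<eta>\<^sup>2 * norm ?\<alpha> \<le> \<eta>\<^sup>2 * (2 * s * B)" by (simp only:)
  then have "norm ?\<alpha> \<le> 2 * s * B" by (rule mult_left_le_imp_le) (use eta in simp)
  then show False using big by linarith
qed

end

section \<open>Choice of the constants\<close>

theorem corollary1p4:
  fixes \<Phi> :: "int \<Rightarrow> real^2 \<Rightarrow> complex" and p :: real
  assumes "littlewood_paley \<Phi>" and "1 \<le> p" and "p \<le> 2"
  shows "\<exists>\<delta>\<^sub>0>0. \<exists>\<epsilon>\<^sub>0>0. \<forall>\<epsilon>. 0 < \<epsilon> \<and> \<epsilon> \<le> \<epsilon>\<^sub>0 \<longrightarrow>
    (\<exists>F :: distr^2.
       F \<in> besov_space \<Phi> (2/p - 3) p \<and>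
       (\<forall>i. real_distr (F $ i)) \<and>
       besov_norm \<Phi> (2/p - 3) p F < ennreal \<epsilon> \<and>
       \<not> (\<exists>U :: distr^2.
            besov_norm \<Phi> (2/p - 1) p U < ennreal \<delta>\<^sub>0 \<and>
            stationary_NS_solution \<Phi> (besov_space \<Phi> (2/p - 1) p) F U))"
proof -
  interpret lp \<Phi> by standard (rule assms(1))
  obtain f where "seed \<Phi> f" using seed_exists by blast
  then interpret seed \<Phi> f .
  obtain K where K: "K \<ge> 0" "\<And>\<eta>. \<eta> > 0 \<Longrightarrow> besov_norm \<Phi> (2/p - 3) p (force \<eta>) \<le> ennreal (\<eta> * K)"
    using force_besov[OF assms(2), of "2/p - 3"] by blast
  define B where "B = (l2 (profile 1))\<^sup>2 + (l2 (profile 2))\<^sup>2"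
  define \<alpha> where "\<alpha> = norm ((LINT x|lborel. profile 1 x * profile 1 x) - (LINT x|lborel. profile 2 x * profile 2 x))"
  have B: "B \<ge> 0" by (simp add: B_def)
  have \<alpha>: "\<alpha> > 0" using profile_aniso by (simp add: \<alpha>_def)
  \<comment> \<open>Makes 2 s B at most half of \<alpha>; the added 1 covers the division without
    knowing that B is positive.\<close>
  define s where "s = \<alpha> / (4 * (B + 1))"
  have s: "s > 0" using \<alpha> B by (simp add: s_def)
  have "2 * s * B = \<alpha> * (B / (2 * (B + 1)))" using B by (simp add: s_def field_simps)
  also have "\<dots> < \<alpha> * 1" using \<alpha> B by (intro mult_strict_left_mono) (simp_all add: divide_less_eq)
  finally have sB: "2 * s * B < \<alpha>" by simp
  \<comment> \<open>The first entry permits absorption of the perturbation, the second makes its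
    contribution to the moments no larger than that of the profile.\<close>
  define t where "t = min (1/48) (s / (48 * (1 + 1 / s)))"
  have s1: "1 + 1 / s > 0" using s by (simp add: add_pos_pos)
  have t: "t > 0" unfolding t_def min_less_iff_conj by (intro conjI divide_pos_pos mult_pos_pos s s1) simp_all
  have t48: "t \<le> 1/48" unfolding t_def by (rule min.cobounded1)
  have "t \<le> s / (48 * (1 + 1 / s))" unfolding t_def by (rule min.cobounded2)
  then have ts: "48 * t * (1 + 1 / s) \<le> s" using s1 by (simp add: pos_le_divide_eq mult_ac)
  define E where "E = bernstein_const * l2 (weighted_fat 0)"
  define L where "L = (LINT \<xi>|lborel. norm (f 1 \<xi>)) + (LINT \<xi>|lborel. norm (f 2 \<xi>))"
  have f0: "0 \<le> (LINT \<xi>|lborel. norm (f i \<xi>))" for i by (intro integral_nonneg_AE AE_I2) simp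
  have E: "E \<ge> 0" using bernstein_const_pos by (simp add: E_def)
  have L: "L \<ge> 0" "(LINT \<xi>|lborel. norm (f i \<xi>)) \<le> L" for i
    using f0 exhaust_2[of i] by (auto simp: L_def)
  have aux: "0 < a \<Longrightarrow> a * (t / (2 * a)) = t / 2" "0 < a \<Longrightarrow> 2 * (t / (4 * a)) * a = t / 2" for a
    by (simp_all add: field_simps)
  \<comment> \<open>The two summands of \<open>tau\<close> are each given the budget t/2: one
    through the size of the solution, the other through the size of the force.\<close>
  define \<delta>\<^sub>0 where "\<delta>\<^sub>0 = t / (2 * (E + 1))"
  define \<epsilon>\<^sub>0 where "\<epsilon>\<^sub>0 = t / (4 * (L + 1))"
  have \<delta>\<^sub>0: "\<delta>\<^sub>0 > 0" "E * \<delta>\<^sub>0 \<le> t / 2"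
  proof -
    show "\<delta>\<^sub>0 > 0" using t E by (simp add: \<delta>\<^sub>0_def)
    have "E * \<delta>\<^sub>0 \<le> (E + 1) * \<delta>\<^sub>0" using \<open>\<delta>\<^sub>0 > 0\<close> by (intro mult_right_mono) auto
    also have "\<dots> = t / 2" unfolding \<delta>\<^sub>0_def by (rule aux(1)) (use E in simp)
    finally show "E * \<delta>\<^sub>0 \<le> t / 2" .
  qed
  have \<epsilon>\<^sub>0: "\<epsilon>\<^sub>0 > 0" "2 * \<epsilon>\<^sub>0 * L \<le> t / 2"
  proof -
    show "\<epsilon>\<^sub>0 > 0" using t L(1) by (simp add: \<epsilon>\<^sub>0_def)
    have "2 * \<epsilon>\<^sub>0 * L \<le> 2 * \<epsilon>\<^sub>0 * (L + 1)" using \<open>\<epsilon>\<^sub>0 > 0\<close> by (intro mult_left_mono) auto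
    also have "\<dots> = t / 2" unfolding \<epsilon>\<^sub>0_def by (rule aux(2)) (use L(1) in simp)
    finally show "2 * \<epsilon>\<^sub>0 * L \<le> t / 2" .
  qed
  show ?thesis
  proof (rule exI[of _ \<delta>\<^sub>0], rule conjI[OF \<delta>\<^sub>0(1)], rule exI[of _ \<epsilon>\<^sub>0], rule conjI[OF \<epsilon>\<^sub>0(1)], intro allI impI)
    fix \<epsilon> assume \<epsilon>: "0 < \<epsilon> \<and> \<epsilon> \<le> \<epsilon>\<^sub>0"
    \<comment> \<open>Dividing by K + 1 rather than K gives both the strict norm bound \<eta> K <
      \<epsilon> and the inequality \<eta> \<le> \<epsilon>.\<close>
    define \<eta> where "\<eta> = \<epsilon> / (K + 1)"
    have \<eta>: "\<eta> > 0" using \<epsilon> K(1) by (simp add: \<eta>_def)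
    have "\<epsilon> * 1 \<le> \<epsilon> * (K + 1)" using \<epsilon> K(1) by (intro mult_left_mono) auto
    then have "\<eta> \<le> \<epsilon>" using K(1) by (simp add: \<eta>_def pos_divide_le_eq)
    then have \<eta>\<epsilon>: "\<eta> \<le> \<epsilon>\<^sub>0" using \<epsilon> by linarith
    have "\<eta> * K < \<eta> * (K + 1)" using \<eta> by (intro mult_strict_left_mono) auto
    also have "\<dots> = \<epsilon>" using K(1) by (simp add: \<eta>_def)
    finally have "besov_norm \<Phi> (2/p - 3) p (force \<eta>) < ennreal \<epsilon>"
      using K \<eta> by (intro le_less_trans[OF K(2)[OF \<eta>]]) (simp add: ennreal_less_iff)
    moreover have False
      if U: "besov_norm \<Phi> (2/p - 1) p U < ennreal \<delta>\<^sub>0"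
        and ns: "stationary_NS_solution \<Phi> (besov_space \<Phi> (2/p - 1) p) (force \<eta>) U" for U
    proof -
      obtain D where D: "\<And>j. D j \<ge> 0" "\<And>J. finite J \<Longrightarrow> (\<Sum>j\<in>J. D j) \<le> \<delta>\<^sub>0"
        "\<And>j i \<theta>. schwartz \<theta> \<Longrightarrow> norm (LP_block \<Phi> j (U $ i) (fourier \<theta>)) \<le> bernstein_const * D j * l2 \<theta>"
        using besov_blocks[OF assms(2,3) U] by blast
      obtain W where W: "is_tensor_square U W" "U \<in> besov_space \<Phi> (2/p - 1) p"
        "\<And>i \<phi>. schwartz \<phi> \<Longrightarrow> (U $ i) \<phi> = inv_neg_laplacian \<Phi> (helmholtz \<Phi> (force \<eta>) $ i) \<phi>
           - inv_neg_laplacian \<Phi> (helmholtz \<Phi> (\<chi> l. ddiv (W $ l)) $ i) \<phi>"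
        using ns unfolding stationary_NS_solution_def by blast
      obtain u where u: "\<And>i. represents (\<lambda>x. u x $ i) (U $ i)"
        "\<And>i k. represents (\<lambda>x. u x $ i * u x $ k) (W $ i $ k)"
        using W(1) unfolding is_tensor_square_def by blast
      interpret solution \<Phi> f p \<delta>\<^sub>0 \<eta> U u W D
        by unfold_locales (fact \<eta> W(2) D u W(3))+
      have "tau i \<le> t" for i
      proof -
        have "2 * \<eta> * (LINT \<xi>|lborel. norm (f i \<xi>)) \<le> 2 * \<epsilon>\<^sub>0 * L"
          using \<eta> \<eta>\<epsilon> f0 L(2) by (intro mult_mono) auto
        then show ?thesis using \<delta>\<^sub>0(2) \<epsilon>\<^sub>0(2) unfolding tau_def E_def[symmetric] by linarith
      qed
      then show False
        using t t48 s ts sB unfolding B_def \<alpha>_def by (intro small_forcing_contradiction[of t s]) auto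
    qed
    ultimately show "\<exists>F :: distr^2. F \<in> besov_space \<Phi> (2/p - 3) p \<and> (\<forall>i. real_distr (F $ i)) \<and>
       besov_norm \<Phi> (2/p - 3) p F < ennreal \<epsilon> \<and>
       \<not> (\<exists>U :: distr^2. besov_norm \<Phi> (2/p - 1) p U < ennreal \<delta>\<^sub>0 \<and>
            stationary_NS_solution \<Phi> (besov_space \<Phi> (2/p - 1) p) F U)"
      using force_in_besov_space[OF assms(2) \<eta>] real_force by blast
  qed
qed

end
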